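(* Let $\mathcal X=\xi\frac{\partial}{\partial x}+\sum_{(L,\alpha)}\eta^\alpha_L\frac{\partial}{\partial y^\alpha_L}$ be a Lie-Bäcklund field in $J^\infty(\mathbb R,\mathbb R^2)$ such that $\xi,\eta^0_1,\eta^0_2$ do not depend on $y^\gamma_K$ for $\gamma\ge2$, $K=1,2$. Suppose that the matrix $M=(M^K_L)$ is nonzero at the point $p=(\bar x,\bar y^0_1,\bar y^0_2,\bar y^1_1,\bar y^1_2)$ of $J^1(\mathbb R,\mathbb R^2)$ and that $$\text{(i)}\quad \sum_{P=1}^2M^R_P\frac{\partial\xi}{\partial y^1_P}=0,\qquad \sum_{P=1}^2M^R_P\frac{\partial\eta^0_L}{\partial y^1_P}=0,\qquad L,R=1,2,$$ $$\text{(ii)}\quad \sum_{P=1}^2Q^R_P\frac{\partial\xi}{\partial y^1_P}=0,\qquad \sum_{P=1}^2Q^R_P\frac{\partial\eta^0_L}{\partial y^1_P}=0,\qquad L,R=1,2.$$ Then $\mathcal X$ is exponentiable to a local flow $\Phi_t=(\Xi_t,H^\alpha_{Lt})$ that is defined on a set in $J^\infty(\mathbb R,\mathbb R^2)$ that projects to a neighborhood of $p$, and its components $\Xi_t$, $H^0_{Lt}$ ($L=1,2$) do not depend on $y^\gamma_K$, $\gamma\ge2$, $K=1,2$.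
   Context: $J^\infty(\mathbb R,\mathbb R^2)$ has coordinates $x$ and $y^\alpha_L$, $L\in\{1,2\}$, $\alpha\in\mathbb Z_{\ge0}$ (superscripts are derivative orders, not powers); $J^1(\mathbb R,\mathbb R^2)$ has coordinates $x,y^0_1,y^0_2,y^1_1,y^1_2$. Functions on (open parts of) $J^\infty$ are $C^\infty$ functions of finitely many coordinates; vector fields have such coefficients. $\mathbb D=\frac{\partial}{\partial x}+\sum_{L,\alpha}y_L^{\alpha+1}\frac{\partial}{\partial y^\alpha_L}$. The field $\mathcal X$ is Lie-Bäcklund if $\eta^{\alpha+1}_L=\mathbb D\eta^\alpha_L-y^{\alpha+1}_L\mathbb D\xi$ for all $L,\alpha$. It is exponentiable to the flow $\Phi_t=(\Xi_t,H^\alpha_{Lt})$ if $\Phi_t$ is a local map in (point, $t$) whose components are smooth, each depending on a finite set of coordinates that can be chosen independent of $t$ (each component may have its own domain, the preimage of an open set in a finite-dimensional coordinate space), with $\Phi_0=\mathrm{id}$, $\Phi_t\circ\Phi_s=\Phi_{t+s}$, $\frac{d}{dt}\Xi_t|_{t=0}=\xi$, $\frac{d}{dt}H^\alpha_{Lt}|_{t=0}=\eta^\alpha_L$ (identities between local maps are understood where defined). Define, for $L,K\in\{1,2\}$, $$O_L=\frac{\partial\eta^0_L}{\partial x}-y^1_L\frac{\partial\xi}{\partial x},\qquad N^K_L=\frac{\partial\eta^0_L}{\partial y^0_K}-y^1_L\frac{\partial\xi}{\partial y^0_K},\qquad M^K_L=\frac{\partial\eta^0_L}{\partial y^1_K}-y^1_L\frac{\partial\xi}{\partial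 y^1_K},$$ and, for $R,P\in\{1,2\}$, with $J,K,S$ summed over $\{1,2\}$, $$Q^R_P=\xi\frac{\partial M^R_P}{\partial x}+\sum_K\eta^0_K\frac{\partial M^R_P}{\partial y^0_K}+\sum_K\Big(O_K+\sum_Jy^1_JN^J_K\Big)\frac{\partial M^R_P}{\partial y^1_K}-\Big(\sum_SM^R_S\frac{\partial O_P}{\partial y^1_S}+\sum_JM^R_JN^J_P+\sum_{S,J}M^R_S\,y^1_J\frac{\partial N^J_P}{\partial y^1_S}\Big).$$ Conditions (i) and (ii) are identities of functions on the domain of the data. *)

theory Defs
  imports "HOL-Analysis.Analysis"
begin

section \<open>Smooth functions of finitely many coordinates\<close>

text \<open>
  A point is a function from an arbitrary index type to the reals, with the product topology.
  A set is the preimage of an open subset of \<open>\<real>\<^sup>F\<close> (\<open>F\<close> finite) iff it is open and membership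
  depends on the coordinates in \<open>F\<close> only; both are required in \<open>smooth_in\<close> below.
\<close>

definition pd :: "'i \<Rightarrow> (('i \<Rightarrow> real) \<Rightarrow> real) \<Rightarrow> ('i \<Rightarrow> real) \<Rightarrow> real" where
  "pd i f u = deriv (\<lambda>s. f (u(i := s))) (u i)"

definition depends_on :: "'i set \<Rightarrow> ('i \<Rightarrow> real) set \<Rightarrow> (('i \<Rightarrow> real) \<Rightarrow> real) \<Rightarrow> bool" where
  "depends_on F U f \<longleftrightarrow> (\<forall>u\<in>U. \<forall>v. (\<forall>i\<in>F. u i = v i) \<longrightarrow> v \<in> U \<and> f u = f v)"

text \<open>
  \<open>C\<^sup>\<infinity>\<close>: the iterated partial derivatives of every order exist and are continuous.
  Partial derivatives in directions outside \<open>F\<close> vanish.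
\<close>

definition smooth_in :: "'i set \<Rightarrow> ('i \<Rightarrow> real) set \<Rightarrow> (('i \<Rightarrow> real) \<Rightarrow> real) \<Rightarrow> bool" where
  "smooth_in F U f \<longleftrightarrow> finite F \<and> open U \<and> depends_on F U f \<and>
     (\<forall>is. continuous_on U (foldr pd is f) \<and>
           (\<forall>i. \<forall>u\<in>U. (\<lambda>s. foldr pd is f (u(i := s))) field_differentiable at (u i)))"


section \<open>Jets of maps from the line to the plane\<close>

text \<open>
  \<open>Cx\<close> is the independent variable and \<open>Cy L \<alpha>\<close> is the coordinate \<open>y\<^sup>\<alpha>\<^sub>L\<close>. The index set
  \<open>{1, 2}\<close> is the two-element type \<open>2\<close>, whose elements are \<open>1\<close> and \<open>2\<close> (the latter equal to \<open>0\<close>).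
\<close>

datatype coord = Cx | Cy 2 nat

type_synonym jet = "coord \<Rightarrow> real"

text \<open>A vector field is given by its components: \<open>X Cx\<close> is \<open>\<xi>\<close> and \<open>X (Cy L \<alpha>)\<close> is \<open>\<eta>\<^sup>\<alpha>\<^sub>L\<close>.\<close>

type_synonym field = "coord \<Rightarrow> jet \<Rightarrow> real"

definition jet1 :: "jet \<Rightarrow> real \<times> (real^2) \<times> (real^2)" where
  "jet1 u = (u Cx, (\<chi> L. u (Cy L 0)), (\<chi> L. u (Cy L 1)))"

definition J1_coords :: "coord set" where
  "J1_coords = insert Cx {Cy L \<alpha> | L \<alpha>. \<alpha> \<le> 1}"

definition vector_field_on :: "jet set \<Rightarrow> field \<Rightarrow> bool" where
  "vector_field_on U X \<longleftrightarrow> (\<forall>c. \<exists>F. smooth_in F U (X c))"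

text \<open>
  The series in the total derivative has only finitely many nonzero terms when \<open>f\<close> depends
  on finitely many coordinates, so it is summed over the indices of its nonzero terms.
\<close>

definition total_deriv :: "(jet \<Rightarrow> real) \<Rightarrow> jet \<Rightarrow> real" where
  "total_deriv f u = pd Cx f u +
     (\<Sum>(L, \<alpha>) | pd (Cy L \<alpha>) f u \<noteq> 0. u (Cy L (Suc \<alpha>)) * pd (Cy L \<alpha>) f u)"

definition Lie_Backlund_on :: "jet set \<Rightarrow> field \<Rightarrow> bool" where
  "Lie_Backlund_on U X \<longleftrightarrow> vector_field_on U X \<and>
     (\<forall>L \<alpha>. \<forall>u\<in>U. X (Cy L (Suc \<alpha>)) u =
        total_deriv (X (Cy L \<alpha>)) u - u (Cy L (Suc \<alpha>)) * total_deriv (X Cx) u)"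


section \<open>Local flows\<close>

text \<open>
  The component \<open>c\<close> of a time-dependent local map \<open>\<Phi>\<close> is \<open>\<lambda>t u. \<Phi> t u c\<close> on the domain \<open>W c\<close> in
  \<open>\<real> \<times> J\<^sup>\<infinity>\<close>; values outside the domain are irrelevant. To treat time as one more coordinate,
  functions of \<open>(t, u)\<close> are regarded as functions of points indexed by \<open>coord option\<close>,
  with \<open>None\<close> for time.
\<close>

definition joint_dom :: "(real \<times> jet) set \<Rightarrow> (coord option \<Rightarrow> real) set" where
  "joint_dom W = {w. (w None, w \<circ> Some) \<in> W}"

definition joint :: "(real \<Rightarrow> jet \<Rightarrow> real) \<Rightarrow> (coord option \<Rightarrow> real) \<Rightarrow> real" where
  "joint f w = f (w None) (w \<circ> Some)"

definition depends_on_time_and ::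
  "coord set \<Rightarrow> (real \<times> jet) set \<Rightarrow> (real \<Rightarrow> jet \<Rightarrow> real) \<Rightarrow> bool" where
  "depends_on_time_and F W f \<longleftrightarrow> depends_on (insert None (Some ` F)) (joint_dom W) (joint f)"

definition smooth_in_time_and ::
  "coord set \<Rightarrow> (real \<times> jet) set \<Rightarrow> (real \<Rightarrow> jet \<Rightarrow> real) \<Rightarrow> bool" where
  "smooth_in_time_and F W f \<longleftrightarrow> smooth_in (insert None (Some ` F)) (joint_dom W) (joint f)"

text \<open>
  The component \<open>c\<close> of \<open>\<Phi> t \<circ> \<Phi> s\<close> is defined at \<open>u\<close> as soon as those components of \<open>\<Phi> s u\<close> on which
  the component \<open>c\<close> of \<open>\<Phi>\<close> depends are defined and lie in the domain of the latter.
\<close>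

definition comp_defined ::
  "(coord \<Rightarrow> (real \<times> jet) set) \<Rightarrow> (real \<Rightarrow> jet \<Rightarrow> jet) \<Rightarrow> coord \<Rightarrow> real \<Rightarrow> real \<Rightarrow> jet \<Rightarrow> bool" where
  "comp_defined W \<Phi> c t s u \<longleftrightarrow>
     (\<exists>F. finite F \<and> depends_on_time_and F (W c) (\<lambda>t u. \<Phi> t u c) \<and>
          (\<forall>c'\<in>F. (s, u) \<in> W c') \<and> (t, \<Phi> s u) \<in> W c)"

definition exponentiable_to ::
  "jet set \<Rightarrow> field \<Rightarrow> (coord \<Rightarrow> (real \<times> jet) set) \<Rightarrow> (real \<Rightarrow> jet \<Rightarrow> jet) \<Rightarrow> bool" where
  "exponentiable_to U X W \<Phi> \<longleftrightarrow>
     (\<forall>c. \<exists>F. smooth_in_time_and F (W c) (\<lambda>t u. \<Phi> t u c)) \<and>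
     (\<forall>c u. (0, u) \<in> W c \<longrightarrow> \<Phi> 0 u c = u c) \<and>
     (\<forall>c t s u. comp_defined W \<Phi> c t s u \<and> (t + s, u) \<in> W c \<longrightarrow> \<Phi> t (\<Phi> s u) c = \<Phi> (t + s) u c) \<and>
     (\<forall>c. \<forall>u\<in>U. (0, u) \<in> W c \<longrightarrow> ((\<lambda>t. \<Phi> t u c) has_real_derivative X c u) (at 0))"

text \<open>The points at which all components of the flow are defined for all small times.\<close>

definition flow_dom :: "(coord \<Rightarrow> (real \<times> jet) set) \<Rightarrow> jet set" where
  "flow_dom W = {u. \<exists>\<epsilon>>0. \<forall>t. \<bar>t\<bar> < \<epsilon> \<longrightarrow> (\<forall>c. (t, u) \<in> W c)}"


section \<open>The matrices attached to a field\<close>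

text \<open>The superscript is the first index, the subscript the second: \<open>Mmat X K L\<close> is \<open>M\<^sup>K\<^sub>L\<close>.\<close>

definition Ovec :: "field \<Rightarrow> 2 \<Rightarrow> jet \<Rightarrow> real" where
  "Ovec X L u = pd Cx (X (Cy L 0)) u - u (Cy L 1) * pd Cx (X Cx) u"

definition Nmat :: "field \<Rightarrow> 2 \<Rightarrow> 2 \<Rightarrow> jet \<Rightarrow> real" where
  "Nmat X K L u = pd (Cy K 0) (X (Cy L 0)) u - u (Cy L 1) * pd (Cy K 0) (X Cx) u"

definition Mmat :: "field \<Rightarrow> 2 \<Rightarrow> 2 \<Rightarrow> jet \<Rightarrow> real" where
  "Mmat X K L u = pd (Cy K 1) (X (Cy L 0)) u - u (Cy L 1) * pd (Cy K 1) (X Cx) u"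

definition Qmat :: "field \<Rightarrow> 2 \<Rightarrow> 2 \<Rightarrow> jet \<Rightarrow> real" where
  "Qmat X R P u =
     X Cx u * pd Cx (Mmat X R P) u
     + (\<Sum>K\<in>UNIV. X (Cy K 0) u * pd (Cy K 0) (Mmat X R P) u)
     + (\<Sum>K\<in>UNIV. (Ovec X K u + (\<Sum>J\<in>UNIV. u (Cy J 1) * Nmat X J K u)) * pd (Cy K 1) (Mmat X R P) u)
     - ((\<Sum>S\<in>UNIV. Mmat X R S u * pd (Cy S 1) (Ovec X P) u)
        + (\<Sum>J\<in>UNIV. Mmat X R J u * Nmat X J P u)
        + (\<Sum>S\<in>UNIV. \<Sum>J\<in>UNIV. Mmat X R S u * u (Cy J 1) * pd (Cy S 1) (Nmat X J P) u))"

end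

theory Submission
  imports Defs
begin

text \<open>
  By (i), \<open>\<xi>\<close> and \<open>\<eta>\<^sup>0\<^sub>L\<close> are annihilated by a field \<open>\<partial>/\<partial>y\<^sup>1\<^sub>a + \<sigma> \<partial>/\<partial>y\<^sup>1\<^sub>b\<close> near \<open>p\<close>, and this forces
  it to annihilate \<open>\<sigma>\<close> as well. So its orbits in the \<open>y\<^sup>1\<close>-planes are straight lines, on which \<open>\<xi>\<close>, \<open>\<eta>\<^sup>0\<^sub>L\<close>
  and \<open>\<sigma>\<close> are constant. The four-dimensional quotient by these lines is the slice \<open>y\<^sup>1\<^sub>a = q\<close>, with
  coordinates \<open>x, y\<^sup>0\<^sub>1, y\<^sup>0\<^sub>2, z\<close>, and it carries the ordinary field
  \<open>V = (\<xi>, \<eta>\<^sup>0\<^sub>1, \<eta>\<^sup>0\<^sub>2, Y\<^sub>b - \<sigma> Y\<^sub>a)\<close> with \<open>Y\<^sub>P = O\<^sub>P + \<Sum>\<^sub>J y\<^sup>1\<^sub>J N\<^sup>J\<^sub>P\<close>, whose local flow is \<open>\<phi>\<close>.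
  Pulling \<open>\<phi>\<close> back along the projection \<open>Z\<close> to the quotient gives \<open>\<Xi>\<^sub>t\<close> and \<open>H\<^sup>0\<^sub>L\<^sub>t\<close>; the higher components
  are \<open>H\<^sup>\<alpha>\<^sup>+\<^sup>1 = \<D>H\<^sup>\<alpha> / \<D>\<Xi>\<close>. The group law amounts to \<open>Z \<circ> \<Phi>\<^sub>s = \<phi>\<^sub>s \<circ> Z\<close>. The defect of this
  identity is linear in the total derivatives of \<open>\<phi>\<^sub>s \<circ> Z\<close>, vanishes at \<open>s = 0\<close>, and by (ii), which says
  \<open>V \<sigma> = n\<^sub>a + \<sigma> n\<^sub>b\<close> with \<open>n\<^sub>K = N\<^sup>K\<^sub>b - \<sigma> N\<^sup>K\<^sub>a\<close>, it satisfies the linear equation \<open>f' = n\<^sub>b f\<close>.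
\<close>

section \<open>Calculus of functions of finitely many coordinates\<close>

text \<open>The equations do not close up on J^1, since eta^1_L = Y_L + sum_K y^2_K M^K_L raises the
  order. Subtracting y^1_L times the first family of (i) from the second gives M^2 = 0. A nonzero M
  is therefore nilpotent of rank one with some off-diagonal entry M^b_a nonzero, and its row M^b
  spans the direction (1, sigma). Moreover M^K_b = sigma M^K_a for both K, so the terms in y^2
  cancel from eta^1_b - sigma eta^1_a = Y_b - sigma Y_a. This is the rate of change of z = y^1_b -
  sigma (y^1_a - q) on the slice, whence the last component of V. Condition (ii) is a bracket
  condition: with A = xi d/dx + sum_K (eta^0_K d/dy^0_K + Y_K d/dy^1_K), the Q^R_P are the
  components along d/dy^1_P of the commutator of A with sum_P M^R_P d/dy^1_P. So (ii) keeps this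
  commutator tangent to the lines, and A descends to their quotient. The H^alpha arise by
  differentiating the flow with respect to its initial point, so smooth dependence on parameters is
  needed to every order.\<close>

lemma fun_upd_continuous: "continuous_on A (\<lambda>s::real. u(i := s))"
proof (rule continuous_on_coordinatewise_then_product)
  show "continuous_on A (\<lambda>s. (u(i := s)) j)" for j by (cases "j = i") (auto intro: continuous_intros)
qed

lemma open_vimage_fun_upd:
  assumes "open (U::('i \<Rightarrow> real) set)"
  shows "open ((\<lambda>s. u(i := s)) -` U)"
  using open_vimage[OF assms fun_upd_continuous] .

lemma eventually_fun_upd:
  assumes "open (U::('i \<Rightarrow> real) set)" and "u \<in> U"
  shows "\<forall>\<^sub>F s in nhds (u i). u(i := s) \<in> U"
proof -
  have "u i \<in> (\<lambda>s. u(i := s)) -` U" using assms by simp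
  then show ?thesis
    using eventually_nhds_in_open[OF open_vimage_fun_upd[OF assms(1)]] by fastforce
qed

lemma DERIV_fun_upd_cong:
  assumes "open U" and "u \<in> U" and "\<And>v. v \<in> U \<Longrightarrow> f v = g v"
  shows "((\<lambda>s. f (u(i := s))) has_real_derivative d) (at (u i)) \<longleftrightarrow>
         ((\<lambda>s. g (u(i := s))) has_real_derivative d) (at (u i))"
  by (rule DERIV_cong_ev)
    (use eventually_mono[OF eventually_fun_upd[OF assms(1,2), of i]] assms(3) in auto)

lemma pd_cong:
  assumes "open U" and "u \<in> U" and "\<And>v. v \<in> U \<Longrightarrow> f v = g v"
  shows "pd i f u = pd i g u"
  unfolding pd_def
  by (rule deriv_cong_ev)
    (use eventually_mono[OF eventually_fun_upd[OF assms(1,2), of i]] assms(3) in auto)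

lemma pd_eqI: "((\<lambda>s. f (u(i := s))) has_real_derivative d) (at (u i)) \<Longrightarrow> pd i f u = d"
  unfolding pd_def by (rule DERIV_imp_deriv)

section \<open>Cylinder sets and functions determined by a set of coordinates\<close>

lemma depends_onD:
  assumes "depends_on F U f" and "u \<in> U" and "\<And>i. i \<in> F \<Longrightarrow> u i = v i"
  shows "v \<in> U" and "f v = f u"
  using assms unfolding depends_on_def by metis+

lemma depends_on_mono: "depends_on F U f \<Longrightarrow> F \<subseteq> G \<Longrightarrow> depends_on G U f"
  unfolding depends_on_def by blast

text \<open>For a constant function \<open>depends_on\<close> speaks of the set alone: membership in
  \<open>U\<close> is decided by the coordinates in \<open>F\<close>. In this form, with the
  constant 0, conditions on domains are carried through the whole proof.\<close>

lemma depends_on_zeroI: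
  assumes "\<And>u v. u \<in> U \<Longrightarrow> (\<And>i. i \<in> F \<Longrightarrow> u i = v i) \<Longrightarrow> v \<in> U"
  shows "depends_on F U (\<lambda>_. 0)"
  using assms unfolding depends_on_def by blast

lemma depends_on_comp1: "depends_on F U f \<Longrightarrow> depends_on F U (\<lambda>u. h (f u))"
  unfolding depends_on_def by metis

lemma depends_on_comp2:
  "depends_on F U f \<Longrightarrow> depends_on F U g \<Longrightarrow> depends_on F U (\<lambda>u. h (f u) (g u))"
  unfolding depends_on_def by metis

text \<open>For \<open>i\<close> in \<open>F\<close>, points that agree on \<open>F\<close> give the
  same function of \<open>s\<close>; for other \<open>i\<close>, \<open>f\<close> is constant in
  direction \<open>i\<close> and both derivatives vanish.\<close>

lemma depends_on_pd:
  assumes "open U" and "depends_on F U f"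
  shows "depends_on F U (pd i f)"
  unfolding depends_on_def
proof (intro ballI allI impI conjI)
  fix u v assume u: "u \<in> U" and uv: "\<forall>i\<in>F. u i = v i"
  show v: "v \<in> U" using depends_onD[OF assms(2) u] uv by blast
  show "pd i f u = pd i f v"
  proof (cases "i \<in> F")
    case True
    have "\<forall>\<^sub>F s in nhds (u i). f (u(i := s)) = f (v(i := s))"
      using eventually_fun_upd[OF assms(1) u, of i]
    proof eventually_elim
      case (elim s)
      show ?case by (rule depends_onD(2)[OF assms(2) elim, symmetric]) (use uv in auto)
    qed
    then show ?thesis unfolding pd_def using True uv by (intro deriv_cong_ev) auto
  next
    case False
    have c: "pd i f w = 0" if w: "w \<in> U" for w
    proof (rule pd_eqI)
      have "(\<lambda>s. f (w(i := s))) = (\<lambda>s. f w)"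
      proof
        fix s show "f (w(i := s)) = f w"
          by (rule depends_onD(2)[OF assms(2) w]) (use False in auto)
      qed
      then show "((\<lambda>s. f (w(i := s))) has_real_derivative 0) (at (w i))" by simp
    qed
    show ?thesis using c[OF u] c[OF v] by simp
  qed
qed

lemma pd_outside:
  assumes "depends_on F U f" and "u \<in> U" and "i \<notin> F"
  shows "pd i f u = 0"
proof (rule pd_eqI)
  have "(\<lambda>s. f (u(i := s))) = (\<lambda>s. f u)"
  proof
    fix s show "f (u(i := s)) = f u"
      by (rule depends_onD(2)[OF assms(1,2)]) (use assms(3) in auto)
  qed
  then show "((\<lambda>s. f (u(i := s))) has_real_derivative 0) (at (u i))" by simp
qed

lemma pd_coord: "pd i (\<lambda>u. u j) u = (if i = j then 1 else 0)"
  by (rule pd_eqI) (auto intro!: derivative_eq_intros)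

text \<open>A version of \<open>smooth_in\<close> of finite order. It peels off one derivative at a
  time, so closure properties follow by induction on the order, and the results on differential
  equations can lose one derivative per step.\<close>

primrec ck :: "nat \<Rightarrow> 'i set \<Rightarrow> ('i \<Rightarrow> real) set \<Rightarrow> (('i \<Rightarrow> real) \<Rightarrow> real) \<Rightarrow> bool" where
  "ck 0 F U f \<longleftrightarrow> finite F \<and> open U \<and> depends_on F U f \<and> continuous_on U f"
| "ck (Suc n) F U f \<longleftrightarrow> (finite F \<and> open U \<and> depends_on F U f \<and> continuous_on U f) \<and>
     (\<forall>i. \<forall>u\<in>U. ((\<lambda>s. f (u(i := s))) has_real_derivative pd i f u) (at (u i))) \<and>
     (\<forall>i. ck n F U (pd i f))"

lemma ckD:
  assumes "ck n F U f"
  shows ck_finite: "finite F" and ck_open: "open U" and ck_depends: "depends_on F U f"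
    and ck_continuous: "continuous_on U f"
  using assms by (cases n; simp)+

lemma ck_pd: "ck (Suc n) F U f \<Longrightarrow> ck n F U (pd i f)"
  by simp

lemma ck_Suc_DERIV:
  "ck (Suc n) F U f \<Longrightarrow> u \<in> U \<Longrightarrow> ((\<lambda>s. f (u(i := s))) has_real_derivative pd i f u) (at (u i))"
  by simp

lemma ck_cong:
  assumes "ck n F U f" and "\<And>u. u \<in> U \<Longrightarrow> f u = g u"
  shows "ck n F U g"
  using assms
proof (induction n arbitrary: f g)
  case 0
  then have "depends_on F U g" unfolding depends_on_def ck.simps by metis
  then show ?case using 0 continuous_on_cong[of U U f g] by simp
next
  case (Suc n)
  have op: "open U" using Suc.prems(1) by simp
  have "depends_on F U g" using Suc.prems unfolding depends_on_def ck.simps by metis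
  moreover have "continuous_on U g" using Suc.prems continuous_on_cong[of U U f g] by simp
  moreover have "((\<lambda>s. g (u(i := s))) has_real_derivative pd i g u) (at (u i))" if "u \<in> U" for i u
    using DERIV_fun_upd_cong[OF op that, of f g i] pd_cong[OF op that, of f g i]
      ck_Suc_DERIV[OF Suc.prems(1) that, of i] Suc.prems(2) by metis
  moreover have "ck n F U (pd i g)" for i
  proof (rule Suc.IH[of "pd i f"])
    show "ck n F U (pd i f)" using Suc.prems(1) by simp
    show "pd i f u = pd i g u" if "u \<in> U" for u using pd_cong[OF op that, of f g] Suc.prems(2) by blast
  qed
  ultimately show ?case using Suc.prems(1) by simp
qed

text \<open>The candidates \<open>g i\<close> have to agree with \<open>pd i f\<close> on
  \<open>U\<close> only, so the explicit formulas of the derivative rules can stand in for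
  \<open>pd\<close>.\<close>

lemma ck_SucI:
  assumes "ck 0 F U f"
    and "\<And>i u. u \<in> U \<Longrightarrow> ((\<lambda>s. f (u(i := s))) has_real_derivative g i u) (at (u i))"
    and "\<And>i. ck n F U (g i)"
  shows "ck (Suc n) F U f"
proof -
  have e: "pd i f u = g i u" if "u \<in> U" for i u by (rule pd_eqI[OF assms(2)[OF that]])
  have "ck n F U (pd i f)" for i by (rule ck_cong[OF assms(3)[of i]]) (simp add: e)
  then show ?thesis using assms e by simp
qed

lemma ck_lower: "ck (Suc n) F U f \<Longrightarrow> ck n F U f"
  by (induction n arbitrary: f) auto

lemma ck_le:
  assumes "ck n F U f" and "m \<le> n"
  shows "ck m F U f"
  using assms(2,1) by (induction n rule: dec_induct) (auto simp del: ck.simps dest: ck_lower)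

lemma ck_0: "ck n F U f \<Longrightarrow> ck 0 F U f" using ck_le by blast

lemma ck_mono:
  assumes "ck n F U f" and "F \<subseteq> G" and "finite G"
  shows "ck n G U f"
  using assms by (induction n arbitrary: f) (auto intro: depends_on_mono)

lemma ck_subset:
  assumes "ck n F U f" and "V \<subseteq> U" and "open V" and "depends_on F V (\<lambda>_. 0)"
  shows "ck n F V f"
  using assms
proof (induction n arbitrary: f)
  case 0
  then show ?case unfolding ck.simps depends_on_def by (meson continuous_on_subset subset_iff)
next
  case (Suc n)
  have "depends_on F V f" using Suc.prems unfolding ck.simps depends_on_def by (meson subset_iff)
  then show ?case using Suc by (auto intro: continuous_on_subset)
qed

lemma smooth_in_foldr: "(\<And>n. ck n F U f) \<Longrightarrow> ck n F U (foldr pd is f)"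
proof (induction "is" arbitrary: n)
  case (Cons i "is")
  then show ?case using ck_pd[of n F U "foldr pd is f" i] by auto
qed simp

text \<open>In \<open>foldr pd (i # is) f\<close> the new derivative is outermost, and this is the
  one that \<open>ck\<close> peels off next. The induction on the order therefore runs over all
  words \<open>is\<close> at once.\<close>

lemma smooth_in_iff_ck: "smooth_in F U f \<longleftrightarrow> (\<forall>n. ck n F U f)"
proof
  assume s: "smooth_in F U f"
  have "ck n F U (foldr pd is f)" for n "is"
  proof (induction n arbitrary: "is")
    case 0
    have "depends_on F U (foldr pd is f)"
      using s by (induction "is") (auto simp: smooth_in_def intro: depends_on_pd)
    then show ?case using s by (simp add: smooth_in_def)
  next
    case (Suc n)
    have "((\<lambda>s. foldr pd is f (u(i := s))) has_real_derivative pd i (foldr pd is f) u) (at (u i))"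
      if "u \<in> U" for i u
      using s that unfolding smooth_in_def pd_def by (simp add: field_differentiable_derivI)
    moreover have "ck n F U (pd i (foldr pd is f))" for i using Suc[of "i # is"] by simp
    moreover have "ck 0 F U (foldr pd is f)" using Suc ck_0 by blast
    ultimately show ?case by simp
  qed
  from this[of _ "[]"] show "\<forall>n. ck n F U f" by simp
next
  assume c: "\<forall>n. ck n F U f"
  have *: "ck n F U (foldr pd is f)" for n "is" using smooth_in_foldr[of F U f n "is"] c by blast
  have "continuous_on U (foldr pd is f)" for "is" using *[of 0] by simp
  moreover have "(\<lambda>s. foldr pd is f (u(i := s))) field_differentiable at (u i)" if "u \<in> U" for "is" i u
    using ck_Suc_DERIV[OF *[of "Suc 0" "is"] that, of i] unfolding field_differentiable_def by blast
  ultimately show "smooth_in F U f" using ckD[of 0 F U f] c unfolding smooth_in_def by blast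
qed

section \<open>Closure of \<open>ck\<close> under the algebraic operations\<close>

lemma ck_const:
  assumes "finite F" "open U" "depends_on F U (\<lambda>_. 0)"
  shows "ck n F U (\<lambda>_. k)"
proof (induction n arbitrary: k)
  case 0
  then show ?case using assms by (auto simp: depends_on_def)
next
  case (Suc n)
  show ?case by (rule ck_SucI[where g="\<lambda>_ _. 0"]) (use Suc ck_0[OF Suc] in simp_all)
qed

lemma ck_const': "ck n F U f \<Longrightarrow> ck m F U (\<lambda>_. k)"
  using ckD[of n F U f] depends_on_comp1[of F U f "\<lambda>_. 0"] by (simp add: ck_const)

lemma ck_coord:
  assumes "finite F" "open U" "depends_on F U (\<lambda>_. 0)" "j \<in> F"
  shows "ck n F U (\<lambda>u. u j)"
proof (cases n)
  case 0
  then show ?thesis using assms continuous_on_product_then_coordinatewise[OF continuous_on_id]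
    by (auto simp: depends_on_def)
next
  case (Suc m)
  show ?thesis unfolding Suc
  proof (rule ck_SucI[where g="\<lambda>i _. if i = j then 1 else 0"])
    show "ck 0 F U (\<lambda>u. u j)"
      using assms continuous_on_product_then_coordinatewise[OF continuous_on_id]
      by (auto simp: depends_on_def)
    show "((\<lambda>s. (u(i := s)) j) has_real_derivative (if i = j then 1 else 0)) (at (u i))" for i u
      by (auto intro!: derivative_eq_intros)
    show "ck m F U (\<lambda>_. if i = j then 1 else 0)" for i by (rule ck_const[OF assms(1-3)])
  qed
qed

lemma ck0_add: "ck 0 F U f \<Longrightarrow> ck 0 F U g \<Longrightarrow> ck 0 F U (\<lambda>u. f u + g u)"
  using depends_on_comp2[of F U f g "(+)"] by (simp add: continuous_on_add)

lemma ck0_mult: "ck 0 F U f \<Longrightarrow> ck 0 F U g \<Longrightarrow> ck 0 F U (\<lambda>u. f u * g u)"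
  using depends_on_comp2[of F U f g "(*)"] by (simp add: continuous_on_mult)

lemma ck0_inverse: "ck 0 F U f \<Longrightarrow> (\<And>u. u \<in> U \<Longrightarrow> f u \<noteq> 0) \<Longrightarrow> ck 0 F U (\<lambda>u. inverse (f u))"
  using depends_on_comp1[of F U f inverse] by (simp add: continuous_on_inverse)

lemma ck_add:
  assumes "ck n F U f" "ck n F U g"
  shows "ck n F U (\<lambda>u. f u + g u)"
  using assms
proof (induction n arbitrary: f g)
  case 0
  then show ?case by (rule ck0_add)
next
  case (Suc n)
  show ?case
  proof (rule ck_SucI[where g="\<lambda>i u. pd i f u + pd i g u"])
    show "ck 0 F U (\<lambda>u. f u + g u)"
      using ck0_add ck_0[OF Suc.prems(1)] ck_0[OF Suc.prems(2)] by blast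
  next
    fix i u assume u: "u \<in> U"
    show "((\<lambda>s. f (u(i := s)) + g (u(i := s))) has_real_derivative pd i f u + pd i g u) (at (u i))"
      by (rule DERIV_add[OF ck_Suc_DERIV[OF Suc.prems(1) u] ck_Suc_DERIV[OF Suc.prems(2) u]])
  next
    show "ck n F U (\<lambda>u. pd i f u + pd i g u)" for i
      using Suc.IH[of "pd i f" "pd i g"] Suc.prems by simp
  qed
qed

lemma ck_mult:
  assumes "ck n F U f" "ck n F U g"
  shows "ck n F U (\<lambda>u. f u * g u)"
  using assms
proof (induction n arbitrary: f g)
  case 0
  then show ?case by (rule ck0_mult)
next
  case (Suc n)
  show ?case
  proof (rule ck_SucI[where g="\<lambda>i u. pd i f u * g u + pd i g u * f u"])
    show "ck 0 F U (\<lambda>u. f u * g u)"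
      using ck0_mult ck_0[OF Suc.prems(1)] ck_0[OF Suc.prems(2)] by blast
  next
    fix i u assume u: "u \<in> U"
    show "((\<lambda>s. f (u(i := s)) * g (u(i := s))) has_real_derivative pd i f u * g u + pd i g u * f u) (at (u i))"
      using DERIV_mult[OF ck_Suc_DERIV[OF Suc.prems(1) u, of i] ck_Suc_DERIV[OF Suc.prems(2) u, of i]]
      by (simp only: fun_upd_triv)
  next
    show "ck n F U (\<lambda>u. pd i f u * g u + pd i g u * f u)" for i
      by (intro ck_add Suc.IH ck_pd ck_lower[OF Suc.prems(1)] ck_lower[OF Suc.prems(2)] Suc.prems)
  qed
qed

lemma ck_uminus: "ck n F U f \<Longrightarrow> ck n F U (\<lambda>u. - f u)"
  using ck_mult[OF ck_const'[where k="- 1"], of n F U f n f] by simp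

lemma ck_diff: "ck n F U f \<Longrightarrow> ck n F U g \<Longrightarrow> ck n F U (\<lambda>u. f u - g u)"
  using ck_add[of n F U f "\<lambda>u. - g u"] ck_uminus[of n F U g] by simp

lemma ck_inverse:
  assumes "ck n F U f" "\<And>u. u \<in> U \<Longrightarrow> f u \<noteq> 0"
  shows "ck n F U (\<lambda>u. inverse (f u))"
  using assms
proof (induction n)
  case 0
  then show ?case using ck0_inverse by blast
next
  case (Suc n)
  show ?case
  proof (rule ck_SucI[where g="\<lambda>i u. - (inverse (f u) * pd i f u * inverse (f u))"])
    show "ck 0 F U (\<lambda>u. inverse (f u))"
      using ck0_inverse ck_0[OF Suc.prems(1)] Suc.prems(2) by blast
  next
    fix i u assume u: "u \<in> U"
    show "((\<lambda>s. inverse (f (u(i := s)))) has_real_derivative - (inverse (f u) * pd i f u * inverse (f u))) (at (u i))"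
      using DERIV_inverse'[OF ck_Suc_DERIV[OF Suc.prems(1) u, of i]] Suc.prems(2)[OF u] by (simp only: fun_upd_triv not_False_eq_True)
  next
    show "ck n F U (\<lambda>u. - (inverse (f u) * pd i f u * inverse (f u)))" for i
      by (intro ck_uminus ck_mult Suc.IH ck_pd ck_lower[OF Suc.prems(1)] Suc.prems)
  qed
qed

lemma ck_divide:
  "ck n F U f \<Longrightarrow> ck n F U g \<Longrightarrow> (\<And>u. u \<in> U \<Longrightarrow> g u \<noteq> 0) \<Longrightarrow> ck n F U (\<lambda>u. f u / g u)"
  using ck_mult[of n F U f "\<lambda>u. inverse (g u)"] ck_inverse[of n F U g] by (simp add: divide_inverse)

lemma ck_sum:
  assumes "finite F" "open U" "depends_on F U (\<lambda>_. 0)" "\<And>k. k \<in> A \<Longrightarrow> ck n F U (f k)"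
  shows "ck n F U (\<lambda>u. \<Sum>k\<in>A. f k u)"
  using assms(4)
proof (induction A rule: infinite_finite_induct)
  case (insert k A)
  then show ?case using ck_add[of n F U "f k" "\<lambda>u. \<Sum>k\<in>A. f k u"] by simp
qed (simp_all add: ck_const[OF assms(1-3)])

section \<open>Cubes as neighbourhoods in finitely many coordinates\<close>

definition cube :: "'i set \<Rightarrow> ('i \<Rightarrow> real) \<Rightarrow> real \<Rightarrow> ('i \<Rightarrow> real) set" where
  "cube F u r = {v. \<forall>i\<in>F. \<bar>v i - u i\<bar> < r}"

lemma open_cube: "finite F \<Longrightarrow> open (cube F u r)"
proof (induction F rule: finite_induct)
  case (insert i F)
  have "cube (insert i F) u r = {v. \<bar>v i - u i\<bar> < r} \<inter> cube F u r" by (auto simp: cube_def)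
  moreover have "open {v::'a \<Rightarrow> real. \<bar>v i - u i\<bar> < r}"
    by (intro open_Collect_less continuous_intros
        continuous_on_product_then_coordinatewise[OF continuous_on_id])
  ultimately show ?case using insert by auto
qed (simp add: cube_def)

lemma depends_cube: "F \<subseteq> G \<Longrightarrow> depends_on G (cube F u r) (\<lambda>_. 0)"
  unfolding depends_on_def cube_def by (simp, metis subsetD)

lemma cube_subset: "r \<le> r' \<Longrightarrow> cube F u r \<subseteq> cube F u r'"
  by (force simp: cube_def)

lemma open_contains_cube:
  assumes "open U" "finite F" "depends_on F U (\<lambda>_. 0)" "u \<in> U"
  obtains r where "r > 0" "cube F u r \<subseteq> U"
proof -
  have "openin (product_topology (\<lambda>i. euclidean) UNIV) U"
    using assms(1) by (simp add: euclidean_product_topology)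
  from product_topology_open_contains_basis[OF this assms(4)]
  obtain X where X: "u \<in> Pi\<^sub>E UNIV X" "\<And>i. open (X i)" "Pi\<^sub>E UNIV X \<subseteq> U"
    by auto
  have "\<exists>e>0. \<forall>s. \<bar>s - u i\<bar> < e \<longrightarrow> s \<in> X i" for i
    using X(1,2) open_dist[of "X i"] by (force simp: dist_real_def)
  then obtain e where e: "\<And>i. e i > 0" "\<And>i s. \<bar>s - u i\<bar> < e i \<Longrightarrow> s \<in> X i" by metis
  define r where "r = Min (insert 1 (e ` F))"
  have r: "r > 0" "\<And>i. i \<in> F \<Longrightarrow> r \<le> e i" using assms(2) e(1) by (auto simp: r_def)
  have "cube F u r \<subseteq> U"
  proof
    fix v assume v: "v \<in> cube F u r"
    \<comment> \<open>A basic open set may restrict coordinates outside \<open>F\<close>. They are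
      taken from \<open>u\<close> here, which does not affect membership in
      \<open>U\<close>.\<close>
    define v' where "v' = (\<lambda>i. if i \<in> F then v i else u i)"
    have "v' i \<in> X i" for i
      using v r(2)[of i] e(2)[of "v i" i] X(1) by (force simp: v'_def cube_def)
    then have "v' \<in> U" using X(3) by (auto simp: PiE_def)
    then show "v \<in> U" using depends_onD(1)[OF assms(3), of v' v] by (simp add: v'_def)
  qed
  with r(1) that show thesis by blast
qed

lemma open_Collect_in:
  assumes "open U" "continuous_on U f" "open S"
  shows "open {u\<in>U. f u \<in> S}"
  using continuous_open_preimage[OF assms(2,1,3)] by (simp add: vimage_def Int_def)

lemma depends_Collect_in:
  assumes "depends_on F U f"
  shows "depends_on F {u\<in>U. f u \<in> S} (\<lambda>_. 0)"
proof (rule depends_on_zeroI)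
  fix u v assume u: "u \<in> {u\<in>U. f u \<in> S}" and e: "\<And>i. i \<in> F \<Longrightarrow> u i = v i"
  then have "u \<in> U" by simp
  from depends_onD[OF assms this e] u show "v \<in> {u\<in>U. f u \<in> S}" by simp
qed

lemma depends_Int:
  "depends_on F U (\<lambda>_. 0) \<Longrightarrow> depends_on F V (\<lambda>_. 0) \<Longrightarrow> depends_on F (U \<inter> V) (\<lambda>_. 0)"
proof (rule depends_on_zeroI)
  fix u v assume a: "depends_on F U (\<lambda>_. 0)" "depends_on F V (\<lambda>_. 0)" "u \<in> U \<inter> V"
    and e: "\<And>i. i \<in> F \<Longrightarrow> u i = v i"
  then have "u \<in> U" "u \<in> V" by auto
  from depends_onD(1)[OF a(1) this(1) e] depends_onD(1)[OF a(2) this(2) e] show "v \<in> U \<inter> V" by simp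
qed

lemma ck0_cube:
  assumes "\<And>k. k \<in> A \<Longrightarrow> ck 0 F U (f k)" "finite A" "finite F" "open U" "depends_on F U (\<lambda>_. 0)" "u \<in> U" "e > 0"
  obtains r where "r > 0" "cube F u r \<subseteq> U" "\<And>k v. k \<in> A \<Longrightarrow> v \<in> cube F u r \<Longrightarrow> \<bar>f k v - f k u\<bar> < e"
proof -
  define S where "S = {v\<in>U. \<forall>k\<in>A. f k v \<in> ball (f k u) e}"
  have "open S \<and> depends_on F S (\<lambda>_. 0)" unfolding S_def using assms(2,1)
  proof (induction A rule: finite_induct)
    case empty then show ?case using assms(4,5) by simp
  next
    case (insert k A)
    have eq: "{v \<in> U. \<forall>k\<in>insert k A. f k v \<in> ball (f k u) e} =
      {v\<in>U. f k v \<in> ball (f k u) e} \<inter> {v \<in> U. \<forall>k\<in>A. f k v \<in> ball (f k u) e}" by auto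
    have "open {v\<in>U. f k v \<in> ball (f k u) e}" "depends_on F {v\<in>U. f k v \<in> ball (f k u) e} (\<lambda>_. 0)"
      using insert.prems[of k] by (intro open_Collect_in depends_Collect_in; simp)+
    moreover have "open {v \<in> U. \<forall>k\<in>A. f k v \<in> ball (f k u) e}"
      "depends_on F {v \<in> U. \<forall>k\<in>A. f k v \<in> ball (f k u) e} (\<lambda>_. 0)"
      using insert.IH[OF insert.prems] by simp_all
    ultimately show ?case unfolding eq by (simp add: open_Int depends_Int)
  qed
  then have S: "open S" "depends_on F S (\<lambda>_. 0)" by simp_all
  have "u \<in> S" using assms(6,7) by (simp add: S_def)
  from open_contains_cube[OF S(1) assms(3) S(2) this]
  obtain r where r: "r > 0" "cube F u r \<subseteq> S" .
  show thesis
  proof (rule that[OF r(1)])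
    show "cube F u r \<subseteq> U" using r(2) by (auto simp: S_def)
    fix k v assume "k \<in> A" "v \<in> cube F u r"
    then have "f k v \<in> ball (f k u) e" using r(2) by (auto simp: S_def)
    then show "\<bar>f k v - f k u\<bar> < e" by (simp add: dist_real_def abs_minus_commute)
  qed
qed

text \<open>The coordinates in \<open>F\<close> are moved one after the other; each move costs one
  use of the mean value theorem and of the continuity of one partial derivative. Hence the error is
  measured by the sum of the increments.\<close>

lemma ck1_strong_diff:
  assumes f: "ck (Suc 0) F U f" and u: "u \<in> U" and e: "e > 0"
  shows "\<exists>d>0. \<forall>v\<in>cube F u d.
       \<bar>f v - f u - (\<Sum>c\<in>F. pd c f u * (v c - u c))\<bar> \<le> e * (\<Sum>c\<in>F. \<bar>v c - u c\<bar>)"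
proof -
  have F: "finite F" and op: "open U" and dep: "depends_on F U f" using f by simp_all
  from ck0_cube[OF _ F F op depends_on_comp1[OF dep] u e, of "\<lambda>c. pd c f"] f
  obtain d where d: "d > 0" "cube F u d \<subseteq> U"
    and pde: "\<And>c v. c \<in> F \<Longrightarrow> v \<in> cube F u d \<Longrightarrow> \<bar>pd c f v - pd c f u\<bar> < e"
    by (metis ck_pd)
  have step: "\<bar>f v - f u - (\<Sum>c\<in>G. pd c f u * (v c - u c))\<bar> \<le> e * (\<Sum>c\<in>G. \<bar>v c - u c\<bar>)"
    if "finite G" "G \<subseteq> F" "v \<in> cube F u d" "\<And>c. c \<notin> G \<Longrightarrow> v c = u c" for G v
    using that
  proof (induction G arbitrary: v rule: finite_induct)
    case empty
    then have "v = u" by auto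
    then show ?case by simp
  next
    case (insert c G)
    define v' where "v' = v(c := u c)"
    have c: "c \<in> F" using insert.prems by simp
    have line: "v(c := u c + \<theta> * (v c - u c)) \<in> cube F u d" if "0 \<le> \<theta>" "\<theta> \<le> 1" for \<theta>
    proof -
      have "\<bar>\<theta> * (v c - u c)\<bar> \<le> \<bar>v c - u c\<bar>"
        using that by (simp add: abs_mult mult_left_le_one_le)
      then show ?thesis using insert.prems(2) c by (auto simp: cube_def)
    qed
    have v': "v' \<in> cube F u d" using line[of 0] by (simp add: v'_def)
    have IH: "\<bar>f v' - f u - (\<Sum>i\<in>G. pd i f u * (v' i - u i))\<bar> \<le> e * (\<Sum>i\<in>G. \<bar>v' i - u i\<bar>)"
    proof (rule insert.IH[OF _ v'])
      show "G \<subseteq> F" using insert.prems(1) by simp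
      show "v' i = u i" if "i \<notin> G" for i using insert.prems(3)[of i] that by (cases "i = c") (simp_all add: v'_def)
    qed
    have eqG: "(\<Sum>i\<in>G. pd i f u * (v' i - u i)) = (\<Sum>i\<in>G. pd i f u * (v i - u i))"
      "(\<Sum>i\<in>G. \<bar>v' i - u i\<bar>) = (\<Sum>i\<in>G. \<bar>v i - u i\<bar>)"
      by (intro sum.cong; use insert.hyps in \<open>auto simp: v'_def\<close>)+
    define h where "h = (\<lambda>\<theta>. f (v(c := u c + \<theta> * (v c - u c))))"
    have "\<exists>\<theta>. \<theta> > 0 \<and> \<theta> < 1 \<and> h 1 - h 0 = (1 - 0) * (pd c f (v(c := u c + \<theta> * (v c - u c))) * (v c - u c))"
    proof (rule MVT2)
      fix \<theta> :: real assume \<theta>: "0 \<le> \<theta>" "\<theta> \<le> 1"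
      let ?w = "v(c := u c + \<theta> * (v c - u c))"
      have "((\<lambda>s. f (?w(c := s))) has_real_derivative pd c f ?w) (at (?w c))"
        by (rule ck_Suc_DERIV[OF f]) (use line[OF \<theta>] d(2) in blast)
      then have "((\<lambda>s. f (v(c := s))) has_real_derivative pd c f ?w) (at (u c + \<theta> * (v c - u c)))"
        by simp
      moreover have "((\<lambda>\<theta>. u c + \<theta> * (v c - u c)) has_real_derivative (v c - u c)) (at \<theta>)"
        by (auto intro!: derivative_eq_intros)
      ultimately show "(h has_real_derivative pd c f ?w * (v c - u c)) (at \<theta>)"
        unfolding h_def
        by (rule DERIV_chain2[where f="\<lambda>s. f (v(c := s))" and g="\<lambda>\<theta>. u c + \<theta> * (v c - u c)"])
    qed simp
    then obtain \<theta> where \<theta>: "0 < \<theta>" "\<theta> < 1"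
      and h: "h 1 - h 0 = pd c f (v(c := u c + \<theta> * (v c - u c))) * (v c - u c)" by auto
    let ?w = "v(c := u c + \<theta> * (v c - u c))"
    have h01: "h 1 = f v" "h 0 = f v'" by (simp_all add: h_def v'_def)
    have "\<bar>pd c f ?w - pd c f u\<bar> \<le> e" using pde[OF c line[of \<theta>]] \<theta> by simp
    then have "\<bar>(pd c f ?w - pd c f u) * (v c - u c)\<bar> \<le> e * \<bar>v c - u c\<bar>"
      by (simp add: abs_mult mult_right_mono)
    moreover have "f v - f v' - pd c f u * (v c - u c) = (pd c f ?w - pd c f u) * (v c - u c)"
      using h h01 by (simp add: algebra_simps)
    ultimately have "\<bar>f v - f v' - pd c f u * (v c - u c)\<bar> \<le> e * \<bar>v c - u c\<bar>" by simp
    then show ?case using IH insert.hyps unfolding eqG by (simp add: distrib_left)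
  qed
  show ?thesis
  proof (intro exI conjI ballI)
    show "d > 0" by (rule d(1))
    fix v assume v: "v \<in> cube F u d"
    define w where "w = (\<lambda>c. if c \<in> F then v c else u c)"
    have w: "w \<in> cube F u d" using v by (simp add: w_def cube_def)
    have "f w = f v" by (rule depends_onD(2)[OF dep]) (use v d(2) in \<open>auto simp: w_def\<close>)
    moreover have "\<bar>f w - f u - (\<Sum>c\<in>F. pd c f u * (w c - u c))\<bar> \<le> e * (\<Sum>c\<in>F. \<bar>w c - u c\<bar>)"
      by (rule step[OF F subset_refl w]) (simp add: w_def)
    ultimately show "\<bar>f v - f u - (\<Sum>c\<in>F. pd c f u * (v c - u c))\<bar> \<le> e * (\<Sum>c\<in>F. \<bar>v c - u c\<bar>)"
      by (simp add: w_def)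
  qed
qed

text \<open>The difference quotient of \<open>f\<close> along \<open>\<gamma>\<close> is a linear
  combination of the quotients \<open>g c\<close> plus a remainder \<open>R\<close>, which
  \<open>ck1_strong_diff\<close> bounds by \<open>e / M\<close> times the sum of the
  \<open>\<bar>g c x\<bar>\<close>. The form relative to \<open>A\<close> also serves end points of
  closed time intervals.\<close>

lemma ck1_chain_within:
  assumes f: "ck (Suc 0) F U f" and u: "\<gamma> s \<in> U"
    and \<gamma>: "\<And>c. c \<in> F \<Longrightarrow> ((\<lambda>s. \<gamma> s c) has_real_derivative \<gamma>' c) (at s within A)"
  shows "((\<lambda>s. f (\<gamma> s)) has_real_derivative (\<Sum>c\<in>F. pd c f (\<gamma> s) * \<gamma>' c)) (at s within A)"
proof -
  define g where "g c x = (\<gamma> x c - \<gamma> s c) / (x - s)" for c x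
  have g: "(g c \<longlongrightarrow> \<gamma>' c) (at s within A)" if "c \<in> F" for c
    using \<gamma>[OF that] unfolding has_field_derivative_iff g_def .
  define R where "R x = (f (\<gamma> x) - f (\<gamma> s)) / (x - s) - (\<Sum>c\<in>F. pd c f (\<gamma> s) * g c x)" for x
  \<comment> \<open>The summand 1 puts \<open>M\<close> strictly above the limit of the sum of
    difference quotients, which is therefore eventually below \<open>M\<close>.\<close>
  define M where "M = (\<Sum>c\<in>F. \<bar>\<gamma>' c\<bar>) + 1"
  have M: "M > 0" unfolding M_def by (simp add: add_nonneg_pos sum_nonneg)
  have "((\<lambda>x. \<Sum>c\<in>F. \<bar>g c x\<bar>) \<longlongrightarrow> (\<Sum>c\<in>F. \<bar>\<gamma>' c\<bar>)) (at s within A)"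
    by (intro tendsto_sum tendsto_rabs g)
  then have evM: "\<forall>\<^sub>F x in at s within A. (\<Sum>c\<in>F. \<bar>g c x\<bar>) < M"
    by (rule order_tendstoD(2)) (simp add: M_def)
  have "(R \<longlongrightarrow> 0) (at s within A)"
  proof (rule tendstoI)
    fix e :: real assume e: "e > 0"
    have eM: "e / M > 0" using e M by simp
    from ck1_strong_diff[OF f u eM]
    obtain d where d: "d > 0" and bd: "\<forall>v\<in>cube F (\<gamma> s) d.
       \<bar>f v - f (\<gamma> s) - (\<Sum>c\<in>F. pd c f (\<gamma> s) * (v c - \<gamma> s c))\<bar> \<le> e / M * (\<Sum>c\<in>F. \<bar>v c - \<gamma> s c\<bar>)"
      by (elim exE conjE)
    have "\<forall>\<^sub>F x in at s within A. \<forall>c\<in>F. \<bar>\<gamma> x c - \<gamma> s c\<bar> < d"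
    proof (rule eventually_ball_finite)
      show "finite F" using f by simp
      show "\<forall>c\<in>F. \<forall>\<^sub>F x in at s within A. \<bar>\<gamma> x c - \<gamma> s c\<bar> < d"
      proof
        fix c assume "c \<in> F"
        then have "continuous (at s within A) (\<lambda>x. \<gamma> x c)"
          using \<gamma> DERIV_continuous by blast
        then have "((\<lambda>x. \<gamma> x c) \<longlongrightarrow> \<gamma> s c) (at s within A)" by (simp add: continuous_within)
        from tendstoD[OF this d] show "\<forall>\<^sub>F x in at s within A. \<bar>\<gamma> x c - \<gamma> s c\<bar> < d"
          by (simp add: dist_real_def)
      qed
    qed
    moreover have "\<forall>\<^sub>F x in at s within A. x \<noteq> s" by (simp add: eventually_at_filter)
    ultimately show "\<forall>\<^sub>F x in at s within A. dist (R x) 0 < e" using evM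
    proof eventually_elim
      case (elim x)
      let ?S = "\<Sum>c\<in>F. pd c f (\<gamma> s) * (\<gamma> x c - \<gamma> s c)"
      have "(\<Sum>c\<in>F. pd c f (\<gamma> s) * g c x) = ?S / (x - s)"
        unfolding g_def sum_divide_distrib by simp
      then have "R x = (f (\<gamma> x) - f (\<gamma> s) - ?S) / (x - s)"
        unfolding R_def by (simp add: diff_divide_distrib)
      then have "\<bar>R x\<bar> = \<bar>f (\<gamma> x) - f (\<gamma> s) - ?S\<bar> / \<bar>x - s\<bar>" by simp
      also have "\<dots> \<le> e / M * (\<Sum>c\<in>F. \<bar>\<gamma> x c - \<gamma> s c\<bar>) / \<bar>x - s\<bar>"
        by (intro divide_right_mono bd[rule_format]) (use elim in \<open>auto simp: cube_def\<close>)
      also have "\<dots> = e / M * (\<Sum>c\<in>F. \<bar>g c x\<bar>)"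
        unfolding g_def by (simp add: sum_divide_distrib[symmetric] abs_divide)
      also have "\<dots> < e / M * M" by (intro mult_strict_left_mono) (use elim e M in auto)
      finally show ?case using M by simp
    qed
  qed
  moreover have "((\<lambda>x. \<Sum>c\<in>F. pd c f (\<gamma> s) * g c x) \<longlongrightarrow> (\<Sum>c\<in>F. pd c f (\<gamma> s) * \<gamma>' c)) (at s within A)"
    by (intro tendsto_sum tendsto_mult tendsto_const g)
  ultimately have "((\<lambda>x. R x + (\<Sum>c\<in>F. pd c f (\<gamma> s) * g c x)) \<longlongrightarrow> 0 + (\<Sum>c\<in>F. pd c f (\<gamma> s) * \<gamma>' c)) (at s within A)"
    by (rule tendsto_add)
  then show ?thesis unfolding has_field_derivative_iff R_def by simp
qed

section \<open>Composition of differentiable functions\<close>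

lemma depends_on_compose:
  assumes "depends_on G V f" "\<And>c. c \<in> G \<Longrightarrow> depends_on F U (g c)" "depends_on F U (\<lambda>_. 0)"
    and "\<And>u. u \<in> U \<Longrightarrow> (\<lambda>c. g c u) \<in> V"
  shows "depends_on F U (\<lambda>u. f (\<lambda>c. g c u))"
  unfolding depends_on_def
proof (intro ballI allI impI conjI)
  fix u v assume u: "u \<in> U" and uv: "\<forall>i\<in>F. u i = v i"
  show "v \<in> U" by (rule depends_onD(1)[OF assms(3) u]) (use uv in auto)
  have "g c u = g c v" if "c \<in> G" for c
    by (rule depends_onD(2)[OF assms(2)[OF that] u, symmetric]) (use uv in auto)
  then show "f (\<lambda>c. g c u) = f (\<lambda>c. g c v)"
    by (intro depends_onD(2)[OF assms(1) assms(4)[OF u], symmetric])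
qed

lemma ck0_compose:
  assumes f: "ck 0 G V f" and g: "\<And>c. c \<in> G \<Longrightarrow> ck 0 F U (g c)"
    and U: "finite F" "open U" "depends_on F U (\<lambda>_. 0)" and V: "\<And>u. u \<in> U \<Longrightarrow> (\<lambda>c. g c u) \<in> V"
  shows "ck 0 F U (\<lambda>u. f (\<lambda>c. g c u))"
proof -
  have dep: "depends_on F U (\<lambda>u. f (\<lambda>c. g c u))"
    by (rule depends_on_compose[of G V]) (use assms in simp_all)
  \<comment> \<open>Nothing is known about \<open>g c\<close> for \<open>c\<close> outside
    \<open>G\<close>, so continuity as a map into the product is available only after these
    coordinates are set to 0.\<close>
  define g' where "g' u = (\<lambda>c. if c \<in> G then g c u else 0)" for u
  have V': "g' u \<in> V" if "u \<in> U" for u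
    by (rule depends_onD(1)[OF ck_depends[OF f] V[OF that]]) (simp add: g'_def)
  have eq: "f (\<lambda>c. g c u) = f (g' u)" if "u \<in> U" for u
    by (rule depends_onD(2)[OF ck_depends[OF f] V[OF that], symmetric]) (simp add: g'_def)
  have "continuous_on U g'"
  proof (rule continuous_on_coordinatewise_then_product)
    show "continuous_on U (\<lambda>u. g' u i)" for i
      by (cases "i \<in> G") (use g[of i] in \<open>simp_all add: g'_def\<close>)
  qed
  moreover have "continuous_on (g' ` U) f"
    by (rule continuous_on_subset[OF ck_continuous[OF f]]) (use V' in auto)
  ultimately have "continuous_on U (\<lambda>u. f (g' u))"
    using continuous_on_compose[of U g' f] by (simp add: o_def)
  then have "continuous_on U (\<lambda>u. f (\<lambda>c. g c u))" using continuous_on_cong[of U U] eq by simp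
  then show ?thesis using dep U by simp
qed

text \<open>The chain rule expresses each partial derivative through \<open>pd c f\<close> at the
  inner map; the induction is over all \<open>f\<close> so that it applies to these
  derivatives.\<close>

lemma ck_compose:
  assumes f: "ck n G V f" and g: "\<And>c. c \<in> G \<Longrightarrow> ck n F U (g c)"
    and U: "finite F" "open U" "depends_on F U (\<lambda>_. 0)" and V: "\<And>u. u \<in> U \<Longrightarrow> (\<lambda>c. g c u) \<in> V"
  shows "ck n F U (\<lambda>u. f (\<lambda>c. g c u))"
  using f g
proof (induction n arbitrary: f)
  case 0
  show ?case by (rule ck0_compose[OF 0 U V])
next
  case (Suc n)
  have G: "finite G" using Suc.prems(1) by simp
  show ?case
  proof (rule ck_SucI[where g="\<lambda>i u. \<Sum>c\<in>G. pd c f (\<lambda>c. g c u) * pd i (g c) u"])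
    show "ck 0 F U (\<lambda>u. f (\<lambda>c. g c u))"
      by (rule ck0_compose[OF ck_0[OF Suc.prems(1)] ck_0[OF Suc.prems(2)] U V])
    show "ck n F U (\<lambda>u. \<Sum>c\<in>G. pd c f (\<lambda>c. g c u) * pd i (g c) u)" for i
    proof (rule ck_sum[OF U], rule ck_mult)
      fix c assume c: "c \<in> G"
      show "ck n F U (\<lambda>u. pd c f (\<lambda>c. g c u))"
        by (rule Suc.IH[OF ck_pd[OF Suc.prems(1)] ck_lower[OF Suc.prems(2)]])
      show "ck n F U (pd i (g c))" by (rule ck_pd[OF Suc.prems(2)[OF c]])
    qed
    fix i u assume u: "u \<in> U"
    have f1: "ck (Suc 0) G V f" by (rule ck_le[OF Suc.prems(1)]) simp
    have "((\<lambda>s. (\<lambda>c. g c (u(i := s))) c) has_real_derivative pd i (g c) u) (at (u i))" if "c \<in> G" for c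
      using ck_Suc_DERIV[OF Suc.prems(2)[OF that] u] .
    from ck1_chain_within[OF f1 _ this, of "\<lambda>c. c"] V[OF u]
    show "((\<lambda>s. f (\<lambda>c. g c (u(i := s)))) has_real_derivative
        (\<Sum>c\<in>G. pd c f (\<lambda>c. g c u) * pd i (g c) u)) (at (u i))"
      by (simp only: fun_upd_triv)
  qed
qed

lemma pd_compose:
  assumes f: "ck (Suc 0) G V f" and g: "\<And>c. c \<in> G \<Longrightarrow> ck (Suc 0) F U (g c)"
    and V: "(\<lambda>c. g c u) \<in> V" and u: "u \<in> U"
  shows "pd i (\<lambda>u. f (\<lambda>c. g c u)) u = (\<Sum>c\<in>G. pd c f (\<lambda>c. g c u) * pd i (g c) u)"
proof (rule pd_eqI)
  have "((\<lambda>s. (\<lambda>c. g c (u(i := s))) c) has_real_derivative pd i (g c) u) (at (u i))" if "c \<in> G" for c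
    using ck_Suc_DERIV[OF g[OF that] u] .
  from ck1_chain_within[OF f _ this, of "\<lambda>c. c"] V
  show "((\<lambda>s. f (\<lambda>c. g c (u(i := s)))) has_real_derivative
        (\<Sum>c\<in>G. pd c f (\<lambda>c. g c u) * pd i (g c) u)) (at (u i))"
    by (simp only: fun_upd_triv)
qed

text \<open>Both iterated partial derivatives are the limit of the same second difference quotient,
  by the mean value theorem applied twice.\<close>

lemma second_difference:
  assumes f: "ck (Suc (Suc 0)) F U f" and ij: "i \<noteq> j" and r: "h > 0"
    and U: "\<forall>a\<in>{0..h}. \<forall>b\<in>{0..h}. u(i := u i + a, j := u j + b) \<in> U"
  obtains a b where "0 < a" "a < h" "0 < b" "b < h"
    "f (u(i := u i + h, j := u j + h)) - f (u(i := u i + h)) - f (u(j := u j + h)) + f u =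
     h * (h * pd j (pd i f) (u(i := u i + a, j := u j + b)))"
proof -
  define w where "w a b = u(i := u i + a, j := u j + b)" for a b
  have wU: "w a b \<in> U" if "0 \<le> a" "a \<le> h" "0 \<le> b" "b \<le> h" for a b using U[rule_format, of a b] that by (simp add: w_def)
  have di: "((\<lambda>a. g (w a b)) has_real_derivative pd i g (w a b)) (at a)"
    if "0 \<le> a" "a \<le> h" "0 \<le> b" "b \<le> h" "ck (Suc 0) F U g" for a b g
  proof -
    have "((\<lambda>s. g ((w a b)(i := s))) has_real_derivative pd i g (w a b)) (at (u i + a))"
      using ck_Suc_DERIV[OF that(5) wU[OF that(1-4)], of i] ij by (simp add: w_def)
    moreover have "((\<lambda>a. u i + a) has_real_derivative 1) (at a)"
      by (auto intro!: derivative_eq_intros)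
    ultimately have "((\<lambda>x. g ((w a b)(i := u i + x))) has_real_derivative pd i g (w a b) * 1) (at a)"
      by (rule DERIV_chain2[where f="\<lambda>s. g ((w a b)(i := s))" and g="\<lambda>a. u i + a"])
    moreover have "(w a b)(i := u i + x) = w x b" for x using ij by (auto simp: w_def fun_eq_iff)
    ultimately show ?thesis by simp
  qed
  have dj: "((\<lambda>b. g (w a b)) has_real_derivative pd j g (w a b)) (at b)"
    if "0 \<le> a" "a \<le> h" "0 \<le> b" "b \<le> h" "ck (Suc 0) F U g" for a b g
  proof -
    have "((\<lambda>s. g ((w a b)(j := s))) has_real_derivative pd j g (w a b)) (at (u j + b))"
      using ck_Suc_DERIV[OF that(5) wU[OF that(1-4)], of j] ij by (simp add: w_def)
    moreover have "((\<lambda>b. u j + b) has_real_derivative 1) (at b)"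
      by (auto intro!: derivative_eq_intros)
    ultimately have "((\<lambda>x. g ((w a b)(j := u j + x))) has_real_derivative pd j g (w a b) * 1) (at b)"
      by (rule DERIV_chain2[where f="\<lambda>s. g ((w a b)(j := s))" and g="\<lambda>b. u j + b"])
    moreover have "(w a b)(j := u j + x) = w a x" for x using ij by (auto simp: w_def fun_eq_iff)
    ultimately show ?thesis by simp
  qed
  have f1: "ck (Suc 0) F U f" by (rule ck_lower[OF f])
  have f2: "ck (Suc 0) F U (pd i f)" by (rule ck_pd[OF f])
  have "\<exists>a. a > 0 \<and> a < h \<and> (f (w h h) - f (w h 0)) - (f (w 0 h) - f (w 0 0)) =
      (h - 0) * (pd i f (w a h) - pd i f (w a 0))"
    by (rule MVT2[OF r, of "\<lambda>a. f (w a h) - f (w a 0)"])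
      (use r f1 in \<open>intro DERIV_diff di; simp\<close>)
  then obtain a where a: "0 < a" "a < h" and
    ea: "(f (w h h) - f (w h 0)) - (f (w 0 h) - f (w 0 0)) = h * (pd i f (w a h) - pd i f (w a 0))"
    by auto
  have "\<exists>b. b > 0 \<and> b < h \<and> pd i f (w a h) - pd i f (w a 0) = (h - 0) * pd j (pd i f) (w a b)"
    by (rule MVT2[OF r, of "\<lambda>b. pd i f (w a b)"]) (use a f2 in \<open>intro dj; simp\<close>)
  then obtain b where b: "0 < b" "b < h" and
    eb: "pd i f (w a h) - pd i f (w a 0) = h * pd j (pd i f) (w a b)" by auto
  have "w h h = u(i := u i + h, j := u j + h)" "w h 0 = u(i := u i + h)"
    "w 0 h = u(j := u j + h)" "w 0 0 = u"
    using ij by (auto simp: w_def fun_eq_iff)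
  then show thesis using ea eb a b that[of a b] by (simp add: w_def)
qed

lemma pd_commute:
  assumes f: "ck (Suc (Suc 0)) F U f" and u: "u \<in> U"
  shows "pd i (pd j f) u = pd j (pd i f) u"
proof (cases "i = j \<or> i \<notin> F \<or> j \<notin> F")
  \<comment> \<open>The degenerate cases: equal directions, or a direction outside \<open>F\<close>,
    where both sides vanish.\<close>
  case True
  have dep: "depends_on F U f" and op: "open U" using f by simp_all
  have "pd i (pd j f) u = 0 \<and> pd j (pd i f) u = 0" if "i \<notin> F" for i j
  proof
    show "pd i (pd j f) u = 0" by (rule pd_outside[OF depends_on_pd[OF op dep] u that])
    have "pd j (pd i f) u = pd j (\<lambda>_. 0) u"
      by (rule pd_cong[OF op u]) (rule pd_outside[OF dep _ that])
    then show "pd j (pd i f) u = 0" by (simp add: pd_def)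
  qed
  with True show ?thesis by metis
next
  case False
  then have ij: "i \<noteq> j" "i \<in> F" "j \<in> F" by auto
  have c: "ck 0 F U (pd i (pd j f))" "ck 0 F U (pd j (pd i f))" using f by simp_all
  have "\<bar>pd i (pd j f) u - pd j (pd i f) u\<bar> \<le> 2 * e" if e: "e > 0" for e
  proof -
    have U: "finite F" "open U" "depends_on F U (\<lambda>_. 0)"
      using f depends_on_comp1[of F U f "\<lambda>_. 0"] by simp_all
    let ?A = "{pd i (pd j f), pd j (pd i f)}"
    have A: "ck 0 F U k" if "k \<in> ?A" for k using that c by blast
    have finA: "finite ?A" by simp
    obtain r where r: "r > 0" "cube F u r \<subseteq> U"
      and bdA: "\<And>k v. k \<in> ?A \<Longrightarrow> v \<in> cube F u r \<Longrightarrow> \<bar>k v - k u\<bar> < e"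
      using ck0_cube[OF A finA U u e, of "\<lambda>k. k"] by metis
    have bd: "\<bar>pd i (pd j f) v - pd i (pd j f) u\<bar> < e" "\<bar>pd j (pd i f) v - pd j (pd i f) u\<bar> < e"
      if "v \<in> cube F u r" for v using bdA that by auto
    define h where "h = r / 2"
    have h: "h > 0" using r by (simp add: h_def)
    have inb: "u(i := u i + a, j := u j + b) \<in> cube F u r" "u(j := u j + a, i := u i + b) \<in> cube F u r"
      if "0 \<le> a" "a \<le> h" "0 \<le> b" "b \<le> h" for a b
      using that r(1) ij by (auto simp: cube_def h_def)
    have inU: "\<forall>a\<in>{0..h}. \<forall>b\<in>{0..h}. u(i := u i + a, j := u j + b) \<in> U"
      "\<forall>a\<in>{0..h}. \<forall>b\<in>{0..h}. u(j := u j + a, i := u i + b) \<in> U"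
      using inb r(2) by auto
    obtain a b where ab: "0 < a" "a < h" "0 < b" "b < h"
      "f (u(i := u i + h, j := u j + h)) - f (u(i := u i + h)) - f (u(j := u j + h)) + f u =
       h * (h * pd j (pd i f) (u(i := u i + a, j := u j + b)))"
      by (rule second_difference[OF f ij(1) h inU(1)])
    obtain a' b' where ab': "0 < a'" "a' < h" "0 < b'" "b' < h"
      "f (u(j := u j + h, i := u i + h)) - f (u(j := u j + h)) - f (u(i := u i + h)) + f u =
       h * (h * pd i (pd j f) (u(j := u j + a', i := u i + b')))"
      by (rule second_difference[OF f ij(1)[symmetric] h inU(2)])
    have "f (u(j := u j + h, i := u i + h)) = f (u(i := u i + h, j := u j + h))"
      using ij(1) by (simp add: fun_upd_twist)
    then have "h * (h * pd j (pd i f) (u(i := u i + a, j := u j + b))) =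
      h * (h * pd i (pd j f) (u(j := u j + a', i := u i + b')))"
      using ab(5) ab'(5) by linarith
    then have "pd j (pd i f) (u(i := u i + a, j := u j + b)) = pd i (pd j f) (u(j := u j + a', i := u i + b'))"
      using h by simp
    moreover note bd(2)[OF inb(1)[of a b]] bd(1)[OF inb(2)[of a' b']]
    ultimately show ?thesis using ab(1-4) ab'(1-4) by force
  qed
  \<comment> \<open>With a quarter of the distance for \<open>e\<close>, the bound
    \<open>2 * e\<close> is half of the distance itself, which is absurd unless the distance is
    0.\<close>
  from this[of "\<bar>pd i (pd j f) u - pd j (pd i f) u\<bar> / 4"] show ?thesis by (cases "pd i (pd j f) u = pd j (pd i f) u") auto
qed

section \<open>Ordinary differential equations with parameters\<close>

text \<open>
  The smallness of \<open>K * card C * T\<close> replaces Gronwall's inequality: by the mean value theorem at the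
  point where \<open>\<bar>e c t\<bar>\<close> is maximal, the maximum is bounded by half of itself plus the data.
\<close>

lemma ode_stability:
  fixes e e' :: "'c \<Rightarrow> real \<Rightarrow> real" and T K :: real
  assumes C: "finite C" and T: "T > 0" and K: "K \<ge> 0" "K * card C * T \<le> 1/2"
    and der: "\<And>c t. c \<in> C \<Longrightarrow> \<bar>t\<bar> \<le> T \<Longrightarrow> (e c has_real_derivative e' c t) (at t within {-T..T})"
    and bound: "\<And>c t. c \<in> C \<Longrightarrow> \<bar>t\<bar> \<le> T \<Longrightarrow> \<bar>e' c t\<bar> \<le> K * (\<Sum>d\<in>C. \<bar>e d t\<bar>) + \<beta>"
    and init: "\<And>c. c \<in> C \<Longrightarrow> \<bar>e c 0\<bar> \<le> \<beta>0"
    and c: "c \<in> C" and t: "\<bar>t\<bar> \<le> T"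
  shows "\<bar>e c t\<bar> \<le> 2 * (\<beta>0 + T * \<beta>)"
proof -
  have "\<exists>s\<in>{-T..T}. \<forall>t\<in>{-T..T}. \<bar>e c t\<bar> \<le> \<bar>e c s\<bar>" if "c \<in> C" for c
  proof (rule continuous_attains_sup)
    have "continuous_on {-T..T} (e c)"
      by (rule DERIV_continuous_on[where D="e' c"]) (rule der[OF that], auto)
    then show "continuous_on {-T..T} (\<lambda>t. \<bar>e c t\<bar>)" by (rule continuous_on_rabs)
  qed (use T in auto)
  then obtain s where s: "\<And>c. c \<in> C \<Longrightarrow> s c \<in> {-T..T}"
    "\<And>c t. c \<in> C \<Longrightarrow> t \<in> {-T..T} \<Longrightarrow> \<bar>e c t\<bar> \<le> \<bar>e c (s c)\<bar>" by metis
  define m where "m = Max ((\<lambda>c. \<bar>e c (s c)\<bar>) ` C)"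
  have ne: "(\<lambda>c. \<bar>e c (s c)\<bar>) ` C \<noteq> {}" "finite ((\<lambda>c. \<bar>e c (s c)\<bar>) ` C)" using c C by auto
  have m: "\<bar>e c t\<bar> \<le> m" if "c \<in> C" "t \<in> {-T..T}" for c t
    using s(2)[OF that] Max_ge[OF ne(2), of "\<bar>e c (s c)\<bar>"] that by (force simp: m_def)
  from Max_in[OF ne(2,1)] obtain c0 where c0: "c0 \<in> C" "m = \<bar>e c0 (s c0)\<bar>" by (auto simp: m_def)
  have B: "\<bar>e' c t\<bar> \<le> K * (card C * m) + \<beta>" if "c \<in> C" "\<bar>t\<bar> \<le> T" for c t
  proof -
    have "(\<Sum>d\<in>C. \<bar>e d t\<bar>) \<le> card C * m"
      by (rule sum_bounded_above) (use that m in \<open>auto simp: abs_le_iff\<close>)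
    then have "K * (\<Sum>d\<in>C. \<bar>e d t\<bar>) \<le> K * (card C * m)" by (rule mult_left_mono[OF _ K(1)])
    then show ?thesis using bound[OF that] by linarith
  qed
  have "norm (e c0 (s c0) - e c0 0) \<le> (K * (card C * m) + \<beta>) * norm (s c0 - 0)"
    by (rule field_differentiable_bound[where S="{-T..T}" and f'="e' c0"])
      (use der[OF c0(1)] B[OF c0(1)] s(1)[OF c0(1)] T in \<open>auto simp: abs_le_iff\<close>)
  also have "\<dots> \<le> (K * (card C * m) + \<beta>) * T"
    using s(1)[OF c0(1)] order_trans[OF abs_ge_zero B[OF c0(1), of 0]] T
    by (intro mult_left_mono) auto
  finally have "m \<le> \<beta>0 + (K * card C * T) * m + T * \<beta>"
    using init[OF c0(1)] c0(2) by (simp add: algebra_simps)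
  also have "(K * card C * T) * m \<le> 1/2 * m"
    by (rule mult_right_mono[OF K(2)]) (simp add: c0(2))
  finally have "m \<le> 2 * (\<beta>0 + T * \<beta>)" by simp
  then show ?thesis using m[OF c, of t] t by (auto simp: abs_le_iff)
qed

section \<open>Existence of solutions by successive approximation\<close>

lemma antiderivative_within:
  fixes f :: "real \<Rightarrow> real" and T :: real
  assumes "continuous_on {-T..T} f" and "T > 0"
  shows "\<exists>H. H 0 = a \<and> (\<forall>t\<in>{-T..T}. (H has_real_derivative f t) (at t within {-T..T}))"
proof -
  from antiderivative_continuous[OF assms(1)]
  obtain g where g: "\<And>t. t \<in> {-T..T} \<Longrightarrow> (g has_vector_derivative f t) (at t within {-T..T})" by blast
  show ?thesis
  proof (intro exI conjI ballI)
    fix t assume "t \<in> {-T..T}"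
    then have "(g has_real_derivative f t) (at t within {-T..T})"
      using g has_real_derivative_iff_has_vector_derivative by blast
    then show "((\<lambda>t. g t - g 0 + a) has_real_derivative f t) (at t within {-T..T})"
      by (auto intro!: derivative_eq_intros)
  qed simp
qed

text \<open>The condition on \<open>K * card C * T\<close> makes the integral operator contract by
  1/2 on the whole interval. The Lipschitz bound is required for all states, so the iterates cannot
  leave the domain of \<open>g\<close>.\<close>

lemma picard:
  fixes g :: "'c \<Rightarrow> real \<Rightarrow> ('c \<Rightarrow> real) \<Rightarrow> real" and T K :: real
  assumes C: "finite C" and T: "T > 0" and K: "K \<ge> 0" "K * card C * T \<le> 1/2"
    and cont: "\<And>c y. c \<in> C \<Longrightarrow> (\<And>d. d \<in> C \<Longrightarrow> continuous_on {-T..T} (y d)) \<Longrightarrow>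
      continuous_on {-T..T} (\<lambda>t. g c t (\<lambda>d. y d t))"
    and lip: "\<And>c t y y'. c \<in> C \<Longrightarrow> t \<in> {-T..T} \<Longrightarrow> \<bar>g c t y - g c t y'\<bar> \<le> K * (\<Sum>d\<in>C. \<bar>y d - y' d\<bar>)"
  shows "\<exists>y. \<forall>c\<in>C. y c 0 = y0 c \<and>
    (\<forall>t\<in>{-T..T}. (y c has_real_derivative g c t (\<lambda>d. y d t)) (at t within {-T..T}))"
proof -
  let ?I = "{-T..T}"
  define step where "step y = (\<lambda>c. SOME H. H 0 = y0 c \<and>
    (\<forall>t\<in>?I. (H has_real_derivative g c t (\<lambda>d. y d t)) (at t within ?I)))" for y
  define Y where "Y n = (step ^^ n) (\<lambda>c t. y0 c)" for n
  have stepD: "step y c 0 = y0 c \<and>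
      (\<forall>t\<in>?I. (step y c has_real_derivative g c t (\<lambda>d. y d t)) (at t within ?I))"
    if "c \<in> C" "\<And>d. d \<in> C \<Longrightarrow> continuous_on ?I (y d)" for y c
    unfolding step_def by (rule someI_ex[OF antiderivative_within[OF cont[OF that] T]])
  have YSuc: "Y (Suc n) = step (Y n)" for n by (simp add: Y_def)
  have Ycont: "continuous_on ?I (Y n c)" if "c \<in> C" for n c
    using that
  proof (induction n arbitrary: c)
    case (Suc n)
    have "\<forall>t\<in>?I. (Y (Suc n) c has_real_derivative g c t (\<lambda>d. Y n d t)) (at t within ?I)"
      unfolding YSuc using stepD[OF Suc.prems Suc.IH] by (rule conjunct2)
    then show ?case by (intro DERIV_continuous_on[where D="\<lambda>t. g c t (\<lambda>d. Y n d t)"]) simp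
  qed (simp add: Y_def)
  have Y0: "Y 0 c t = y0 c" for c t by (simp add: Y_def)
  have Yinit: "Y n c 0 = y0 c" if "c \<in> C" for n c
    using stepD[OF that, of "Y (n - 1)"] Ycont by (cases n) (auto simp: Y0 YSuc)
  have Yder: "(Y (Suc n) c has_real_derivative g c t (\<lambda>d. Y n d t)) (at t within ?I)"
    if "c \<in> C" "t \<in> ?I" for n c t
    using stepD[OF that(1), of "Y n"] Ycont that(2) by (simp add: YSuc)
  have "\<exists>M. \<forall>t\<in>?I. \<bar>Y 1 c t - Y 0 c t\<bar> \<le> M" if "c \<in> C" for c
  proof -
    have "compact ((\<lambda>t. Y 1 c t - Y 0 c t) ` ?I)"
      by (intro compact_continuous_image continuous_on_diff Ycont that) simp
    then have "bounded ((\<lambda>t. Y 1 c t - Y 0 c t) ` ?I)" by (rule compact_imp_bounded)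
    then show ?thesis by (simp add: bounded_iff)
  qed
  then obtain M where M: "\<And>c t. c \<in> C \<Longrightarrow> t \<in> ?I \<Longrightarrow> \<bar>Y 1 c t - Y 0 c t\<bar> \<le> M c" by metis
  define L where "L = (\<Sum>c\<in>C. \<bar>M c\<bar>)"
  have MleL: "M c \<le> L" if "c \<in> C" for c
    using member_le_sum[of c C "\<lambda>c. \<bar>M c\<bar>"] that C by (auto simp: L_def)
  have geo: "\<bar>Y (Suc n) c t - Y n c t\<bar> \<le> L * (1/2) ^ n" if "c \<in> C" "t \<in> ?I" for n c t
    using that
  proof (induction n arbitrary: c t)
    case 0
    then show ?case using order_trans[OF M[OF 0] MleL] by simp
  next
    case (Suc n)
    have B: "\<bar>g c t (\<lambda>d. Y (Suc n) d t) - g c t (\<lambda>d. Y n d t)\<bar> \<le> K * (card C * (L * (1/2) ^ n))"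
      if "t \<in> ?I" for t
    proof -
      have "(\<Sum>d\<in>C. \<bar>Y (Suc n) d t - Y n d t\<bar>) \<le> card C * (L * (1/2) ^ n)"
        by (rule sum_bounded_above) (use Suc.IH that in auto)
      then have "K * (\<Sum>d\<in>C. \<bar>Y (Suc n) d t - Y n d t\<bar>) \<le> K * (card C * (L * (1/2) ^ n))"
        by (rule mult_left_mono[OF _ K(1)])
      then show ?thesis using lip[OF Suc.prems(1) that] by (meson order_trans)
    qed
    have "norm ((Y (Suc (Suc n)) c t - Y (Suc n) c t) - (Y (Suc (Suc n)) c 0 - Y (Suc n) c 0))
        \<le> (K * (card C * (L * (1/2) ^ n))) * norm (t - 0)"
      by (rule field_differentiable_bound[where S="?I" and
            f'="\<lambda>t. g c t (\<lambda>d. Y (Suc n) d t) - g c t (\<lambda>d. Y n d t)"])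
        (use Suc.prems B T in \<open>auto intro!: DERIV_diff Yder\<close>)
    also have "\<dots> \<le> (K * (card C * (L * (1/2) ^ n))) * T"
      using Suc.prems(2) order_trans[OF abs_ge_zero B[OF Suc.prems(2)]]
      by (intro mult_left_mono) auto
    also have "\<dots> = (K * card C * T) * (L * (1/2) ^ n)" by simp
    also have "\<dots> \<le> 1/2 * (L * (1/2) ^ n)"
      by (intro mult_right_mono[OF K(2)] mult_nonneg_nonneg) (auto simp: L_def sum_nonneg)
    finally show ?case using Yinit[OF Suc.prems(1)] by simp
  qed
  \<comment> \<open>The limit is written as a telescoping series, so that the Weierstrass test with
    the bound \<open>geo\<close> gives uniform convergence.\<close>
  define y where "y c t = Y 0 c t + (\<Sum>n. Y (Suc n) c t - Y n c t)" for c t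
  have ul: "uniform_limit ?I (\<lambda>n t. Y n c t) (y c) sequentially" if c: "c \<in> C" for c
  proof -
    have "uniform_limit ?I (\<lambda>n t. \<Sum>i<n. Y (Suc i) c t - Y i c t) (\<lambda>t. \<Sum>n. Y (Suc n) c t - Y n c t) sequentially"
      by (rule Weierstrass_m_test[where M="\<lambda>n. L * (1/2) ^ n"])
        (use geo c in \<open>auto intro!: summable_mult\<close>)
    moreover have "(\<Sum>i<n. Y (Suc i) c t - Y i c t) = Y n c t - Y 0 c t" for n t
      by (rule sum_lessThan_telescope[of "\<lambda>i. Y i c t"])
    ultimately have "uniform_limit ?I (\<lambda>n t. Y n c t - Y 0 c t) (\<lambda>t. \<Sum>n. Y (Suc n) c t - Y n c t) sequentially"
      by simp
    from uniform_limit_add[OF uniform_limit_const[of "\<lambda>t. Y 0 c t" ?I] this]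
    show ?thesis unfolding y_def by simp
  qed
  have lim: "(\<lambda>n. Y n c t) \<longlonglongrightarrow> y c t" if "c \<in> C" "t \<in> ?I" for c t
    using tendsto_uniform_limitI[OF ul[OF that(1)] that(2)] .
  show ?thesis
  proof (intro exI ballI conjI)
    fix c assume c: "c \<in> C"
    have "(\<lambda>n. Y n c 0) \<longlonglongrightarrow> y c 0" using lim[OF c, of 0] T by simp
    then show "y c 0 = y0 c" using Yinit[OF c] by (simp add: LIMSEQ_const_iff)
    \<comment> \<open>By the Lipschitz bound the derivatives converge uniformly as well, so the
      limit may be differentiated. The index is shifted because the derivative of
      \<open>Y (Suc n)\<close> is the right-hand side at \<open>Y n\<close>.\<close>
    have "\<exists>h. \<forall>t\<in>?I. (\<lambda>n. Y (Suc n) c t) \<longlonglongrightarrow> h t \<and>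
        (h has_derivative (*) (g c t (\<lambda>d. y d t))) (at t within ?I)"
    proof (rule has_derivative_sequence[where f'="\<lambda>n t. (*) (g c t (\<lambda>d. Y n d t))"])
      show "convex ?I" by simp
      show "(Y (Suc n) c has_derivative (*) (g c t (\<lambda>d. Y n d t))) (at t within ?I)" if "t \<in> ?I" for n t
        using Yder[OF c that] by (simp add: has_field_derivative_def)
      show "(0::real) \<in> ?I" using T by simp
      show "(\<lambda>n. Y (Suc n) c 0) \<longlonglongrightarrow> y c 0" using LIMSEQ_Suc[OF lim[OF c, of 0]] T by simp
      fix \<epsilon> :: real assume \<epsilon>: "\<epsilon> > 0"
      \<comment> \<open>The added 1 keeps the denominator positive when \<open>K\<close> is
        0.\<close>
      define \<delta> where "\<delta> = \<epsilon> / (K * card C + 1)"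
      have p: "K * card C + 1 > 0" using K(1) by (simp add: add_nonneg_pos)
      have \<delta>: "\<delta> > 0" using p \<epsilon> by (simp add: \<delta>_def)
      have "\<forall>d\<in>C. \<forall>\<^sub>F n in sequentially. \<forall>t\<in>?I. dist (Y n d t) (y d t) < \<delta>"
        using ul \<delta> by (auto simp: uniform_limit_iff)
      then have "\<forall>\<^sub>F n in sequentially. \<forall>d\<in>C. \<forall>t\<in>?I. dist (Y n d t) (y d t) < \<delta>"
        by (rule eventually_ball_finite[OF C])
      then show "\<forall>\<^sub>F n in sequentially. \<forall>t\<in>?I. \<forall>h.
          norm (g c t (\<lambda>d. Y n d t) * h - g c t (\<lambda>d. y d t) * h) \<le> \<epsilon> * norm h"
      proof eventually_elim
        case (elim n)
        show ?case
        proof (intro ballI allI)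
          fix t h :: real assume t: "t \<in> ?I"
          have "(\<Sum>d\<in>C. \<bar>Y n d t - y d t\<bar>) \<le> card C * \<delta>"
            by (rule sum_bounded_above) (use elim t in \<open>force simp: dist_real_def\<close>)
          then have "K * (\<Sum>d\<in>C. \<bar>Y n d t - y d t\<bar>) \<le> K * (card C * \<delta>)"
            by (rule mult_left_mono[OF _ K(1)])
          also have "\<dots> \<le> (K * card C + 1) * \<delta>" using \<delta> by (simp add: algebra_simps)
          also have "\<dots> = \<epsilon>" using p by (simp add: \<delta>_def)
          finally have "\<bar>g c t (\<lambda>d. Y n d t) - g c t (\<lambda>d. y d t)\<bar> \<le> \<epsilon>"
            using lip[OF c t, of "\<lambda>d. Y n d t" "\<lambda>d. y d t"] by linarith
          then have "\<bar>g c t (\<lambda>d. Y n d t) - g c t (\<lambda>d. y d t)\<bar> * \<bar>h\<bar> \<le> \<epsilon> * \<bar>h\<bar>"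
            by (rule mult_right_mono) simp
          then show "norm (g c t (\<lambda>d. Y n d t) * h - g c t (\<lambda>d. y d t) * h) \<le> \<epsilon> * norm h"
            by (simp add: left_diff_distrib[symmetric] abs_mult)
        qed
      qed
    qed
    then obtain h where h: "\<And>t. t \<in> ?I \<Longrightarrow> (\<lambda>n. Y (Suc n) c t) \<longlonglongrightarrow> h t"
      "\<And>t. t \<in> ?I \<Longrightarrow> (h has_derivative (*) (g c t (\<lambda>d. y d t))) (at t within ?I)" by blast
    have eq: "h t = y c t" if "t \<in> ?I" for t
      by (rule LIMSEQ_unique[OF h(1)[OF that] LIMSEQ_Suc[OF lim[OF c that]]])
    fix t assume t: "t \<in> ?I"
    have "(y c has_derivative (*) (g c t (\<lambda>d. y d t))) (at t within ?I)"
      by (rule has_derivative_transform[OF t _ h(2)[OF t]]) (simp add: eq)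
    then show "(y c has_real_derivative g c t (\<lambda>d. y d t)) (at t within ?I)"
      by (simp add: has_field_derivative_def)
  qed
qed

section \<open>Auxiliary estimates for the dependence on parameters\<close>

lemma eventually_uniformly_close:
  fixes f :: "'a::topological_space \<times> 'b::topological_space \<Rightarrow> real"
  assumes "continuous_on (U \<times> C) f" "compact C" "open U" "x0 \<in> U" "\<epsilon> > 0"
  shows "\<forall>\<^sub>F x in nhds x0. \<forall>t\<in>C. \<bar>f (x, t) - f (x0, t)\<bar> \<le> \<epsilon>"
proof -
  from continuous_on_prod_compactE[OF assms(1,2,4,5)]
  obtain X0 where X0: "x0 \<in> X0" "open X0" "\<forall>x\<in>X0 \<inter> U. \<forall>t\<in>C. dist (f (x, t)) (f (x0, t)) \<le> \<epsilon>" .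
  have "\<forall>\<^sub>F x in nhds x0. x \<in> X0 \<inter> U"
    by (rule eventually_nhds_in_open) (use X0 assms in auto)
  then show ?thesis by eventually_elim (use X0(3) in \<open>auto simp: dist_real_def\<close>)
qed

lemma ck0_continuous_compose:
  assumes f: "ck 0 G V f" and \<gamma>: "\<And>x. x \<in> S \<Longrightarrow> \<gamma> x \<in> V"
    and cont: "\<And>c. c \<in> G \<Longrightarrow> continuous_on S (\<lambda>x. \<gamma> x c)"
  shows "continuous_on S (\<lambda>x. f (\<gamma> x))"
proof -
  define \<gamma>' where "\<gamma>' x = (\<lambda>c. if c \<in> G then \<gamma> x c else 0)" for x
  have V': "\<gamma>' x \<in> V" if "x \<in> S" for x
    by (rule depends_onD(1)[OF ck_depends[OF f] \<gamma>[OF that]]) (simp add: \<gamma>'_def)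
  have eq: "f (\<gamma> x) = f (\<gamma>' x)" if "x \<in> S" for x
    by (rule depends_onD(2)[OF ck_depends[OF f] \<gamma>[OF that], symmetric]) (simp add: \<gamma>'_def)
  have "continuous_on S \<gamma>'"
  proof (rule continuous_on_coordinatewise_then_product)
    show "continuous_on S (\<lambda>x. \<gamma>' x i)" for i
      by (cases "i \<in> G") (use cont[of i] in \<open>simp_all add: \<gamma>'_def\<close>)
  qed
  moreover have "continuous_on (\<gamma>' ` S) f"
    by (rule continuous_on_subset[OF ck_continuous[OF f]]) (use V' in auto)
  ultimately have "continuous_on S (\<lambda>x. f (\<gamma>' x))"
    using continuous_on_compose[of S \<gamma>' f] by (simp add: o_def)
  then show ?thesis using continuous_on_cong[of S S "\<lambda>x. f (\<gamma> x)" "\<lambda>x. f (\<gamma>' x)"] eq by simp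
qed

text \<open>A division-free form of the derivative: estimates that hold eventually in
  \<open>h\<close> for several quantities can be combined linearly and fed into
  \<open>ode_stability\<close>.\<close>

lemma DERIV_iff_eventually_le:
  "(f has_real_derivative D) (at a) \<longleftrightarrow>
    (\<forall>\<epsilon>>0. \<forall>\<^sub>F h in at 0. \<bar>f (a + h) - f a - h * D\<bar> \<le> \<epsilon> * \<bar>h\<bar>)"
proof -
  have eq: "\<bar>(f (a + h) - f a) / h - D\<bar> * \<bar>h\<bar> = \<bar>f (a + h) - f a - h * D\<bar>" if "h \<noteq> 0" for h
  proof -
    have "((f (a + h) - f a) / h - D) * h = f (a + h) - f a - h * D"
      using that by (simp add: field_simps)
    then show ?thesis by (simp add: abs_mult[symmetric])
  qed
  have ne: "\<forall>\<^sub>F h::real in at 0. h \<noteq> 0" by (simp add: eventually_at_filter)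
  show ?thesis
    unfolding DERIV_def tendsto_iff
  proof (intro iffI allI impI)
    fix \<epsilon> :: real assume \<epsilon>: "\<epsilon> > 0"
    assume "\<forall>e>0. \<forall>\<^sub>F h in at 0. dist ((f (a + h) - f a) / h) D < e"
    then have "\<forall>\<^sub>F h in at 0. dist ((f (a + h) - f a) / h) D < \<epsilon>" using \<epsilon> by blast
    with ne show "\<forall>\<^sub>F h in at 0. \<bar>f (a + h) - f a - h * D\<bar> \<le> \<epsilon> * \<bar>h\<bar>"
      by eventually_elim (simp add: eq[symmetric] dist_real_def mult_right_mono)
  next
    fix \<epsilon> :: real assume \<epsilon>: "\<epsilon> > 0"
    assume "\<forall>\<epsilon>>0. \<forall>\<^sub>F h in at 0. \<bar>f (a + h) - f a - h * D\<bar> \<le> \<epsilon> * \<bar>h\<bar>"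
    then have "\<forall>\<^sub>F h in at 0. \<bar>f (a + h) - f a - h * D\<bar> \<le> \<epsilon> / 2 * \<bar>h\<bar>" using \<epsilon> by (metis half_gt_zero)
    with ne show "\<forall>\<^sub>F h in at 0. dist ((f (a + h) - f a) / h) D < \<epsilon>"
    proof eventually_elim
      case (elim h)
      then have "\<bar>(f (a + h) - f a) / h - D\<bar> * \<bar>h\<bar> \<le> \<epsilon> / 2 * \<bar>h\<bar>" by (simp add: eq)
      then have "\<bar>(f (a + h) - f a) / h - D\<bar> \<le> \<epsilon> / 2" using elim(1) by (simp add: mult_le_cancel_right)
      then show ?case using \<epsilon> by (simp add: dist_real_def)
    qed
  qed
qed

lemma pd_Lipschitz_bound:
  assumes f: "ck (Suc 0) F U f" and u: "u \<in> U"
    and lip: "\<And>s. u(i := s) \<in> U \<Longrightarrow> \<bar>f (u(i := s)) - f u\<bar> \<le> K * \<bar>s - u i\<bar>"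
  shows "\<bar>pd i f u\<bar> \<le> K"
proof (rule field_le_epsilon)
  fix \<epsilon> :: real assume \<epsilon>: "\<epsilon> > 0"
  have "((\<lambda>s. f (u(i := s))) has_real_derivative pd i f u) (at (u i))"
    by (rule ck_Suc_DERIV[OF f u])
  then have "\<forall>\<^sub>F h in at 0. \<bar>f (u(i := u i + h)) - f (u(i := u i)) - h * pd i f u\<bar> \<le> \<epsilon> * \<bar>h\<bar>"
    unfolding DERIV_iff_eventually_le using \<epsilon> by blast
  moreover have "\<forall>\<^sub>F h in at 0. u(i := u i + h) \<in> U"
  proof -
    have "isCont (\<lambda>h. u i + h) 0" by (intro continuous_intros)
    then have "((\<lambda>h. u i + h) \<longlongrightarrow> u i) (at 0)" by (simp add: isCont_def)
    then show ?thesis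
      using eventually_compose_filterlim[OF eventually_fun_upd[OF ck_open[OF f] u]] by blast
  qed
  moreover have "\<forall>\<^sub>F h::real in at 0. h \<noteq> 0" by (simp add: eventually_at_filter)
  ultimately have "\<forall>\<^sub>F h::real in at 0. \<bar>pd i f u\<bar> \<le> K + \<epsilon>"
  proof eventually_elim
    case (elim h)
    have "\<bar>h * pd i f u\<bar> \<le> K * \<bar>h\<bar> + \<epsilon> * \<bar>h\<bar>" using elim(1) lip[OF elim(2)] by simp
    then have "\<bar>pd i f u\<bar> * \<bar>h\<bar> \<le> (K + \<epsilon>) * \<bar>h\<bar>" by (simp add: abs_mult algebra_simps)
    then show ?case using elim(3) by (simp add: mult_le_cancel_right)
  qed
  then show "\<bar>pd i f u\<bar> \<le> K + \<epsilon>" by simp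
qed

text \<open>\<open>K\<close> is fixed once and for all: by \<open>pd_space_bound\<close> the
  linearized equation has the same Lipschitz constant, so passing to derivatives shortens the time
  interval by an arbitrarily small amount only.\<close>

locale ode_param =
  fixes F :: "'j set" and \<tau> :: 'j and D0 :: "('j \<Rightarrow> real) set" and C :: "'c set" and K :: real
  assumes finF: "finite F" and \<tau>: "\<tau> \<in> F" and openD: "open D0" and depD: "depends_on F D0 (\<lambda>_. 0)"
    and time_inv: "\<And>P s. P \<in> D0 \<Longrightarrow> P(\<tau> := s) \<in> D0"
    and finC: "finite C" and K0: "K \<ge> 0"
begin

definition Dm :: "real \<Rightarrow> ('j \<Rightarrow> real) set" where "Dm T = {P\<in>D0. \<bar>P \<tau>\<bar> < T}"

definition Wd :: "real \<Rightarrow> ('c \<Rightarrow> real) set \<Rightarrow> ('j + 'c \<Rightarrow> real) set" where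
  "Wd T Y = {w. w \<circ> Inl \<in> Dm T \<and> w \<circ> Inr \<in> Y}"

text \<open>
  Time is the coordinate \<open>\<tau>\<close> of the parameter point \<open>P\<close>, and \<open>G c\<close> is a function of \<open>P\<close> and of the
  unknowns, combined by \<open>case_sum\<close>.
\<close>

definition ode_problem ::
  "nat \<Rightarrow> real \<Rightarrow> ('c \<Rightarrow> real) set \<Rightarrow> ('c \<Rightarrow> ('j + 'c \<Rightarrow> real) \<Rightarrow> real) \<Rightarrow> ('c \<Rightarrow> ('j \<Rightarrow> real) \<Rightarrow> real) \<Rightarrow> bool" where
  "ode_problem n T Y G y \<longleftrightarrow> 0 < T \<and> K * card C * T \<le> 1/2 \<and> open Y \<and> depends_on C Y (\<lambda>_. 0) \<and>
    (\<forall>v\<in>Y. \<forall>v'\<in>Y. \<forall>\<theta>\<in>{0..1}. (\<lambda>d. v d + \<theta> * (v' d - v d)) \<in> Y) \<and>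
    (\<forall>c\<in>C. ck n (F <+> C) (Wd T Y) (G c)) \<and>
    (\<forall>c\<in>C. \<forall>P\<in>Dm T. \<forall>v\<in>Y. \<forall>v'\<in>Y. \<bar>G c (case_sum P v) - G c (case_sum P v')\<bar> \<le> K * (\<Sum>d\<in>C. \<bar>v d - v' d\<bar>)) \<and>
    (\<forall>P\<in>Dm T. (\<lambda>d. y d P) \<in> Y) \<and>
    (\<forall>P\<in>Dm T. \<forall>c\<in>C. ((\<lambda>s. y c (P(\<tau> := s))) has_real_derivative G c (case_sum P (\<lambda>d. y d P))) (at (P \<tau>))) \<and>
    (\<forall>c\<in>C. ck n F (Dm T) (\<lambda>P. y c (P(\<tau> := 0))))"

lemma ode_problemD:
  assumes "ode_problem n T Y G y"
  shows "0 < T" "K * card C * T \<le> 1/2" "open Y" "depends_on C Y (\<lambda>_. 0)"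
    "\<And>v v' \<theta>. v \<in> Y \<Longrightarrow> v' \<in> Y \<Longrightarrow> 0 \<le> \<theta> \<Longrightarrow> \<theta> \<le> 1 \<Longrightarrow> (\<lambda>d. v d + \<theta> * (v' d - v d)) \<in> Y"
    "\<And>c. c \<in> C \<Longrightarrow> ck n (F <+> C) (Wd T Y) (G c)"
    "\<And>c P v v'. c \<in> C \<Longrightarrow> P \<in> Dm T \<Longrightarrow> v \<in> Y \<Longrightarrow> v' \<in> Y \<Longrightarrow>
      \<bar>G c (case_sum P v) - G c (case_sum P v')\<bar> \<le> K * (\<Sum>d\<in>C. \<bar>v d - v' d\<bar>)"
    "\<And>P. P \<in> Dm T \<Longrightarrow> (\<lambda>d. y d P) \<in> Y"
    "\<And>P c. P \<in> Dm T \<Longrightarrow> c \<in> C \<Longrightarrow>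
      ((\<lambda>s. y c (P(\<tau> := s))) has_real_derivative G c (case_sum P (\<lambda>d. y d P))) (at (P \<tau>))"
    "\<And>c. c \<in> C \<Longrightarrow> ck n F (Dm T) (\<lambda>P. y c (P(\<tau> := 0)))"
  using assms unfolding ode_problem_def by simp_all

lemma open_Dm: "open (Dm T)"
proof -
  have "open {P::'j \<Rightarrow> real. \<bar>P \<tau>\<bar> < T}"
    by (intro open_Collect_less continuous_intros
        continuous_on_product_then_coordinatewise[OF continuous_on_id])
  moreover have "Dm T = D0 \<inter> {P. \<bar>P \<tau>\<bar> < T}" by (auto simp: Dm_def)
  ultimately show ?thesis using openD by (simp add: open_Int)
qed

lemma depends_Dm: "depends_on F (Dm T) (\<lambda>_. 0)"
proof (rule depends_on_zeroI)
  fix u v assume u: "u \<in> Dm T" and e: "\<And>i. i \<in> F \<Longrightarrow> u i = v i"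
  have "u \<in> D0" using u by (simp add: Dm_def)
  from depends_onD(1)[OF depD this e] e[OF \<tau>] u show "v \<in> Dm T" by (simp add: Dm_def)
qed

lemma Dm_upd: "P \<in> D0 \<Longrightarrow> \<bar>s\<bar> < T \<Longrightarrow> P(\<tau> := s) \<in> Dm T"
  by (simp add: Dm_def time_inv)

lemma Dm_D0: "P \<in> Dm T \<Longrightarrow> P \<in> D0"
  by (simp add: Dm_def)

lemma Dm_mono: "T' \<le> T \<Longrightarrow> Dm T' \<subseteq> Dm T"
  by (auto simp: Dm_def)

lemma case_sum_Wd: "case_sum P v \<in> Wd T Y \<longleftrightarrow> P \<in> Dm T \<and> v \<in> Y"
  by (simp add: Wd_def case_sum_o_inj)

lemma Wd_mono: "T' \<le> T \<Longrightarrow> Wd T' Y \<subseteq> Wd T Y"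
  using Dm_mono by (auto simp: Wd_def)

lemma open_Wd: "open Y \<Longrightarrow> open (Wd T Y)"
proof -
  assume Y: "open Y"
  have "continuous_on UNIV (\<lambda>w::'j + 'c \<Rightarrow> real. w \<circ> Inl)"
    by (rule continuous_on_coordinatewise_then_product) (simp add: o_def)
  from open_vimage[OF open_Dm this] have "open ((\<lambda>w::'j + 'c \<Rightarrow> real. w \<circ> Inl) -` Dm T)" .
  moreover have "continuous_on UNIV (\<lambda>w::'j + 'c \<Rightarrow> real. w \<circ> Inr)"
    by (rule continuous_on_coordinatewise_then_product) (simp add: o_def)
  from open_vimage[OF Y this] have "open ((\<lambda>w::'j + 'c \<Rightarrow> real. w \<circ> Inr) -` Y)" .
  moreover have "Wd T Y = (\<lambda>w. w \<circ> Inl) -` Dm T \<inter> (\<lambda>w. w \<circ> Inr) -` Y" by (auto simp: Wd_def)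
  ultimately show ?thesis by (simp add: open_Int)
qed

lemma depends_Wd:
  assumes "depends_on C Y (\<lambda>_. 0)"
  shows "depends_on (F <+> C) (Wd T Y) (\<lambda>_. 0)"
proof (rule depends_on_zeroI)
  fix u v assume u: "u \<in> Wd T Y" and e: "\<And>i. i \<in> F <+> C \<Longrightarrow> u i = v i"
  have "v \<circ> Inl \<in> Dm T"
    by (rule depends_onD(1)[OF depends_Dm, of "u \<circ> Inl"]) (use u e[OF InlI] e[OF InrI] in \<open>simp_all add: Wd_def\<close>)
  moreover have "v \<circ> Inr \<in> Y"
    by (rule depends_onD(1)[OF assms, of "u \<circ> Inr"]) (use u e[OF InlI] e[OF InrI] in \<open>simp_all add: Wd_def\<close>)
  ultimately show "v \<in> Wd T Y" by (simp add: Wd_def)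
qed

lemma ck_subst:
  assumes f: "ck n (F <+> C) (Wd T Y) f" and g: "\<And>d. d \<in> C \<Longrightarrow> ck n F (Dm T) (g d)"
    and Y: "\<And>P. P \<in> Dm T \<Longrightarrow> (\<lambda>d. g d P) \<in> Y"
  shows "ck n F (Dm T) (\<lambda>P. f (case_sum P (\<lambda>d. g d P)))"
proof (rule ck_compose[OF f _ finF open_Dm depends_Dm])
  fix k assume "k \<in> F <+> C"
  then show "ck n F (Dm T) (\<lambda>P. case_sum P (\<lambda>d. g d P) k)"
    by (cases k) (auto intro: g ck_coord[OF finF open_Dm depends_Dm])
next
  fix P assume "P \<in> Dm T"
  then show "(\<lambda>k. case_sum P (\<lambda>d. g d P) k) \<in> Wd T Y" using Y by (simp add: case_sum_Wd)
qed

lemma ck_lift: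
  assumes A: "ck n F (Dm T) A" and Y: "open Y" "depends_on C Y (\<lambda>_. 0)"
  shows "ck n (F <+> C) (Wd T Y) (\<lambda>w. A (w \<circ> Inl))"
  unfolding comp_def
proof (rule ck_compose[OF A _ _ open_Wd[OF Y(1)] depends_Wd[OF Y(2)]])
  show fin: "finite (F <+> C)" using finF finC by simp
  show "ck n (F <+> C) (Wd T Y) (\<lambda>w. w (Inl j))" if "j \<in> F" for j
    by (rule ck_coord[OF fin open_Wd[OF Y(1)] depends_Wd[OF Y(2)]]) (use that in auto)
  show "(\<lambda>j. w (Inl j)) \<in> Dm T" if "w \<in> Wd T Y" for w
    using that by (simp add: Wd_def comp_def)
qed

lemma ode_problem_lower:
  assumes p: "ode_problem n T Y G y" and T': "0 < T'" "T' \<le> T" and m: "m \<le> n"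
  shows "ode_problem m T' Y G y"
proof -
  note P = ode_problemD[OF p]
  have "K * card C * T' \<le> K * card C * T" by (rule mult_left_mono[OF T'(2)]) (simp add: K0)
  then have KT: "K * card C * T' \<le> 1/2" using P(2) by linarith
  have G: "ck m (F <+> C) (Wd T' Y) (G c)" if "c \<in> C" for c
    by (rule ck_subset[OF ck_le[OF P(6)[OF that] m] Wd_mono[OF T'(2)] open_Wd[OF P(3)] depends_Wd[OF P(4)]])
  have i: "ck m F (Dm T') (\<lambda>P. y c (P(\<tau> := 0)))" if "c \<in> C" for c
    by (rule ck_subset[OF ck_le[OF P(10)[OF that] m] Dm_mono[OF T'(2)] open_Dm depends_Dm])
  note D = subsetD[OF Dm_mono[OF T'(2)]]
  show ?thesis
    unfolding ode_problem_def
    by (intro conjI ballI T'(1) KT P(3) P(4) P(5) G P(7)[OF _ D] P(8)[OF D] P(9)[OF D] i) simp_all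
qed

text \<open>The right-hand sides are compared along the solution with parameter \<open>P'\<close>
  alone; the effect of the different state is absorbed by the Lipschitz term in
  \<open>ode_stability\<close>.\<close>

lemma ode_compare:
  assumes p: "ode_problem n T Y G y" and T': "0 < T'" "T' < T" and P: "P \<in> D0" "P' \<in> D0"
    and init: "\<And>c. c \<in> C \<Longrightarrow> \<bar>y c (P(\<tau> := 0)) - y c (P'(\<tau> := 0))\<bar> \<le> \<beta>0"
    and dist: "\<And>c s. c \<in> C \<Longrightarrow> \<bar>s\<bar> \<le> T' \<Longrightarrow>
      \<bar>G c (case_sum (P(\<tau> := s)) (\<lambda>d. y d (P'(\<tau> := s)))) - G c (case_sum (P'(\<tau> := s)) (\<lambda>d. y d (P'(\<tau> := s))))\<bar> \<le> \<beta>"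
    and c: "c \<in> C" and s: "\<bar>s\<bar> \<le> T'"
  shows "\<bar>y c (P(\<tau> := s)) - y c (P'(\<tau> := s))\<bar> \<le> 2 * (\<beta>0 + T' * \<beta>)"
proof -
  note pr = ode_problemD[OF p]
  have "K * card C * T' \<le> K * card C * T" by (rule mult_left_mono) (use K0 T' in simp_all)
  then have KT: "K * card C * T' \<le> 1/2" using pr(2) by linarith
  let ?g = "\<lambda>P c s. G c (case_sum (P(\<tau> := s)) (\<lambda>d. y d (P(\<tau> := s))))"
  have der: "((\<lambda>s. y c (Q(\<tau> := s))) has_real_derivative ?g Q c s) (at s within {-T'..T'})"
    if "Q \<in> D0" "c \<in> C" "\<bar>s\<bar> \<le> T'" for Q c s
  proof -
    have "Q(\<tau> := s) \<in> Dm T" using that T' by (intro Dm_upd) auto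
    from pr(9)[OF this that(2)] show ?thesis by (simp add: has_field_derivative_at_within)
  qed
  show ?thesis
  proof (rule ode_stability[OF finC T'(1) K0 KT, where
        e="\<lambda>c s. y c (P(\<tau> := s)) - y c (P'(\<tau> := s))" and e'="\<lambda>c s. ?g P c s - ?g P' c s"])
    fix c s assume cs: "c \<in> C" "\<bar>s\<bar> \<le> T'"
    show "((\<lambda>s. y c (P(\<tau> := s)) - y c (P'(\<tau> := s))) has_real_derivative ?g P c s - ?g P' c s)
        (at s within {-T'..T'})"
      by (rule DERIV_diff[OF der[OF P(1) cs] der[OF P(2) cs]])
    have D: "P(\<tau> := s) \<in> Dm T" "P'(\<tau> := s) \<in> Dm T" using P cs T' by (auto intro: Dm_upd)
    from pr(7)[OF cs(1) D(1) pr(8)[OF D(1)] pr(8)[OF D(2)]] dist[OF cs]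
    show "\<bar>?g P c s - ?g P' c s\<bar> \<le> K * (\<Sum>d\<in>C. \<bar>y d (P(\<tau> := s)) - y d (P'(\<tau> := s))\<bar>) + \<beta>"
      by linarith
  qed (use init c s in auto)
qed

text \<open>Both claims come from \<open>ode_compare\<close>. If the parameters agree on
  \<open>F\<close>, its data are zero. Near \<open>P0\<close> its data are uniformly small on a
  compact time interval, and the change of the time coordinate is covered by continuity of the
  single solution through \<open>P0\<close>.\<close>

lemma ode_sol_ck0:
  assumes p: "ode_problem n T Y G y" and c: "c \<in> C"
  shows "ck 0 F (Dm T) (y c)"
proof -
  note pr = ode_problemD[OF p]
  have G0: "ck 0 (F <+> C) (Wd T Y) (G c)" if "c \<in> C" for c by (rule ck_0[OF pr(6)[OF that]])
  have time_der: "((\<lambda>s. y c (P(\<tau> := s))) has_real_derivative G c (case_sum (P(\<tau> := s)) (\<lambda>d. y d (P(\<tau> := s))))) (at s)"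
    if "P \<in> D0" "\<bar>s\<bar> < T" "c \<in> C" for P s c
    using pr(9)[OF Dm_upd[OF that(1,2)] that(3)] by simp
  \<comment> \<open>Provides a compact time interval around 0 that contains the time of
    \<open>P\<close> and still lies in the open range.\<close>
  have T2: "\<exists>T'>0. T' < T \<and> \<bar>P \<tau>\<bar> < T'" if "P \<in> Dm T" for P
  proof -
    have "\<bar>P \<tau>\<bar> < T" using that by (simp add: Dm_def)
    from dense[OF this] obtain T' where "\<bar>P \<tau>\<bar> < T'" "T' < T" by (elim exE conjE)
    then show ?thesis by (intro exI[of _ T']) linarith
  qed
  have dep: "depends_on F (Dm T) (y c)"
    unfolding depends_on_def
  proof (intro ballI allI impI conjI)
    fix u v assume u: "u \<in> Dm T" and uv: "\<forall>i\<in>F. u i = v i"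
    show v: "v \<in> Dm T" by (rule depends_onD(1)[OF depends_Dm u]) (use uv in auto)
    from T2[OF u] obtain T' where T': "0 < T'" "T' < T" "\<bar>u \<tau>\<bar> < T'" by blast
    have D: "u \<in> D0" "v \<in> D0" using u v by (auto simp: Dm_def)
    have "\<bar>y c (u(\<tau> := u \<tau>)) - y c (v(\<tau> := u \<tau>))\<bar> \<le> 2 * (0 + T' * 0)"
    proof (rule ode_compare[OF p T'(1,2) D _ _ c])
      fix c assume c: "c \<in> C"
      have "y c (v(\<tau> := 0)) = y c (u(\<tau> := 0))"
        by (rule depends_onD(2)[OF ck_depends[OF pr(10)[OF c]] u]) (use uv in auto)
      then show "\<bar>y c (u(\<tau> := 0)) - y c (v(\<tau> := 0))\<bar> \<le> 0" by simp
      fix s assume s: "\<bar>s\<bar> \<le> T'"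
      then have "u(\<tau> := s) \<in> Dm T" "v(\<tau> := s) \<in> Dm T" using D T' by (auto intro: Dm_upd)
      then have "case_sum (u(\<tau> := s)) (\<lambda>d. y d (v(\<tau> := s))) \<in> Wd T Y"
        using pr(8) by (simp add: case_sum_Wd)
      then have "G c (case_sum (v(\<tau> := s)) (\<lambda>d. y d (v(\<tau> := s)))) = G c (case_sum (u(\<tau> := s)) (\<lambda>d. y d (v(\<tau> := s))))"
      proof (rule depends_onD(2)[OF ck_depends[OF pr(6)[OF c]]])
        fix k assume "k \<in> F <+> C"
        then show "case_sum (u(\<tau> := s)) (\<lambda>d. y d (v(\<tau> := s))) k = case_sum (v(\<tau> := s)) (\<lambda>d. y d (v(\<tau> := s))) k"
          using uv by (cases k) auto
      qed
      then show "\<bar>G c (case_sum (u(\<tau> := s)) (\<lambda>d. y d (v(\<tau> := s)))) - G c (case_sum (v(\<tau> := s)) (\<lambda>d. y d (v(\<tau> := s))))\<bar> \<le> 0"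
        by simp
    qed (use T' in simp)
    then show "y c u = y c v" using uv \<tau> by (simp add: fun_upd_idem)
  qed
  have cont_s: "continuous_on {-T'..T'} (\<lambda>s. y d (P(\<tau> := s)))" if "P \<in> D0" "T' < T" "d \<in> C" for P T' d
    by (rule DERIV_continuous_on, rule has_field_derivative_at_within, rule time_der) (use that in auto)
  have "continuous_on (Dm T) (y c)"
    unfolding continuous_on_def
  proof
    fix P0 assume P0: "P0 \<in> Dm T"
    from T2[OF P0] obtain T' where T': "0 < T'" "T' < T" "\<bar>P0 \<tau>\<bar> < T'" by blast
    have P0D: "P0 \<in> D0" using P0 by (simp add: Dm_def)
    have "((\<lambda>P. y c P) \<longlongrightarrow> y c P0) (nhds P0)"
    proof (rule tendstoI)
      fix e :: real assume e: "e > 0"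
      \<comment> \<open>Chosen so that the bound \<open>2 * (\<beta> + T' * \<beta>)\<close> from
        \<open>ode_compare\<close> equals \<open>e / 2\<close>.\<close>
      define \<beta> where "\<beta> = e / (4 * (1 + T'))"
      have \<beta>: "\<beta> > 0" using e T' by (simp add: \<beta>_def)
      have "\<forall>\<^sub>F P in nhds P0. \<forall>s\<in>{-T'..T'}. \<bar>G c (case_sum (P(\<tau> := s)) (\<lambda>d. y d (P0(\<tau> := s)))) - G c (case_sum (P0(\<tau> := s)) (\<lambda>d. y d (P0(\<tau> := s))))\<bar> \<le> \<beta>"
        if c: "c \<in> C" for c
      proof -
        have "continuous_on (D0 \<times> {-T'..T'}) (\<lambda>x. G c (case_sum ((fst x)(\<tau> := snd x)) (\<lambda>d. y d (P0(\<tau> := snd x)))))"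
        proof (rule ck0_continuous_compose[OF G0[OF c]])
          fix x assume "x \<in> D0 \<times> {-T'..T'}"
          then have "fst x \<in> D0" "\<bar>snd x\<bar> < T" using T' by auto
          then have "(fst x)(\<tau> := snd x) \<in> Dm T" "P0(\<tau> := snd x) \<in> Dm T" using Dm_upd P0D by blast+
          then show "case_sum ((fst x)(\<tau> := snd x)) (\<lambda>d. y d (P0(\<tau> := snd x))) \<in> Wd T Y"
            using pr(8) by (simp add: case_sum_Wd)
        next
          fix k assume "k \<in> F <+> C"
          then consider j where "k = Inl j" "j \<in> F" | d where "k = Inr d" "d \<in> C" by blast
          then show "continuous_on (D0 \<times> {-T'..T'}) (\<lambda>x. case_sum ((fst x)(\<tau> := snd x)) (\<lambda>d. y d (P0(\<tau> := snd x))) k)"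
          proof cases
            case 1
            have "continuous_on (D0 \<times> {-T'..T'}) (\<lambda>x. fst x j)"
              by (rule continuous_on_product_then_coordinatewise) (intro continuous_intros)
            then show ?thesis using 1 by (cases "j = \<tau>") (auto intro: continuous_intros)
          next
            case 2
            have "continuous_on (D0 \<times> {-T'..T'}) (\<lambda>x. y d (P0(\<tau> := snd x)))"
              by (rule continuous_on_compose2[OF cont_s[OF P0D T'(2) 2(2)]]) (auto intro: continuous_intros)
            then show ?thesis using 2 by simp
          qed
        qed
        from eventually_uniformly_close[OF this _ openD P0D \<beta>] show ?thesis by simp
      qed
      then have ev1: "\<forall>\<^sub>F P in nhds P0. \<forall>c\<in>C. \<forall>s\<in>{-T'..T'}. \<bar>G c (case_sum (P(\<tau> := s)) (\<lambda>d. y d (P0(\<tau> := s)))) - G c (case_sum (P0(\<tau> := s)) (\<lambda>d. y d (P0(\<tau> := s))))\<bar> \<le> \<beta>"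
        using finC by (simp add: eventually_ball_finite)
      have "\<forall>\<^sub>F P in nhds P0. dist (y c (P(\<tau> := 0))) (y c (P0(\<tau> := 0))) < \<beta>" if "c \<in> C" for c
      proof -
        have "continuous_on (Dm T) (\<lambda>P. y c (P(\<tau> := 0)))" by (rule ck_continuous[OF pr(10)[OF that]])
        then have "((\<lambda>P. y c (P(\<tau> := 0))) \<longlongrightarrow> y c (P0(\<tau> := 0))) (at P0)"
          using P0 at_within_open[OF P0 open_Dm] unfolding continuous_on_def by force
        then have "((\<lambda>P. y c (P(\<tau> := 0))) \<longlongrightarrow> y c (P0(\<tau> := 0))) (nhds P0)"
          using tendsto_at_iff_tendsto_nhds[of "\<lambda>P. y c (P(\<tau> := 0))" P0] by simp
        from tendstoD[OF this \<beta>] show ?thesis .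
      qed
      then have ev2: "\<forall>\<^sub>F P in nhds P0. \<forall>c\<in>C. dist (y c (P(\<tau> := 0))) (y c (P0(\<tau> := 0))) < \<beta>"
        using finC by (simp add: eventually_ball_finite)
      have "isCont (\<lambda>s. y c (P0(\<tau> := s))) (P0 \<tau>)"
        using DERIV_isCont[OF pr(9)[OF P0 c]] .
      then have "((\<lambda>s. y c (P0(\<tau> := s))) \<longlongrightarrow> y c (P0(\<tau> := P0 \<tau>))) (nhds (P0 \<tau>))"
        unfolding isCont_def by (rule tendsto_at_iff_tendsto_nhds[THEN iffD1])
      moreover have \<tau>lim: "((\<lambda>P. P \<tau>) \<longlongrightarrow> P0 \<tau>) (nhds P0)"
        using continuous_on_product_then_coordinatewise[OF continuous_on_id, of UNIV \<tau>]
          tendsto_at_iff_tendsto_nhds[of "\<lambda>P. P \<tau>" P0] by (auto simp: continuous_on_def)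
      ultimately have "((\<lambda>P. y c (P0(\<tau> := P \<tau>))) \<longlongrightarrow> y c (P0(\<tau> := P0 \<tau>))) (nhds P0)"
        by (rule filterlim_compose)
      then have "((\<lambda>P. y c (P0(\<tau> := P \<tau>))) \<longlongrightarrow> y c P0) (nhds P0)" by simp
      then have ev3: "\<forall>\<^sub>F P in nhds P0. dist (y c (P0(\<tau> := P \<tau>))) (y c P0) < e / 2"
        by (rule tendstoD) (use e in simp)
      have ev4: "\<forall>\<^sub>F P in nhds P0. P \<in> D0" using openD P0D by (rule eventually_nhds_in_open)
      have ev5: "\<forall>\<^sub>F P in nhds P0. \<bar>P \<tau>\<bar> < T'"
        using order_tendstoD(2)[OF tendsto_rabs[OF \<tau>lim] T'(3)] .
      from ev1 ev2 ev3 ev4 ev5 show "\<forall>\<^sub>F P in nhds P0. dist (y c P) (y c P0) < e"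
      proof eventually_elim
        case (elim P)
        have "\<bar>y c (P(\<tau> := P \<tau>)) - y c (P0(\<tau> := P \<tau>))\<bar> \<le> 2 * (\<beta> + T' * \<beta>)"
        proof (rule ode_compare[OF p T'(1,2) elim(4) P0D _ _ c])
          show "\<bar>y c (P(\<tau> := 0)) - y c (P0(\<tau> := 0))\<bar> \<le> \<beta>" if "c \<in> C" for c
            using elim(2) that by (simp add: dist_real_def less_imp_le)
          show "\<bar>G c (case_sum (P(\<tau> := s)) (\<lambda>d. y d (P0(\<tau> := s)))) - G c (case_sum (P0(\<tau> := s)) (\<lambda>d. y d (P0(\<tau> := s))))\<bar> \<le> \<beta>"
            if "c \<in> C" "\<bar>s\<bar> \<le> T'" for c s
            by (rule elim(1)[rule_format]) (use that in auto)
        qed (use elim(5) in simp)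
        also have "2 * (\<beta> + T' * \<beta>) = 2 * (1 + T') * \<beta>" by (simp add: algebra_simps)
        also have "\<dots> = e / 2" using T' by (simp add: \<beta>_def field_simps)
        finally have "dist (y c P) (y c (P0(\<tau> := P \<tau>))) \<le> e / 2" by (simp add: dist_real_def)
        with elim(3) dist_triangle[of "y c P" "y c P0" "y c (P0(\<tau> := P \<tau>))"] show ?case
          by linarith
      qed
    qed
    then show "(y c \<longlongrightarrow> y c P0) (at P0 within Dm T)"
      by (rule tendsto_mono[rotated]) (simp add: at_within_def)
  qed
  then show ?thesis using finF open_Dm dep by simp
qed

lemma pd_space_bound:
  assumes p: "ode_problem (Suc n) T Y G y" and w: "w \<in> Wd T Y" and c: "c \<in> C" and d: "d \<in> C"
  shows "\<bar>pd (Inr d) (G c) w\<bar> \<le> K"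
proof (rule pd_Lipschitz_bound[OF ck_le[OF ode_problemD(6)[OF p c]] w])
  have eq: "case_sum (v \<circ> Inl) (v \<circ> Inr) = v" for v :: "'j + 'c \<Rightarrow> real"
    by (simp add: fun_eq_iff split: sum.split)
  fix s assume ws: "w(Inr d := s) \<in> Wd T Y"
  have "w(Inr d := s) \<circ> Inl = w \<circ> Inl" by auto
  then have "\<bar>G c (w(Inr d := s)) - G c w\<bar> \<le> K * (\<Sum>k\<in>C. \<bar>(w(Inr d := s)) (Inr k) - w (Inr k)\<bar>)"
    using ode_problemD(7)[OF p c, of "w \<circ> Inl" "w(Inr d := s) \<circ> Inr" "w \<circ> Inr"] w ws
      eq[of w] eq[of "w(Inr d := s)"] by (simp add: Wd_def)
  also have "(\<Sum>k\<in>C. \<bar>(w(Inr d := s)) (Inr k) - w (Inr k)\<bar>) = (\<Sum>k\<in>C. if k = d then \<bar>s - w (Inr d)\<bar> else 0)"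
    by (rule sum.cong) auto
  also have "\<dots> = \<bar>s - w (Inr d)\<bar>" using d finC by simp
  finally show "\<bar>G c (w(Inr d := s)) - G c w\<bar> \<le> K * \<bar>s - w (Inr d)\<bar>" .
qed simp

text \<open>Linear right-hand sides are globally Lipschitz, so \<open>picard\<close> applies at each
  parameter point separately. Regularity of \<open>E\<close> in the parameters comes later, from the
  induction in \<open>ode_smooth_dependence\<close>.\<close>

lemma linear_ode_exists:
  assumes T: "0 < T'" "T' < T" "K * card C * T \<le> 1/2"
    and A: "\<And>c d. c \<in> C \<Longrightarrow> d \<in> C \<Longrightarrow> ck 0 F (Dm T) (A c d)"
    and AK: "\<And>c d P. c \<in> C \<Longrightarrow> d \<in> C \<Longrightarrow> P \<in> Dm T \<Longrightarrow> \<bar>A c d P\<bar> \<le> K"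
    and B: "\<And>c. c \<in> C \<Longrightarrow> ck 0 F (Dm T) (B c)"
  shows "\<exists>E. \<forall>c\<in>C. \<forall>P\<in>D0. E c (P(\<tau> := 0)) = E0 c (P(\<tau> := 0)) \<and>
    (\<forall>s. \<bar>s\<bar> < T' \<longrightarrow> ((\<lambda>s. E c (P(\<tau> := s))) has_real_derivative
       (\<Sum>d\<in>C. A c d (P(\<tau> := s)) * E d (P(\<tau> := s))) + B c (P(\<tau> := s))) (at s))"
proof -
  have "K * card C * T' \<le> K * card C * T" by (rule mult_left_mono) (use K0 T in simp_all)
  then have KT: "K * card C * T' \<le> 1/2" using T(3) by linarith
  have line: "continuous_on {-T'..T'} (\<lambda>s. f (P(\<tau> := s)))" if f: "ck 0 F (Dm T) f" and P: "P \<in> D0" for f P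
  proof (rule ck0_continuous_compose[OF f])
    show "P(\<tau> := s) \<in> Dm T" if "s \<in> {-T'..T'}" for s using that T P by (intro Dm_upd) auto
    show "continuous_on {-T'..T'} (\<lambda>s. (P(\<tau> := s)) j)" for j
      by (cases "j = \<tau>") (auto intro: continuous_intros)
  qed
  have "\<exists>z. \<forall>c\<in>C. z c 0 = E0 c (P(\<tau> := 0)) \<and>
    (\<forall>t\<in>{-T'..T'}. (z c has_real_derivative (\<Sum>d\<in>C. A c d (P(\<tau> := t)) * z d t) + B c (P(\<tau> := t))) (at t within {-T'..T'}))"
    if P: "P \<in> D0" for P
  proof (rule picard[OF finC T(1) K0 KT, where g="\<lambda>c t v. (\<Sum>d\<in>C. A c d (P(\<tau> := t)) * v d) + B c (P(\<tau> := t))"])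
    fix c and v :: "'c \<Rightarrow> real \<Rightarrow> real"
    assume c: "c \<in> C" and v: "\<And>d. d \<in> C \<Longrightarrow> continuous_on {-T'..T'} (v d)"
    show "continuous_on {-T'..T'} (\<lambda>t. (\<Sum>d\<in>C. A c d (P(\<tau> := t)) * v d t) + B c (P(\<tau> := t)))"
      by (rule continuous_on_add[OF continuous_on_sum[OF continuous_on_mult] line[OF B[OF c] P]])
        (rule line[OF A[OF c] P], assumption, rule v, assumption)
  next
    fix c t and v v' :: "'c \<Rightarrow> real"
    assume c: "c \<in> C" and t: "t \<in> {-T'..T'}"
    have D: "P(\<tau> := t) \<in> Dm T" using t T P by (intro Dm_upd) auto
    have "(\<Sum>d\<in>C. A c d (P(\<tau> := t)) * v d) + B c (P(\<tau> := t)) - ((\<Sum>d\<in>C. A c d (P(\<tau> := t)) * v' d) + B c (P(\<tau> := t)))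
      = (\<Sum>d\<in>C. A c d (P(\<tau> := t)) * (v d - v' d))"
      by (simp add: right_diff_distrib sum_subtractf)
    also have "\<bar>\<dots>\<bar> \<le> (\<Sum>d\<in>C. K * \<bar>v d - v' d\<bar>)"
      by (rule order_trans[OF sum_abs sum_mono]) (use AK[OF c _ D] in \<open>simp add: abs_mult mult_right_mono\<close>)
    finally show "\<bar>(\<Sum>d\<in>C. A c d (P(\<tau> := t)) * v d) + B c (P(\<tau> := t)) - ((\<Sum>d\<in>C. A c d (P(\<tau> := t)) * v' d) + B c (P(\<tau> := t)))\<bar>
      \<le> K * (\<Sum>d\<in>C. \<bar>v d - v' d\<bar>)"
      by (simp add: sum_distrib_left)
  qed
  then have "\<forall>P\<in>D0. \<exists>z. \<forall>c\<in>C. z c 0 = E0 c (P(\<tau> := 0)) \<and>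
    (\<forall>t\<in>{-T'..T'}. (z c has_real_derivative (\<Sum>d\<in>C. A c d (P(\<tau> := t)) * z d t) + B c (P(\<tau> := t))) (at t within {-T'..T'}))"
    by (rule ballI)
  from bchoice[OF this] obtain Z where Z': "\<forall>P\<in>D0. \<forall>c\<in>C. Z P c 0 = E0 c (P(\<tau> := 0)) \<and>
    (\<forall>t\<in>{-T'..T'}. (Z P c has_real_derivative (\<Sum>d\<in>C. A c d (P(\<tau> := t)) * Z P d t) + B c (P(\<tau> := t))) (at t within {-T'..T'}))" ..
  have Z: "Z P c 0 = E0 c (P(\<tau> := 0))"
    "\<And>t. t \<in> {-T'..T'} \<Longrightarrow>
      (Z P c has_real_derivative (\<Sum>d\<in>C. A c d (P(\<tau> := t)) * Z P d t) + B c (P(\<tau> := t))) (at t within {-T'..T'})"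
    if "P \<in> D0" "c \<in> C" for P c
    using Z'[rule_format, OF that] by simp_all
  \<comment> \<open>\<open>Z\<close> is chosen point by point. Resetting the time makes all points
    of one time line use the same solution.\<close>
  define E where "E c P = Z (P(\<tau> := 0)) c (P \<tau>)" for c P
  have E: "E c (P(\<tau> := s)) = Z (P(\<tau> := 0)) c s" for c P s by (simp add: E_def)
  have "((\<lambda>s. E c (P(\<tau> := s))) has_real_derivative
       (\<Sum>d\<in>C. A c d (P(\<tau> := s)) * E d (P(\<tau> := s))) + B c (P(\<tau> := s))) (at s)"
    if "c \<in> C" "P \<in> D0" "\<bar>s\<bar> < T'" for c P s
  proof -
    have "at s within {-T'..T'} = at s" by (rule at_within_interior) (use that in auto)
    moreover have "s \<in> {-T'..T'}" using that(3) by auto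
    ultimately show ?thesis using Z(2)[OF time_inv[OF that(2), of 0] that(1), of s] by (simp add: E)
  qed
  moreover have "E c (P(\<tau> := 0)) = E0 c (P(\<tau> := 0))" if "c \<in> C" "P \<in> D0" for c P
    using Z(1)[OF time_inv[OF that(2), of 0] that(1)] by (simp add: E)
  ultimately show ?thesis by blast
qed

text \<open>
  Along the segment \<open>\<theta> \<mapsto> w h s \<theta>\<close> between two solutions the mean value theorem turns the equation for
  their difference into a linear one, with coefficients uniformly close to those of the linearization.
\<close>

lemma ode_sol_diff:
  assumes p: "ode_problem (Suc 0) T Y G y" and i: "i \<in> F" "i \<noteq> \<tau>" and T1: "T1 \<le> T"
    and E0: "\<And>c P. c \<in> C \<Longrightarrow> P \<in> D0 \<Longrightarrow> E c (P(\<tau> := 0)) = pd i (\<lambda>P. y c (P(\<tau> := 0))) (P(\<tau> := 0))"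
    and E: "\<And>c P s. c \<in> C \<Longrightarrow> P \<in> D0 \<Longrightarrow> \<bar>s\<bar> < T1 \<Longrightarrow> ((\<lambda>s. E c (P(\<tau> := s))) has_real_derivative
       (\<Sum>d\<in>C. pd (Inr d) (G c) (case_sum (P(\<tau> := s)) (\<lambda>d. y d (P(\<tau> := s)))) * E d (P(\<tau> := s)))
       + pd (Inl i) (G c) (case_sum (P(\<tau> := s)) (\<lambda>d. y d (P(\<tau> := s))))) (at s)"
    and c0: "c0 \<in> C" and P: "P \<in> Dm T1"
  shows "((\<lambda>s. y c0 (P(i := s))) has_real_derivative E c0 P) (at (P i))"
proof -
  note pr = ode_problemD[OF p]
  have yc: "ck 0 F (Dm T) (y d)" if "d \<in> C" for d by (rule ode_sol_ck0[OF p that])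
  have PD: "P \<in> D0" using P by (rule Dm_D0)
  obtain T' where T': "\<bar>P \<tau>\<bar> < T'" "T' < T1" using P dense[of "\<bar>P \<tau>\<bar>" T1] unfolding Dm_def by blast
  have T'0: "0 < T'" using T' by linarith
  have "K * card C * T' \<le> K * card C * T" by (rule mult_left_mono) (use K0 T' T1 in simp_all)
  then have KT: "K * card C * T' \<le> 1/2" using pr(2) by linarith
  have "\<forall>\<^sub>F s in nhds (P i). P(i := s) \<in> D0" by (rule eventually_fun_upd[OF openD PD])
  then obtain \<delta> where \<delta>: "\<delta> > 0" "\<And>s. dist s (P i) < \<delta> \<Longrightarrow> P(i := s) \<in> D0"
    by (auto simp: eventually_nhds_metric)
  define Q where "Q h s = P(i := P i + h, \<tau> := s)" for h s
  have Q0: "Q 0 s = P(\<tau> := s)" for s by (simp add: Q_def)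
  have Qbase: "P(i := P i + h) \<in> D0" if "\<bar>h\<bar> < \<delta>" for h using \<delta>(2) that by (simp add: dist_real_def)
  have QD: "Q h s \<in> Dm T" if "\<bar>h\<bar> < \<delta>" "\<bar>s\<bar> \<le> T'" for h s
    unfolding Q_def by (rule Dm_upd[OF Qbase[OF that(1)]]) (use that T' T1 in linarith)
  define w where "w h s \<theta> = case_sum (Q (\<theta> * h) s) (\<lambda>d. y d (Q 0 s) + \<theta> * (y d (Q h s) - y d (Q 0 s)))" for h s \<theta>
  have \<theta>h: "\<bar>\<theta> * h\<bar> < \<delta>" if "\<bar>h\<bar> < \<delta>" "0 \<le> \<theta>" "\<theta> \<le> 1" for \<theta> h
  proof -
    have "\<bar>\<theta> * h\<bar> \<le> \<bar>h\<bar>" using that by (simp add: abs_mult mult_left_le_one_le)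
    then show ?thesis using that by linarith
  qed
  have wW: "w h s \<theta> \<in> Wd T Y" if "\<bar>h\<bar> < \<delta>" "\<bar>s\<bar> \<le> T'" "0 \<le> \<theta>" "\<theta> \<le> 1" for h s \<theta>
    unfolding w_def case_sum_Wd
    using QD[OF \<theta>h[OF that(1,3,4)] that(2)] pr(5)[OF pr(8)[OF QD[of 0 s]] pr(8)[OF QD[OF that(1,2)]] that(3,4)] \<delta>(1) that(2)
    by simp
  let ?Cc = "{-T'..T'} \<times> {0..1::real}"
  have contQ: "continuous_on S (\<lambda>x. y d (Q (f x) (g x)))"
    if "d \<in> C" "continuous_on S f" "continuous_on S g" "\<And>x. x \<in> S \<Longrightarrow> \<bar>f x\<bar> < \<delta>" "\<And>x. x \<in> S \<Longrightarrow> \<bar>g x\<bar> \<le> T'"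
    for d f g and S :: "(real \<times> real \<times> real) set"
  proof (rule ck0_continuous_compose[OF yc[OF that(1)]])
    show "Q (f x) (g x) \<in> Dm T" if "x \<in> S" for x using QD that \<open>\<And>x. x \<in> S \<Longrightarrow> \<bar>f x\<bar> < \<delta>\<close> \<open>\<And>x. x \<in> S \<Longrightarrow> \<bar>g x\<bar> \<le> T'\<close> by blast
    show "continuous_on S (\<lambda>x. Q (f x) (g x) j)" for j
      unfolding Q_def using that(2,3) by (cases "j = \<tau>"; cases "j = i") (auto intro!: continuous_intros)
  qed
  have contw: "continuous_on ({-\<delta><..<\<delta>} \<times> ?Cc) (\<lambda>x. pd k (G c) (w (fst x) (fst (snd x)) (snd (snd x))))"
    if c: "c \<in> C" for c k
  proof (rule ck0_continuous_compose[OF ck_pd[OF pr(6)[OF c]]])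
    show "w (fst x) (fst (snd x)) (snd (snd x)) \<in> Wd T Y" if "x \<in> {-\<delta><..<\<delta>} \<times> ?Cc" for x
      by (rule wW) (use that in auto)
    fix m assume "m \<in> F <+> C"
    then consider j where "m = Inl j" "j \<in> F" | d where "m = Inr d" "d \<in> C" by blast
    then show "continuous_on ({-\<delta><..<\<delta>} \<times> ?Cc) (\<lambda>x. w (fst x) (fst (snd x)) (snd (snd x)) m)"
    proof cases
      case 1
      then show ?thesis unfolding w_def Q_def
        by (cases "j = \<tau>"; cases "j = i") (auto intro!: continuous_intros)
    next
      case 2
      have "continuous_on ({-\<delta><..<\<delta>} \<times> ?Cc) (\<lambda>x. y d (Q 0 (fst (snd x))))"
        "continuous_on ({-\<delta><..<\<delta>} \<times> ?Cc) (\<lambda>x. y d (Q (fst x) (fst (snd x))))"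
        by (rule contQ[OF 2(2)]; use \<delta>(1) in \<open>auto intro!: continuous_intros\<close>)+
      then show ?thesis using 2 unfolding w_def by (auto intro!: continuous_intros)
    qed
  qed
  let ?ks = "insert (Inl i) (Inr ` C)"
  have unif: "\<forall>\<^sub>F h in nhds 0. \<forall>c\<in>C. \<forall>k\<in>?ks. \<forall>s \<theta>. \<bar>s\<bar> \<le> T' \<longrightarrow> 0 \<le> \<theta> \<longrightarrow> \<theta> \<le> 1 \<longrightarrow>
      \<bar>pd k (G c) (w h s \<theta>) - pd k (G c) (w 0 s \<theta>)\<bar> \<le> \<epsilon>" if \<epsilon>: "\<epsilon> > 0" for \<epsilon>
  proof -
    have ev: "\<forall>\<^sub>F h in nhds 0. \<forall>x\<in>?Cc. \<bar>pd k (G c) (w h (fst x) (snd x)) - pd k (G c) (w 0 (fst x) (snd x))\<bar> \<le> \<epsilon>"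
      if "c \<in> C" for c k
      using eventually_uniformly_close[OF contw[OF that] _ _ _ \<epsilon>, of 0] \<delta>(1) by (simp add: compact_Times)
    have "\<forall>\<^sub>F h in nhds 0. \<forall>c\<in>C. \<forall>k\<in>?ks. \<forall>x\<in>?Cc. \<bar>pd k (G c) (w h (fst x) (snd x)) - pd k (G c) (w 0 (fst x) (snd x))\<bar> \<le> \<epsilon>"
    proof (rule eventually_ball_finite[OF finC], rule ballI, rule eventually_ball_finite)
      show "finite ?ks" using finC by simp
    qed (rule ballI, rule ev)
    then show ?thesis
    proof eventually_elim
      case (elim h)
      show ?case
      proof (intro ballI allI impI)
        fix c k s \<theta> assume a: "c \<in> C" "k \<in> ?ks" "\<bar>s\<bar> \<le> T'" "0 \<le> \<theta>" "\<theta> \<le> (1::real)"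
        have "(s, \<theta>) \<in> ?Cc" using a by auto
        from elim[rule_format, OF a(1,2) this]
        show "\<bar>pd k (G c) (w h s \<theta>) - pd k (G c) (w 0 s \<theta>)\<bar> \<le> \<epsilon>" by simp
      qed
    qed
  qed
  have w0: "w 0 s \<theta> = case_sum (P(\<tau> := s)) (\<lambda>d. y d (P(\<tau> := s)))" for s \<theta> by (simp add: w_def Q0)
  have "\<exists>M. \<forall>s\<in>{-T'..T'}. \<bar>E d (P(\<tau> := s))\<bar> \<le> M" if d: "d \<in> C" for d
  proof -
    have "continuous_on {-T'..T'} (\<lambda>s. E d (P(\<tau> := s)))"
      by (rule DERIV_continuous_on, rule has_field_derivative_at_within, rule E[OF d PD]) (use T' in auto)
    then have "bounded ((\<lambda>s. E d (P(\<tau> := s))) ` {-T'..T'})"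
      by (intro compact_imp_bounded compact_continuous_image) simp_all
    then show ?thesis by (simp add: bounded_iff)
  qed
  then obtain M0 where M0: "\<And>d s. d \<in> C \<Longrightarrow> s \<in> {-T'..T'} \<Longrightarrow> \<bar>E d (P(\<tau> := s))\<bar> \<le> M0 d" by metis
  define M where "M = (\<Sum>d\<in>C. \<bar>M0 d\<bar>)"
  have M: "M \<ge> 0" by (simp add: M_def sum_nonneg)
  have sumE: "(\<Sum>d\<in>C. \<bar>E d (P(\<tau> := s))\<bar>) \<le> M" if "\<bar>s\<bar> \<le> T'" for s
    unfolding M_def by (rule sum_mono) (use M0[of _ s] that in \<open>force simp: abs_le_iff\<close>)
  have main: "\<bar>y c0 (P(i := P i + h)) - y c0 P - h * E c0 P\<bar> \<le> 2 * (1 + T' * (1 + M)) * \<epsilon> * \<bar>h\<bar>"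
    if h: "\<bar>h\<bar> < \<delta>" and \<epsilon>: "\<epsilon> > 0"
      and un: "\<And>c k s \<theta>. c \<in> C \<Longrightarrow> k \<in> ?ks \<Longrightarrow> \<bar>s\<bar> \<le> T' \<Longrightarrow> 0 \<le> \<theta> \<Longrightarrow> \<theta> \<le> 1 \<Longrightarrow>
        \<bar>pd k (G c) (w h s \<theta>) - pd k (G c) (w 0 s \<theta>)\<bar> \<le> \<epsilon>"
      and ini: "\<And>c. c \<in> C \<Longrightarrow> \<bar>y c (Q h 0) - y c (Q 0 0) - h * E c (Q 0 0)\<bar> \<le> \<epsilon> * \<bar>h\<bar>" for h \<epsilon>
  proof -
    let ?g = "\<lambda>h c s. G c (case_sum (Q h s) (\<lambda>d. y d (Q h s)))"
    let ?A = "\<lambda>c d s. pd (Inr d) (G c) (case_sum (P(\<tau> := s)) (\<lambda>d. y d (P(\<tau> := s))))"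
    let ?B = "\<lambda>c s. pd (Inl i) (G c) (case_sum (P(\<tau> := s)) (\<lambda>d. y d (P(\<tau> := s))))"
    let ?e = "\<lambda>c s. y c (Q h s) - y c (Q 0 s) - h * E c (Q 0 s)"
    let ?e' = "\<lambda>c s. ?g h c s - ?g 0 c s - h * ((\<Sum>d\<in>C. ?A c d s * E d (Q 0 s)) + ?B c s)"
    \<comment> \<open>\<open>?e\<close> is the error of the first-order approximation by
      \<open>h * E\<close>. Its data are \<open>\<epsilon> * \<bar>h\<bar>\<close> at time zero and
      \<open>\<bar>h\<bar> * (\<epsilon> * (1 + M))\<close> in the equation, so it is small compared
      with \<open>h\<close>.\<close>
    have "\<bar>?e c0 (P \<tau>)\<bar> \<le> 2 * (\<epsilon> * \<bar>h\<bar> + T' * (\<bar>h\<bar> * (\<epsilon> * (1 + M))))"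
    proof (rule ode_stability[OF finC T'0 K0 KT, where e="?e" and e'="?e'"])
      fix c s assume cs: "c \<in> C" "\<bar>s\<bar> \<le> T'"
      have dy: "((\<lambda>s. y c (Q h s)) has_real_derivative ?g h c s) (at s within {-T'..T'})" if "\<bar>h\<bar> < \<delta>" for h
        using pr(9)[OF QD[OF that cs(2)] cs(1)] unfolding Q_def by (simp add: has_field_derivative_at_within)
      have sT: "\<bar>s\<bar> < T1" using cs T' by linarith
      have dE: "((\<lambda>s. E c (Q 0 s)) has_real_derivative (\<Sum>d\<in>C. ?A c d s * E d (Q 0 s)) + ?B c s) (at s within {-T'..T'})"
        using E[OF cs(1) PD sT] unfolding Q0 by (rule has_field_derivative_at_within)
      have h0: "\<bar>0::real\<bar> < \<delta>" using \<delta>(1) by simp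
      show "(?e c has_real_derivative ?e' c s) (at s within {-T'..T'})"
        by (rule DERIV_diff[OF DERIV_diff[OF dy[OF h] dy[OF h0]] DERIV_cmult[OF dE]])
      let ?dw = "\<lambda>k. case k of Inl j \<Rightarrow> (if j = i then h else 0) | Inr d \<Rightarrow> y d (Q h s) - y d (Q 0 s)"
      have "\<exists>\<theta>. \<theta> > 0 \<and> \<theta> < 1 \<and> G c (w h s 1) - G c (w h s 0) = (1 - 0) * (\<Sum>k\<in>F <+> C. pd k (G c) (w h s \<theta>) * ?dw k)"
      proof (rule MVT2)
        fix \<theta> :: real assume \<theta>: "0 \<le> \<theta>" "\<theta> \<le> 1"
        show "((\<lambda>\<theta>. G c (w h s \<theta>)) has_real_derivative (\<Sum>k\<in>F <+> C. pd k (G c) (w h s \<theta>) * ?dw k)) (at \<theta>)"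
        proof (rule ck1_chain_within[where \<gamma>="w h s" and s=\<theta>, OF pr(6)[OF cs(1)] wW[OF h cs(2) \<theta>]])
          fix k
          show "((\<lambda>\<theta>. w h s \<theta> k) has_real_derivative ?dw k) (at \<theta>)"
          proof (cases k)
            case (Inl j)
            then show ?thesis
              unfolding w_def Q_def using i by (cases "j = \<tau>"; cases "j = i") (auto intro!: derivative_eq_intros)
          next
            case (Inr d)
            then show ?thesis unfolding w_def by (auto intro!: derivative_eq_intros)
          qed
        qed
      qed simp
      then obtain \<theta> where \<theta>: "0 < \<theta>" "\<theta> < 1" and
        mv: "G c (w h s 1) - G c (w h s 0) = (\<Sum>k\<in>F <+> C. pd k (G c) (w h s \<theta>) * ?dw k)" by auto
      have w1: "w h s 1 = case_sum (Q h s) (\<lambda>d. y d (Q h s))" "w h s 0 = case_sum (Q 0 s) (\<lambda>d. y d (Q 0 s))"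
        by (simp_all add: w_def)
      define a where "a d = pd (Inr d) (G c) (w h s \<theta>)" for d
      define b where "b = pd (Inl i) (G c) (w h s \<theta>)"
      have "(\<Sum>k\<in>F <+> C. pd k (G c) (w h s \<theta>) * ?dw k) =
          (\<Sum>j\<in>F. pd (Inl j) (G c) (w h s \<theta>) * (if j = i then h else 0)) + (\<Sum>d\<in>C. a d * (y d (Q h s) - y d (Q 0 s)))"
        by (simp add: sum.Plus[OF finF finC] a_def)
      also have "(\<Sum>j\<in>F. pd (Inl j) (G c) (w h s \<theta>) * (if j = i then h else 0)) = (\<Sum>j\<in>F. if j = i then b * h else 0)"
        by (rule sum.cong) (auto simp: b_def)
      also have "\<dots> = b * h" using finF i(1) by simp
      finally have gdiff: "?g h c s - ?g 0 c s = b * h + (\<Sum>d\<in>C. a d * (y d (Q h s) - y d (Q 0 s)))"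
        using mv w1 by simp
      have aK: "\<bar>a d\<bar> \<le> K" if "d \<in> C" for d
        unfolding a_def by (rule pd_space_bound[OF p _ cs(1) that]) (rule wW, use h cs \<theta> in auto)
      have ad: "\<bar>a d - ?A c d s\<bar> \<le> \<epsilon>" if "d \<in> C" for d
        using un[OF cs(1) _ cs(2), of "Inr d" \<theta>] that \<theta> unfolding w0 a_def by simp
      have bd: "\<bar>b - ?B c s\<bar> \<le> \<epsilon>"
        using un[OF cs(1) _ cs(2), of "Inl i" \<theta>] \<theta> unfolding w0 b_def by simp
      \<comment> \<open>The part linear in the error is controlled by \<open>K\<close> through
        \<open>aK\<close>; the rest is small because the mean-value coefficients are close to those
        of the linearization, and \<open>M\<close> bounds \<open>E\<close> along the
        solution.\<close>
      have split: "?e' c s = (\<Sum>d\<in>C. a d * ?e d s) + h * ((b - ?B c s) + (\<Sum>d\<in>C. (a d - ?A c d s) * E d (Q 0 s)))"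
        unfolding gdiff by (simp add: algebra_simps sum.distrib sum_subtractf sum_distrib_left)
      have "\<bar>\<Sum>d\<in>C. a d * ?e d s\<bar> \<le> (\<Sum>d\<in>C. K * \<bar>?e d s\<bar>)"
        by (rule order_trans[OF sum_abs sum_mono]) (use aK in \<open>simp add: abs_mult mult_right_mono\<close>)
      then have b1: "\<bar>\<Sum>d\<in>C. a d * ?e d s\<bar> \<le> K * (\<Sum>d\<in>C. \<bar>?e d s\<bar>)" by (simp add: sum_distrib_left)
      have "\<bar>\<Sum>d\<in>C. (a d - ?A c d s) * E d (Q 0 s)\<bar> \<le> (\<Sum>d\<in>C. \<epsilon> * \<bar>E d (Q 0 s)\<bar>)"
        by (rule order_trans[OF sum_abs sum_mono]) (use ad in \<open>simp add: abs_mult mult_right_mono\<close>)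
      also have "\<dots> \<le> \<epsilon> * M" using sumE[OF cs(2)] \<epsilon> by (simp add: sum_distrib_left[symmetric] Q0)
      finally have "\<bar>(b - ?B c s) + (\<Sum>d\<in>C. (a d - ?A c d s) * E d (Q 0 s))\<bar> \<le> \<epsilon> * (1 + M)"
        using bd by (simp add: distrib_left)
      then have b2: "\<bar>h * ((b - ?B c s) + (\<Sum>d\<in>C. (a d - ?A c d s) * E d (Q 0 s)))\<bar> \<le> \<bar>h\<bar> * (\<epsilon> * (1 + M))"
        unfolding abs_mult by (rule mult_left_mono) simp
      show "\<bar>?e' c s\<bar> \<le> K * (\<Sum>d\<in>C. \<bar>?e d s\<bar>) + \<bar>h\<bar> * (\<epsilon> * (1 + M))"
        unfolding split using b1 b2 by (rule order_trans[OF abs_triangle_ineq add_mono])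
    next
      show "\<bar>?e c 0\<bar> \<le> \<epsilon> * \<bar>h\<bar>" if "c \<in> C" for c using ini[OF that] .
      show "c0 \<in> C" by (rule c0)
      show "\<bar>P \<tau>\<bar> \<le> T'" using T' by simp
    qed
    moreover have "Q h (P \<tau>) = P(i := P i + h)" "Q 0 (P \<tau>) = P" using i by (auto simp: Q_def fun_eq_iff)
    ultimately have "\<bar>y c0 (P(i := P i + h)) - y c0 P - h * E c0 P\<bar> \<le> 2 * (\<epsilon> * \<bar>h\<bar> + T' * (\<bar>h\<bar> * (\<epsilon> * (1 + M))))"
      by simp
    also have "\<dots> = 2 * (1 + T' * (1 + M)) * \<epsilon> * \<bar>h\<bar>" by (simp add: algebra_simps)
    finally show ?thesis .
  qed
  have Q00: "Q 0 0 \<in> Dm T" by (rule QD) (use \<delta>(1) T'0 in auto)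
  have init_ev: "\<forall>\<^sub>F h in at 0. \<bar>y c (Q h 0) - y c (Q 0 0) - h * E c (Q 0 0)\<bar> \<le> \<epsilon> * \<bar>h\<bar>"
    if c: "c \<in> C" and \<epsilon>: "\<epsilon> > 0" for c \<epsilon>
  proof -
    have "((\<lambda>s. y c ((Q 0 0)(i := s, \<tau> := 0))) has_real_derivative pd i (\<lambda>P. y c (P(\<tau> := 0))) (Q 0 0)) (at (Q 0 0 i))"
      by (rule ck_Suc_DERIV[OF pr(10)[OF c] Q00])
    then have "\<forall>\<^sub>F h in at 0. \<bar>y c ((Q 0 0)(i := Q 0 0 i + h, \<tau> := 0)) - y c ((Q 0 0)(i := Q 0 0 i, \<tau> := 0))
        - h * pd i (\<lambda>P. y c (P(\<tau> := 0))) (Q 0 0)\<bar> \<le> \<epsilon> * \<bar>h\<bar>"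
      unfolding DERIV_iff_eventually_le using \<epsilon> by blast
    moreover have "(Q 0 0)(i := Q 0 0 i + h, \<tau> := 0) = Q h 0" "(Q 0 0)(i := Q 0 0 i, \<tau> := 0) = Q 0 0" for h
      using i by (auto simp: Q_def fun_eq_iff)
    moreover have "E c (Q 0 0) = pd i (\<lambda>P. y c (P(\<tau> := 0))) (Q 0 0)" using E0[OF c PD] by (simp add: Q0)
    ultimately show ?thesis by simp
  qed
  show ?thesis
    unfolding DERIV_iff_eventually_le
  proof (intro allI impI)
    fix e :: real assume e: "e > 0"
    define L where "L = 2 * (1 + T' * (1 + M))"
    have "T' * (1 + M) \<ge> 0" using T'0 M by simp
    then have L: "L > 0" by (simp add: L_def)
    define \<epsilon> where "\<epsilon> = e / L"
    have \<epsilon>: "\<epsilon> > 0" using e L by (simp add: \<epsilon>_def)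
    have "\<forall>\<^sub>F h in at 0. \<forall>c\<in>C. \<bar>y c (Q h 0) - y c (Q 0 0) - h * E c (Q 0 0)\<bar> \<le> \<epsilon> * \<bar>h\<bar>"
      using init_ev[OF _ \<epsilon>] finC by (simp add: eventually_ball_finite)
    moreover have "\<forall>\<^sub>F h in at 0. \<forall>c\<in>C. \<forall>k\<in>?ks. \<forall>s \<theta>. \<bar>s\<bar> \<le> T' \<longrightarrow> 0 \<le> \<theta> \<longrightarrow> \<theta> \<le> 1 \<longrightarrow>
      \<bar>pd k (G c) (w h s \<theta>) - pd k (G c) (w 0 s \<theta>)\<bar> \<le> \<epsilon>"
      by (rule filter_leD[OF _ unif[OF \<epsilon>]]) (simp add: at_within_def)
    moreover have "\<forall>\<^sub>F h::real in at 0. \<bar>h\<bar> < \<delta>"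
      using \<delta>(1) by (auto simp: eventually_at dist_real_def)
    ultimately show "\<forall>\<^sub>F h in at 0. \<bar>y c0 (P(i := P i + h)) - y c0 (P(i := P i)) - h * E c0 P\<bar> \<le> e * \<bar>h\<bar>"
    proof eventually_elim
      case (elim h)
      have "\<bar>y c0 (P(i := P i + h)) - y c0 P - h * E c0 P\<bar> \<le> 2 * (1 + T' * (1 + M)) * \<epsilon> * \<bar>h\<bar>"
        by (rule main[OF elim(3) \<epsilon>]) (use elim(1,2) in blast)+
      also have "2 * (1 + T' * (1 + M)) * \<epsilon> = e" using L unfolding L_def[symmetric] by (simp add: \<epsilon>_def)
      finally show ?case by (simp only: fun_upd_triv)
    qed
  qed
qed

text \<open>
  The partial derivatives of the solution solve the linearized equation, which is again an
  \<open>ode_problem\<close>, with one derivative less and all of space as set of values.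
\<close>

theorem ode_smooth_dependence:
  assumes "ode_problem n T Y G y" and "0 < T'" and "T' < T" and "c \<in> C"
  shows "ck n F (Dm T') (y c)"
  using assms
proof (induction n arbitrary: T T' Y G y c)
  case 0
  show ?case
    by (rule ck_subset[OF ode_sol_ck0[OF 0(1,4)] Dm_mono open_Dm depends_Dm]) (use 0 in simp)
next
  case (Suc n)
  note pr = ode_problemD[OF Suc.prems(1)]
  \<comment> \<open>Nested time bounds: the solution and the coefficients have order
    \<open>n\<close> below \<open>T2\<close>, the linearized solution lives below \<open>T1\<close>,
    and its regularity is obtained below \<open>T'\<close>.\<close>
  obtain T1 where T1: "T' < T1" "T1 < T" using dense[OF Suc.prems(3)] by blast
  obtain T2 where T2: "T1 < T2" "T2 < T" using dense[OF T1(2)] by blast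
  have pos: "0 < T1" "0 < T2" using Suc.prems(2) T1 T2 by linarith+
  have le: "T1 \<le> T" "T2 \<le> T" "T1 \<le> T2" "T' \<le> T2" "T' \<le> T1" using T1 T2 by linarith+
  have p2: "ode_problem (Suc n) T2 Y G y" by (rule ode_problem_lower[OF Suc.prems(1) pos(2) le(2)]) simp
  note pr2 = ode_problemD[OF p2]
  have y2: "ck n F (Dm T2) (y d)" if "d \<in> C" for d
    by (rule Suc.IH[OF ode_problem_lower[OF Suc.prems(1) _ order_refl] pos(2) T2(2) that]) (use pr(1) in simp_all)
  have sub: "ck n F (Dm T2) (\<lambda>P. f (case_sum P (\<lambda>d. y d P)))" if "ck n (F <+> C) (Wd T2 Y) f" for f
    by (rule ck_subst[OF that y2 pr2(8)])
  define A where "A c d P = pd (Inr d) (G c) (case_sum P (\<lambda>d. y d P))" for c d P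
  have A: "ck n F (Dm T2) (A c d)" if "c \<in> C" for c d
    unfolding A_def by (rule sub[OF ck_pd[OF pr2(6)[OF that]]])
  have AK: "\<bar>A c d P\<bar> \<le> K" if "c \<in> C" "d \<in> C" "P \<in> Dm T2" for c d P
    unfolding A_def by (rule pd_space_bound[OF p2 _ that(1,2)]) (use that(3) pr2(8) in \<open>simp add: case_sum_Wd\<close>)
  have partial: "\<exists>g. (\<forall>u\<in>Dm T'. ((\<lambda>s. y c (u(i := s))) has_real_derivative g u) (at (u i))) \<and> ck n F (Dm T') g" for i
  proof -
    consider "i \<notin> F" | "i = \<tau>" | "i \<in> F" "i \<noteq> \<tau>" by blast
    then show ?thesis
    proof cases
      case 1
      have y0: "ck 0 F (Dm T') (y c)"
        by (rule ck_0, rule ck_subset[OF y2[OF Suc.prems(4)] Dm_mono[OF le(4)] open_Dm depends_Dm])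
      have "((\<lambda>s. y c (u(i := s))) has_real_derivative 0) (at (u i))" if u: "u \<in> Dm T'" for u
      proof -
        have "y c (u(i := s)) = y c u" for s
          by (rule depends_onD(2)[OF ck_depends[OF y0] u]) (use 1 in auto)
        then show ?thesis by simp
      qed
      then show ?thesis
        by (intro exI[of _ "\<lambda>_. 0"] conjI ballI ck_const[OF finF open_Dm depends_Dm])
    next
      case 2
      have "ck n F (Dm T2) (\<lambda>P. G c (case_sum P (\<lambda>d. y d P)))"
        by (rule sub[OF ck_lower[OF pr2(6)[OF Suc.prems(4)]]])
      from ck_subset[OF this Dm_mono[OF le(4)] open_Dm depends_Dm]
      show ?thesis
      proof (intro exI conjI ballI)
        show "ck n F (Dm T') (\<lambda>P. G c (case_sum P (\<lambda>d. y d P)))" by fact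
        show "((\<lambda>s. y c (u(i := s))) has_real_derivative G c (case_sum u (\<lambda>d. y d u))) (at (u i))"
          if "u \<in> Dm T'" for u
          unfolding 2 by (rule pr2(9)[OF subsetD[OF Dm_mono[OF le(4)] that] Suc.prems(4)])
      qed
    next
      case 3
      define B where "B c P = pd (Inl i) (G c) (case_sum P (\<lambda>d. y d P))" for c P
      have B: "ck n F (Dm T2) (B c)" if "c \<in> C" for c
        unfolding B_def by (rule sub[OF ck_pd[OF pr2(6)[OF that]]])
      obtain E where E': "\<forall>c\<in>C. \<forall>P\<in>D0. E c (P(\<tau> := 0)) = pd i (\<lambda>P. y c (P(\<tau> := 0))) (P(\<tau> := 0)) \<and>
        (\<forall>s. \<bar>s\<bar> < T1 \<longrightarrow> ((\<lambda>s. E c (P(\<tau> := s))) has_real_derivative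
           (\<Sum>d\<in>C. A c d (P(\<tau> := s)) * E d (P(\<tau> := s))) + B c (P(\<tau> := s))) (at s))"
        using linear_ode_exists[where A=A and B=B and ?E0.0="\<lambda>c. pd i (\<lambda>P. y c (P(\<tau> := 0)))",
            OF pos(1) T2(1) pr2(2) ck_0[OF A] AK ck_0[OF B]] ..
      have E: "E c (P(\<tau> := 0)) = pd i (\<lambda>P. y c (P(\<tau> := 0))) (P(\<tau> := 0))"
        "\<And>s. \<bar>s\<bar> < T1 \<Longrightarrow> ((\<lambda>s. E c (P(\<tau> := s))) has_real_derivative
           (\<Sum>d\<in>C. A c d (P(\<tau> := s)) * E d (P(\<tau> := s))) + B c (P(\<tau> := s))) (at s)"
        if "c \<in> C" "P \<in> D0" for c P
        using E'[rule_format, OF that] by simp_all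
      have der: "((\<lambda>s. y c (u(i := s))) has_real_derivative E c u) (at (u i))" if "u \<in> Dm T1" for u
        by (rule ode_sol_diff[OF ode_problem_lower[OF p2 pos(2) order_refl] 3 le(3) E(1) E(2)[unfolded A_def B_def] Suc.prems(4) that])
          simp_all
      define G' where "G' c w = (\<Sum>d\<in>C. A c d (w \<circ> Inl) * w (Inr d)) + B c (w \<circ> Inl)" for c w
      have "ode_problem n T1 UNIV G' E"
        unfolding ode_problem_def
      proof (intro conjI ballI)
        show "0 < T1" by (rule pos(1))
        show "K * card C * T1 \<le> 1/2"
          using ode_problemD(2)[OF ode_problem_lower[OF p2 pos(1) le(3) order_refl]] .
        show "open (UNIV :: ('c \<Rightarrow> real) set)" by simp
        show dU: "depends_on C (UNIV :: ('c \<Rightarrow> real) set) (\<lambda>_. 0)" by (simp add: depends_on_def)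
        show "ck n (F <+> C) (Wd T1 UNIV) (G' c)" if c: "c \<in> C" for c
        proof -
          have fin: "finite (F <+> C)" using finF finC by simp
          note W = open_Wd[OF open_UNIV, of T1] depends_Wd[OF dU, of T1]
          have l: "ck n (F <+> C) (Wd T1 UNIV) (\<lambda>w. f (w \<circ> Inl))" if "ck n F (Dm T2) f" for f
            by (rule ck_lift[OF ck_subset[OF that Dm_mono[OF le(3)] open_Dm depends_Dm] open_UNIV dU])
          show ?thesis unfolding G'_def
            by (intro ck_add ck_sum[OF fin W] ck_mult l A B c ck_coord[OF fin W]) auto
        qed
        fix P assume P: "P \<in> Dm T1"
        have P2: "P \<in> Dm T2" using P Dm_mono[OF le(3)] by blast
        {
          fix c and v v' :: "'c \<Rightarrow> real" assume c: "c \<in> C"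
          have "G' c (case_sum P v) - G' c (case_sum P v') = (\<Sum>d\<in>C. A c d P * (v d - v' d))"
            by (simp add: G'_def case_sum_o_inj right_diff_distrib sum_subtractf)
          also have "\<bar>\<dots>\<bar> \<le> (\<Sum>d\<in>C. K * \<bar>v d - v' d\<bar>)"
            by (rule order_trans[OF sum_abs sum_mono]) (use AK[OF c _ P2] in \<open>simp add: abs_mult mult_right_mono\<close>)
          finally show "\<bar>G' c (case_sum P v) - G' c (case_sum P v')\<bar> \<le> K * (\<Sum>d\<in>C. \<bar>v d - v' d\<bar>)"
            by (simp add: sum_distrib_left)
        }
        {
          fix c assume c: "c \<in> C"
          have "\<bar>P \<tau>\<bar> < T1" using P by (simp add: Dm_def)
          from E(2)[OF c Dm_D0[OF P] this]
          show "((\<lambda>s. E c (P(\<tau> := s))) has_real_derivative G' c (case_sum P (\<lambda>d. E d P))) (at (P \<tau>))"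
            by (simp add: G'_def case_sum_o_inj)
        }
      next
        fix c assume c: "c \<in> C"
        have e: "ck n F (Dm T1) (pd i (\<lambda>P. y c (P(\<tau> := 0))))"
          by (rule ck_subset[OF ck_pd[OF pr2(10)[OF c]] Dm_mono[OF le(3)] open_Dm depends_Dm])
        \<comment> \<open>Resetting the time is a substitution, so the initial data of
          \<open>E\<close> inherit order \<open>n\<close> from the derivative of the initial data of
          \<open>y\<close>.\<close>
        have "ck n F (Dm T1) (\<lambda>P. pd i (\<lambda>P. y c (P(\<tau> := 0))) (\<lambda>j. if j = \<tau> then 0 else P j))"
        proof (rule ck_compose[OF e _ finF open_Dm depends_Dm])
          show "ck n F (Dm T1) (\<lambda>P. if j = \<tau> then 0 else P j)" if "j \<in> F" for j
            using that by (cases "j = \<tau>") (simp_all add: ck_const[OF finF open_Dm depends_Dm] ck_coord[OF finF open_Dm depends_Dm])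
          show "(\<lambda>j. if j = \<tau> then 0 else P j) \<in> Dm T1" if "P \<in> Dm T1" for P
            using Dm_upd[OF Dm_D0[OF that], of 0 T1] pos(1) by (simp add: fun_upd_def)
        qed
        then show "ck n F (Dm T1) (\<lambda>P. E c (P(\<tau> := 0)))"
          by (rule ck_cong) (use E(1)[OF c Dm_D0] in \<open>simp add: fun_upd_def\<close>)
      qed simp_all
      from Suc.IH[OF this Suc.prems(2) T1(1) Suc.prems(4)] have "ck n F (Dm T') (E c)" .
      moreover have "\<forall>u\<in>Dm T'. ((\<lambda>s. y c (u(i := s))) has_real_derivative E c u) (at (u i))"
        using der Dm_mono[OF le(5)] by blast
      ultimately show ?thesis by blast
    qed
  qed
  then obtain g where g: "\<And>i u. u \<in> Dm T' \<Longrightarrow> ((\<lambda>s. y c (u(i := s))) has_real_derivative g i u) (at (u i))"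
    "\<And>i. ck n F (Dm T') (g i)" by metis
  have "ck 0 F (Dm T') (y c)"
    by (rule ck_0, rule ck_subset[OF y2[OF Suc.prems(4)] Dm_mono[OF le(4)] open_Dm depends_Dm])
  then show ?case by (rule ck_SucI[OF _ g])
qed

end

section \<open>Local flows of smooth fields\<close>

declare ck.simps [simp del]

lemma cube_convex:
  assumes "v \<in> cube C u r" "v' \<in> cube C u r" "0 \<le> \<theta>" "\<theta> \<le> 1"
  shows "(\<lambda>d. v d + \<theta> * (v' d - v d)) \<in> cube C u r"
  unfolding cube_def
proof (intro CollectI ballI)
  fix d assume d: "d \<in> C"
  have "v d + \<theta> * (v' d - v d) - u d = (1 - \<theta>) * (v d - u d) + \<theta> * (v' d - u d)"
    by (simp add: algebra_simps)
  then have "\<bar>v d + \<theta> * (v' d - v d) - u d\<bar> \<le> \<bar>(1 - \<theta>) * (v d - u d)\<bar> + \<bar>\<theta> * (v' d - u d)\<bar>"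
    by (metis abs_triangle_ineq)
  also have "\<dots> = (1 - \<theta>) * \<bar>v d - u d\<bar> + \<theta> * \<bar>v' d - u d\<bar>"
    using assms(3,4) by (simp add: abs_mult)
  also have "\<dots> < r"
    by (rule convex_bound_lt) (use assms d in \<open>auto simp: cube_def\<close>)
  finally show "\<bar>v d + \<theta> * (v' d - v d) - u d\<bar> < r" .
qed

lemma Lipschitz_on_cube:
  assumes f: "ck (Suc 0) C U f" and sub: "cube C u r \<subseteq> U"
    and K: "\<And>d v. d \<in> C \<Longrightarrow> v \<in> cube C u r \<Longrightarrow> \<bar>pd d f v\<bar> \<le> K"
    and v: "v \<in> cube C u r" "v' \<in> cube C u r"
  shows "\<bar>f v - f v'\<bar> \<le> K * (\<Sum>d\<in>C. \<bar>v d - v' d\<bar>)"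
proof -
  define w where "w \<theta> = (\<lambda>d. v' d + \<theta> * (v d - v' d))" for \<theta>
  have wb: "w \<theta> \<in> cube C u r" if "0 \<le> \<theta>" "\<theta> \<le> 1" for \<theta>
    unfolding w_def by (rule cube_convex[OF v(2,1) that])
  have "\<exists>\<theta>. \<theta> > 0 \<and> \<theta> < 1 \<and> f (w 1) - f (w 0) = (1 - 0) * (\<Sum>d\<in>C. pd d f (w \<theta>) * (v d - v' d))"
  proof (rule MVT2)
    fix \<theta> :: real assume \<theta>: "0 \<le> \<theta>" "\<theta> \<le> 1"
    show "((\<lambda>\<theta>. f (w \<theta>)) has_real_derivative (\<Sum>d\<in>C. pd d f (w \<theta>) * (v d - v' d))) (at \<theta>)"
    proof (rule ck1_chain_within[where \<gamma>=w and s=\<theta>, OF f])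
      show "w \<theta> \<in> U" using wb[OF \<theta>] sub by blast
      show "((\<lambda>\<theta>. w \<theta> d) has_real_derivative v d - v' d) (at \<theta>)" for d
        unfolding w_def by (auto intro!: derivative_eq_intros)
    qed
  qed simp
  then obtain \<theta> where \<theta>: "0 < \<theta>" "\<theta> < 1" "f (w 1) - f (w 0) = (\<Sum>d\<in>C. pd d f (w \<theta>) * (v d - v' d))"
    by auto
  have "\<bar>\<Sum>d\<in>C. pd d f (w \<theta>) * (v d - v' d)\<bar> \<le> (\<Sum>d\<in>C. K * \<bar>v d - v' d\<bar>)"
    by (rule order_trans[OF sum_abs sum_mono])
      (use K wb[of \<theta>] \<theta>(1,2) in \<open>simp add: abs_mult mult_right_mono\<close>)
  moreover have "w 1 = v" "w 0 = v'" by (simp_all add: w_def)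
  ultimately show ?thesis using \<theta>(3) by (simp add: sum_distrib_left)
qed

definition flow_joint_dom :: "'i set \<Rightarrow> ('i \<Rightarrow> real) \<Rightarrow> real \<Rightarrow> real \<Rightarrow> ('i option \<Rightarrow> real) set" where
  "flow_joint_dom C u r T = {w. w \<circ> Some \<in> cube C u r \<and> \<bar>w None\<bar> < T}"

lemma open_flow_dom0: "finite C \<Longrightarrow> open {w::'i option \<Rightarrow> real. w \<circ> Some \<in> cube C u r}"
proof -
  assume C: "finite C"
  have "continuous_on UNIV (\<lambda>w::'i option \<Rightarrow> real. w \<circ> Some)"
    by (rule continuous_on_coordinatewise_then_product) (simp add: o_def)
  from open_vimage[OF open_cube[OF C] this] show ?thesis by (simp add: vimage_def)
qed

text \<open>Two radii are kept apart: orbits that start in the cube of radius \<open>r\<close>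
  remain in the cube of radius \<open>R\<close>. The group law is uniqueness of solutions, in the
  form of \<open>ode_stability\<close> with zero data.\<close>

lemma local_flow_exists:
  fixes V :: "'i \<Rightarrow> ('i \<Rightarrow> real) \<Rightarrow> real"
  assumes finC: "finite C" and V: "\<And>c n. c \<in> C \<Longrightarrow> ck n C U (V c)" and u: "u \<in> U"
    and U: "open U" "depends_on C U (\<lambda>_. 0)"
  shows "\<exists>R r T \<phi>. 0 < r \<and> r \<le> R \<and> 0 < T \<and> cube C u R \<subseteq> U \<and>
    (\<forall>n. \<forall>c\<in>C. ck n (insert None (Some ` C)) (flow_joint_dom C u r T) (\<lambda>w. \<phi> (w None) (w \<circ> Some) c)) \<and>
    (\<forall>P\<in>cube C u r. \<forall>c\<in>C. \<phi> 0 P c = P c) \<and>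
    (\<forall>P\<in>cube C u r. \<forall>t. \<bar>t\<bar> < T \<longrightarrow> \<phi> t P \<in> cube C u R \<and>
       (\<forall>c\<in>C. ((\<lambda>t. \<phi> t P c) has_real_derivative V c (\<phi> t P)) (at t))) \<and>
    (\<forall>P\<in>cube C u r. \<forall>s t. \<bar>s\<bar> < T \<longrightarrow> \<bar>t\<bar> < T \<longrightarrow> \<phi> s P \<in> cube C u r \<longrightarrow>
       (\<forall>c\<in>C. \<phi> t (\<phi> s P) c = \<phi> (t + s) P c))"
proof -
  obtain Ra where Ra: "Ra > 0" "cube C u Ra \<subseteq> U"
    "\<And>c v. c \<in> C \<Longrightarrow> v \<in> cube C u Ra \<Longrightarrow> \<bar>V c v - V c u\<bar> < 1"
    using ck0_cube[where f=V, OF V finC finC U u zero_less_one] by metis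
  have pV: "ck 0 C U (case x of (c, d) \<Rightarrow> pd d (V c))" if "x \<in> C \<times> C" for x
    using that ck_pd[OF V] by (cases x) simp
  have finCC: "finite (C \<times> C)" using finC by simp
  obtain Rb where Rb: "Rb > 0" "cube C u Rb \<subseteq> U"
    "\<And>x v. x \<in> C \<times> C \<Longrightarrow> v \<in> cube C u Rb \<Longrightarrow>
      \<bar>(case x of (c, d) \<Rightarrow> pd d (V c)) v - (case x of (c, d) \<Rightarrow> pd d (V c)) u\<bar> < 1"
    using ck0_cube[where f="\<lambda>x. case x of (c, d) \<Rightarrow> pd d (V c)", OF pV finCC finC U u zero_less_one] by metis
  define R0 where "R0 = min Ra Rb"
  define R where "R = R0 / 2"
  define r where "r = R / 2"
  have pos: "0 < R0" "0 < R" "0 < r" "r \<le> R" "R < R0" using Ra(1) Rb(1) by (auto simp: R0_def R_def r_def)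
  define M where "M = 1 + (\<Sum>c\<in>C. \<bar>V c u\<bar>)"
  define K where "K = 1 + (\<Sum>x\<in>C \<times> C. \<bar>(case x of (c, d) \<Rightarrow> pd d (V c)) u\<bar>)"
  have M0: "M > 0" and K0: "K > 0" unfolding M_def K_def by (simp_all add: add_pos_nonneg sum_nonneg)
  have sub: "cube C u R0 \<subseteq> U" using Ra(2) cube_subset[of R0 Ra C u] by (auto simp: R0_def)
  have cubeR: "cube C u R \<subseteq> cube C u R0" "cube C u r \<subseteq> cube C u R" using pos by (simp_all add: cube_subset)
  have VM: "\<bar>V c v\<bar> \<le> M" if "c \<in> C" "v \<in> cube C u R0" for c v
  proof -
    have "v \<in> cube C u Ra" using that(2) cube_subset[of R0 Ra C u] by (auto simp: R0_def)
    from Ra(3)[OF that(1) this] have "\<bar>V c v\<bar> \<le> 1 + \<bar>V c u\<bar>" by linarith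
    also have "\<bar>V c u\<bar> \<le> (\<Sum>c\<in>C. \<bar>V c u\<bar>)" by (rule member_le_sum[OF that(1) _ finC]) simp
    finally show ?thesis by (simp add: M_def)
  qed
  have VK: "\<bar>pd d (V c) v\<bar> \<le> K" if "c \<in> C" "d \<in> C" "v \<in> cube C u R0" for c d v
  proof -
    have "v \<in> cube C u Rb" using that(3) cube_subset[of R0 Rb C u] by (auto simp: R0_def)
    from Rb(3)[OF _ this, of "(c, d)"] that have "\<bar>pd d (V c) v\<bar> \<le> 1 + \<bar>pd d (V c) u\<bar>" by simp
    also have "\<bar>pd d (V c) u\<bar> \<le> (\<Sum>x\<in>C \<times> C. \<bar>(case x of (c, d) \<Rightarrow> pd d (V c)) u\<bar>)"
      using member_le_sum[of "(c, d)" "C \<times> C" "\<lambda>x. \<bar>(case x of (c, d) \<Rightarrow> pd d (V c)) u\<bar>"] that finC by simp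
    finally show ?thesis by (simp add: K_def)
  qed
  have VL: "\<bar>V c v - V c v'\<bar> \<le> K * (\<Sum>d\<in>C. \<bar>v d - v' d\<bar>)" if "c \<in> C" "v \<in> cube C u R0" "v' \<in> cube C u R0" for c v v'
    by (rule Lipschitz_on_cube[OF V[OF that(1)] sub VK[OF that(1)] that(2,3)])
  \<comment> \<open>The first bound meets the smallness condition of \<open>picard\<close>. Within
    time \<open>r / M\<close>, at speed at most \<open>M\<close>, an orbit moves by at most
    \<open>r\<close>, which is half of \<open>R\<close>, and so stays within
    \<open>R\<close>.\<close>
  define T1 where "T1 = min (1 / (2 * K * (card C + 1))) (r / M)"
  have T1: "T1 > 0" "M * T1 \<le> r" "K * card C * T1 \<le> 1/2"
  proof -
    have p: "2 * K * (card C + 1) > 0" using K0 by simp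
    show "T1 > 0" using p M0 pos by (simp add: T1_def)
    have "T1 \<le> r / M" by (simp add: T1_def)
    then show "M * T1 \<le> r" using M0 by (simp add: field_simps)
    have "T1 \<le> 1 / (2 * K * (card C + 1))" by (simp add: T1_def)
    then have "T1 * (2 * K * (card C + 1)) \<le> 1" using p by (simp add: pos_le_divide_eq)
    moreover have "K * card C * T1 \<le> K * (card C + 1) * T1" using K0 \<open>T1 > 0\<close> by simp
    ultimately show "K * card C * T1 \<le> 1/2" by (simp add: algebra_simps)
  qed
  \<comment> \<open>Clamping makes the field globally Lipschitz; the solutions stay where it has no effect.\<close>
  define cl where "cl v = (\<lambda>d. max (u d - R) (min (u d + R) (v d)))" for v
  have clb: "cl v \<in> cube C u R0" for v
    using pos by (auto simp: cube_def cl_def max_def min_def)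
  have clid: "cl v d = v d" if "v \<in> cube C u R" "d \<in> C" for v d
    using that by (force simp: cube_def cl_def max_def min_def)
  have cll: "\<bar>cl v d - cl v' d\<bar> \<le> \<bar>v d - v' d\<bar>" for v v' d
    by (auto simp: cl_def max_def min_def)
  have ex: "\<exists>z. \<forall>c\<in>C. z c 0 = P c \<and>
     (\<forall>t\<in>{-T1..T1}. (z c has_real_derivative V c (cl (\<lambda>d. z d t))) (at t within {-T1..T1}))" for P
  proof (rule picard[OF finC T1(1) less_imp_le[OF K0] T1(3), where g="\<lambda>c t v. V c (cl v)"])
    fix c and v :: "'i \<Rightarrow> real \<Rightarrow> real"
    assume c: "c \<in> C" and v: "\<And>d. d \<in> C \<Longrightarrow> continuous_on {-T1..T1} (v d)"
    show "continuous_on {-T1..T1} (\<lambda>t. V c (cl (\<lambda>d. v d t)))"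
    proof (rule ck0_continuous_compose[OF V[OF c]])
      show "cl (\<lambda>d. v d t) \<in> U" for t using clb sub by blast
      show "continuous_on {-T1..T1} (\<lambda>t. cl (\<lambda>d. v d t) d)" if "d \<in> C" for d
        unfolding cl_def by (intro continuous_on_max continuous_on_min continuous_on_const v that)
    qed
  next
    fix c and t :: real and v v' :: "'i \<Rightarrow> real" assume c: "c \<in> C"
    have "\<bar>V c (cl v) - V c (cl v')\<bar> \<le> K * (\<Sum>d\<in>C. \<bar>cl v d - cl v' d\<bar>)" by (rule VL[OF c clb clb])
    also have "\<dots> \<le> K * (\<Sum>d\<in>C. \<bar>v d - v' d\<bar>)"
      by (intro mult_left_mono sum_mono cll) (use K0 in simp)
    finally show "\<bar>V c (cl v) - V c (cl v')\<bar> \<le> K * (\<Sum>d\<in>C. \<bar>v d - v' d\<bar>)" .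
  qed
  then have "\<forall>P. \<exists>z. \<forall>c\<in>C. z c 0 = P c \<and>
     (\<forall>t\<in>{-T1..T1}. (z c has_real_derivative V c (cl (\<lambda>d. z d t))) (at t within {-T1..T1}))" by blast
  from choice[OF this] obtain Z where Z': "\<forall>P. \<forall>c\<in>C. Z P c 0 = P c \<and>
     (\<forall>t\<in>{-T1..T1}. (Z P c has_real_derivative V c (cl (\<lambda>d. Z P d t))) (at t within {-T1..T1}))" ..
  have Z0: "Z P c 0 = P c" if "c \<in> C" for P c using Z' that by blast
  have Zd: "(Z P c has_real_derivative V c (cl (\<lambda>d. Z P d t))) (at t within {-T1..T1})"
    if "c \<in> C" "\<bar>t\<bar> \<le> T1" for P c t
    using Z'[rule_format, OF that(1)] that(2) by (simp add: abs_le_iff)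
  \<comment> \<open>\<open>Z\<close> was chosen for full points; \<open>res\<close> first discards
    the coordinates outside \<open>C\<close>.\<close>
  define res where "res P = (\<lambda>c. if c \<in> C then P c else 0)" for P :: "'i \<Rightarrow> real"
  define \<phi> where "\<phi> t P = (\<lambda>c. Z (res P) c t)" for t P
  have resb: "res P \<in> cube C u r" if "P \<in> cube C u r" for P using that by (simp add: res_def cube_def)
  have phi0: "\<phi> 0 P c = P c" if "c \<in> C" for P c using Z0[OF that] that by (simp add: \<phi>_def res_def)
  have phib: "\<phi> t P \<in> cube C u R" if P: "P \<in> cube C u r" and t: "\<bar>t\<bar> \<le> T1" for P t
    unfolding cube_def
  proof (intro CollectI ballI)
    fix c assume c: "c \<in> C"
    have "norm (Z (res P) c t - Z (res P) c 0) \<le> M * norm (t - 0)"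
      by (rule field_differentiable_bound[where S="{-T1..T1}" and f'="\<lambda>t. V c (cl (\<lambda>d. Z (res P) d t))"])
        (use Zd[OF c] VM[OF c clb] t T1(1) in \<open>auto simp: abs_le_iff\<close>)
    also have "\<dots> \<le> M * T1" using t M0 by simp
    finally have "\<bar>\<phi> t P c - P c\<bar> \<le> r" using T1(2) phi0[OF c, of P] by (simp add: \<phi>_def)
    moreover have "\<bar>P c - u c\<bar> < r" using P c by (simp add: cube_def)
    ultimately show "\<bar>\<phi> t P c - u c\<bar> < R" unfolding r_def by linarith
  qed
  have clV: "V c (cl (\<phi> t P)) = V c (\<phi> t P)" if "c \<in> C" "P \<in> cube C u r" "\<bar>t\<bar> \<le> T1" for c P t
    by (rule depends_onD(2)[OF ck_depends[OF V[OF that(1)]]])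
      (use phib[OF that(2,3)] clid cubeR sub in auto)
  have phid_within: "((\<lambda>t. \<phi> t P c) has_real_derivative V c (\<phi> t P)) (at t within {-T1..T1})"
    if "c \<in> C" "P \<in> cube C u r" "\<bar>t\<bar> \<le> T1" for P c t
    using Zd[OF that(1,3), of "res P"] clV[OF that] by (simp add: \<phi>_def)
  have phid: "((\<lambda>t. \<phi> t P c) has_real_derivative V c (\<phi> t P)) (at t)"
    if "c \<in> C" "P \<in> cube C u r" "\<bar>t\<bar> < T1" for P c t
  proof -
    have "at t within {-T1..T1} = at t" by (rule at_within_interior) (use that in auto)
    then show ?thesis using phid_within[OF that(1,2), of t] that(3) by simp
  qed
  define D0 where "D0 = {w::'i option \<Rightarrow> real. w \<circ> Some \<in> cube C u r}"
  \<comment> \<open>Time becomes the coordinate \<open>None\<close> and the initial point the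
    parameter, so \<open>ode_smooth_dependence\<close> yields smoothness in both jointly.\<close>
  interpret ode_param "insert None (Some ` C)" None D0 C K
  proof
    show "open D0" unfolding D0_def by (rule open_flow_dom0[OF finC])
    show "depends_on (insert None (Some ` C)) D0 (\<lambda>_. 0)"
      by (rule depends_on_zeroI) (auto simp: D0_def cube_def)
    show "P(None := s) \<in> D0" if "P \<in> D0" for P s
    proof -
      have "P(None := s) \<circ> Some = P \<circ> Some" by auto
      then show ?thesis using that by (simp add: D0_def)
    qed
  qed (use finC K0 in auto)
  have Dm: "Dm T = flow_joint_dom C u r T" for T
    unfolding Dm_def unfolding D0_def flow_joint_dom_def by simp
  let ?y = "\<lambda>c w. \<phi> (w None) (w \<circ> Some) c"
  have upd: "(P(None := s)) \<circ> Some = P \<circ> Some" for P :: "'i option \<Rightarrow> real" and s by auto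
  have prob: "ode_problem n T1 (cube C u R) (\<lambda>c w. V c (w \<circ> Inr)) ?y" for n
    unfolding ode_problem_def
  proof (intro conjI ballI)
    show "0 < T1" "K * card C * T1 \<le> 1/2" by (rule T1)+
    show oB: "open (cube C u R)" by (rule open_cube[OF finC])
    show dB: "depends_on C (cube C u R) (\<lambda>_. 0)" by (rule depends_cube) simp
    show "(\<lambda>d. v d + \<theta> * (v' d - v d)) \<in> cube C u R"
      if "v \<in> cube C u R" "v' \<in> cube C u R" "\<theta> \<in> {0..1}" for v v' \<theta>
      by (rule cube_convex) (use that in auto)
    show "ck n (insert None (Some ` C) <+> C) (Wd T1 (cube C u R)) (\<lambda>w. V c (w \<circ> Inr))" if c: "c \<in> C" for c
      unfolding comp_def
    proof (rule ck_compose[OF V[OF c] _ _ open_Wd[OF oB] depends_Wd[OF dB]])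
      show fin: "finite (insert None (Some ` C) <+> C)" using finC by simp
      show "ck n (insert None (Some ` C) <+> C) (Wd T1 (cube C u R)) (\<lambda>w. w (Inr d))" if "d \<in> C" for d
        by (rule ck_coord[OF fin open_Wd[OF oB] depends_Wd[OF dB]]) (use that in auto)
      show "(\<lambda>d. w (Inr d)) \<in> U" if "w \<in> Wd T1 (cube C u R)" for w
        using that cubeR sub by (auto simp: Wd_def comp_def)
    qed
    show "ck n (insert None (Some ` C)) (Dm T1) (\<lambda>P. ?y c (P(None := 0)))" if c: "c \<in> C" for c
      using ck_coord[OF finF open_Dm depends_Dm, of "Some c"] c by (simp add: phi0[OF c])
    fix P assume P: "P \<in> Dm T1"
    have P': "P \<circ> Some \<in> cube C u r" "\<bar>P None\<bar> < T1" using P by (simp_all add: Dm flow_joint_dom_def)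
    show "(\<lambda>d. ?y d P) \<in> cube C u R" using phib[OF P'(1), of "P None"] P'(2) by simp
    show "((\<lambda>s. ?y c (P(None := s))) has_real_derivative V c (case_sum P (\<lambda>d. ?y d P) \<circ> Inr)) (at (P None))"
      if "c \<in> C" for c
      using phid[OF that P'] by (simp add: upd case_sum_o_inj)
    show "\<bar>V c (case_sum P v \<circ> Inr) - V c (case_sum P v' \<circ> Inr)\<bar> \<le> K * (\<Sum>d\<in>C. \<bar>v d - v' d\<bar>)"
      if "c \<in> C" "v \<in> cube C u R" "v' \<in> cube C u R" for c v v'
      using VL[OF that(1)] that(2,3) cubeR(1) by (auto simp: case_sum_o_inj)
  qed
  \<comment> \<open>Half of \<open>T1\<close>, so that \<open>t + s\<close> stays in the range where
    the orbits are controlled.\<close>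
  define T where "T = T1 / 2"
  have T: "T > 0" "T < T1" "T + T = T1" using T1(1) by (auto simp: T_def)
  show ?thesis
  proof (rule exI[of _ R], rule exI[of _ r], rule exI[of _ T], rule exI[of _ \<phi>], intro conjI allI ballI impI)
    show "cube C u R \<subseteq> U" using cubeR sub by blast
    show "ck n (insert None (Some ` C)) (flow_joint_dom C u r T) (\<lambda>w. \<phi> (w None) (w \<circ> Some) c)" if "c \<in> C" for n c
      using ode_smooth_dependence[OF prob T(1,2) that] by (simp add: Dm)
    show "\<phi> t P \<in> cube C u R" if "P \<in> cube C u r" "\<bar>t\<bar> < T" for P t using phib that T by simp
    show "((\<lambda>t. \<phi> t P c) has_real_derivative V c (\<phi> t P)) (at t)" if "P \<in> cube C u r" "\<bar>t\<bar> < T" "c \<in> C" for P t c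
      using phid that T by simp
    fix P s t c
    assume P: "P \<in> cube C u r" and s: "\<bar>s\<bar> < T" and t: "\<bar>t\<bar> < T" and Q: "\<phi> s P \<in> cube C u r" and c: "c \<in> C"
    have "K * card C * T \<le> K * card C * T1" by (rule mult_left_mono) (use K0 T in simp_all)
    then have KT: "K * card C * T \<le> 1/2" using T1(3) by linarith
    have "\<bar>\<phi> t (\<phi> s P) c - \<phi> (t + s) P c\<bar> \<le> 2 * (0 + T * 0)"
    proof (rule ode_stability[OF finC T(1) K0 KT,
        where e="\<lambda>c t. \<phi> t (\<phi> s P) c - \<phi> (t + s) P c" and e'="\<lambda>c t. V c (\<phi> t (\<phi> s P)) - V c (\<phi> (t + s) P)"])
      fix c x assume cx: "c \<in> C" "\<bar>x\<bar> \<le> T"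
      have x1: "\<bar>x\<bar> < T1" "\<bar>x + s\<bar> < T1" using cx(2) s T by linarith+
      have "((\<lambda>t. \<phi> (t + s) P c) has_real_derivative V c (\<phi> (x + s) P)) (at x)"
        using phid[OF cx(1) P x1(2)] by (simp add: DERIV_shift)
      then have "((\<lambda>t. \<phi> t (\<phi> s P) c - \<phi> (t + s) P c) has_real_derivative V c (\<phi> x (\<phi> s P)) - V c (\<phi> (x + s) P)) (at x)"
        by (rule DERIV_diff[OF phid[OF cx(1) Q x1(1)]])
      then show "((\<lambda>t. \<phi> t (\<phi> s P) c - \<phi> (t + s) P c) has_real_derivative V c (\<phi> x (\<phi> s P)) - V c (\<phi> (x + s) P)) (at x within {-T..T})"
        by (rule has_field_derivative_at_within)
      show "\<bar>V c (\<phi> x (\<phi> s P)) - V c (\<phi> (x + s) P)\<bar> \<le> K * (\<Sum>d\<in>C. \<bar>\<phi> x (\<phi> s P) d - \<phi> (x + s) P d\<bar>) + 0"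
        using VL[OF cx(1), of "\<phi> x (\<phi> s P)" "\<phi> (x + s) P"] phib[OF Q, of x] phib[OF P, of "x + s"] x1 cubeR(1) by auto
    qed (use phi0 c t in auto)
    then show "\<phi> t (\<phi> s P) c = \<phi> (t + s) P c" by simp
  qed (use pos T phi0 in simp_all)
qed

section \<open>Prolongation of flows to infinite jets\<close>

lemma total_deriv_cong:
  assumes "open U" "u \<in> U" "\<And>v. v \<in> U \<Longrightarrow> f v = g v"
  shows "total_deriv f u = total_deriv g u"
  unfolding total_deriv_def using pd_cong[OF assms] by simp

text \<open>The coefficient of the total derivative along \<open>c\<close>, that is, the total
  derivative of the coordinate function \<open>c\<close>.\<close>

definition shift :: "coord \<Rightarrow> jet \<Rightarrow> real" where
  "shift c u = (case c of Cx \<Rightarrow> 1 | Cy L \<alpha> \<Rightarrow> u (Cy L (Suc \<alpha>)))"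

lemma shift_simps [simp]: "shift Cx u = 1" "shift (Cy L \<alpha>) u = u (Cy L (Suc \<alpha>))"
  by (simp_all add: shift_def)

text \<open>Directions outside \<open>F\<close> contribute zero, so the sum over the support extends
  to any finite \<open>F\<close> that determines \<open>f\<close>. Unlike the support, this index
  set does not vary with the point or with time, which is what differentiation of the sum
  requires.\<close>

lemma total_deriv_sum:
  assumes F: "finite F" and dep: "depends_on F U f" and u: "u \<in> U"
  shows "total_deriv f u = (\<Sum>c\<in>F. pd c f u * shift c u)"
proof -
  have z: "pd c f u = 0" if "c \<notin> F" for c by (rule pd_outside[OF dep u that])
  define A where "A = {(L, \<alpha>). pd (Cy L \<alpha>) f u \<noteq> 0}"
  have inj: "inj_on (\<lambda>(L, \<alpha>). Cy L \<alpha>) A" by (auto simp: inj_on_def)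
  have sub: "(\<lambda>(L, \<alpha>). Cy L \<alpha>) ` A \<subseteq> F" using z by (auto simp: A_def)
  have "(\<Sum>c\<in>F. pd c f u * shift c u) = (\<Sum>c\<in>insert Cx F. pd c f u * shift c u)"
    using F z[of Cx] by (cases "Cx \<in> F") (simp_all add: insert_absorb)
  also have "\<dots> = (\<Sum>c\<in>insert Cx ((\<lambda>(L, \<alpha>). Cy L \<alpha>) ` A). pd c f u * shift c u)"
  proof (rule sum.mono_neutral_right)
    show "\<forall>c\<in>insert Cx F - insert Cx ((\<lambda>(L, \<alpha>). Cy L \<alpha>) ` A). pd c f u * shift c u = 0"
    proof
      fix c assume c: "c \<in> insert Cx F - insert Cx ((\<lambda>(L, \<alpha>). Cy L \<alpha>) ` A)"
      show "pd c f u * shift c u = 0"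
      proof (cases c)
        case Cx then show ?thesis using c by simp
      next
        case (Cy L \<alpha>)
        then have "(L, \<alpha>) \<notin> A" using c by (auto simp: image_iff)
        then show ?thesis using Cy by (simp add: A_def)
      qed
    qed
  qed (use F sub in auto)
  also have "\<dots> = pd Cx f u * 1 + (\<Sum>c\<in>(\<lambda>(L, \<alpha>). Cy L \<alpha>) ` A. pd c f u * shift c u)"
    using finite_subset[OF sub F] by (subst sum.insert) auto
  also have "(\<Sum>c\<in>(\<lambda>(L, \<alpha>). Cy L \<alpha>) ` A. pd c f u * shift c u) =
      (\<Sum>(L, \<alpha>)\<in>A. u (Cy L (Suc \<alpha>)) * pd (Cy L \<alpha>) f u)"
    by (subst sum.reindex[OF inj]) (simp add: case_prod_unfold mult.commute)
  finally show ?thesis by (simp add: total_deriv_def A_def)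
qed

lemma total_deriv_coord: "total_deriv (\<lambda>u. u c) u = shift c u"
proof -
  have "depends_on {c} UNIV (\<lambda>u::jet. u c)" by (simp add: depends_on_def)
  from total_deriv_sum[OF _ this, of u] show ?thesis by (simp add: pd_coord)
qed

lemma open_depends_vimage:
  assumes V: "open V" "depends_on G V (\<lambda>_. 0)" and U: "open U" "depends_on F U (\<lambda>_. 0)"
    and g: "\<And>c. c \<in> G \<Longrightarrow> continuous_on U (g c)" "\<And>c. c \<in> G \<Longrightarrow> depends_on F U (g c)"
  shows "open {u\<in>U. (\<lambda>c. g c u) \<in> V}" "depends_on F {u\<in>U. (\<lambda>c. g c u) \<in> V} (\<lambda>_. 0)"
proof -
  define g' where "g' u = (\<lambda>c. if c \<in> G then g c u else 0)" for u
  have eq: "(\<lambda>c. g c u) \<in> V \<longleftrightarrow> g' u \<in> V" for u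
    using depends_onD(1)[OF V(2), of "\<lambda>c. g c u" "g' u"] depends_onD(1)[OF V(2), of "g' u" "\<lambda>c. g c u"]
    by (auto simp: g'_def)
  have "continuous_on U g'"
  proof (rule continuous_on_coordinatewise_then_product)
    show "continuous_on U (\<lambda>u. g' u i)" for i
      by (cases "i \<in> G") (use g(1)[of i] in \<open>simp_all add: g'_def\<close>)
  qed
  from open_Collect_in[OF U(1) this V(1)] show "open {u\<in>U. (\<lambda>c. g c u) \<in> V}" by (simp add: eq)
  show "depends_on F {u\<in>U. (\<lambda>c. g c u) \<in> V} (\<lambda>_. 0)"
  proof (rule depends_on_zeroI)
    fix u v assume u: "u \<in> {u\<in>U. (\<lambda>c. g c u) \<in> V}" and e: "\<And>i. i \<in> F \<Longrightarrow> u i = v i"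
    then have uU: "u \<in> U" by simp
    have "g c u = g c v" if "c \<in> G" for c using depends_onD(2)[OF g(2)[OF that] uU e] by simp
    then have "(\<lambda>c. g c v) \<in> V" using depends_onD(1)[OF V(2), of "\<lambda>c. g c u" "\<lambda>c. g c v"] u by simp
    then show "v \<in> {u\<in>U. (\<lambda>c. g c u) \<in> V}" using depends_onD(1)[OF U(2) uU e] by simp
  qed
qed

lemma total_deriv_compose:
  assumes f: "ck (Suc 0) G V f" and F: "finite F" and g: "\<And>c. c \<in> G \<Longrightarrow> ck (Suc 0) F U (g c)"
    and U: "open U" "depends_on F U (\<lambda>_. 0)" and u: "u \<in> U" "(\<lambda>c. g c u) \<in> V"
  shows "total_deriv (\<lambda>v. f (\<lambda>c. g c v)) u = (\<Sum>c\<in>G. pd c f (\<lambda>c. g c u) * total_deriv (g c) u)"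
proof -
  let ?N = "{u\<in>U. (\<lambda>c. g c u) \<in> V}"
  have V0: "open V" "depends_on G V (\<lambda>_. 0)"
    using ckD[OF f] depends_on_comp1[of G V f "\<lambda>_. 0"] by simp_all
  note N = open_depends_vimage[OF V0 U ck_continuous[OF g] ck_depends[OF g]]
  have g': "ck (Suc 0) F ?N (g c)" if "c \<in> G" for c
    by (rule ck_subset[OF g[OF that] _ N]) auto
  have "ck (Suc 0) F ?N (\<lambda>v. f (\<lambda>c. g c v))" by (rule ck_compose[OF f g' F N]) auto
  from total_deriv_sum[OF F ck_depends[OF this]] u
  have "total_deriv (\<lambda>v. f (\<lambda>c. g c v)) u = (\<Sum>i\<in>F. pd i (\<lambda>v. f (\<lambda>c. g c v)) u * shift i u)" by simp
  also have "\<dots> = (\<Sum>i\<in>F. (\<Sum>c\<in>G. pd c f (\<lambda>c. g c u) * pd i (g c) u) * shift i u)"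
    using pd_compose[OF f g u(2,1)] by simp
  also have "\<dots> = (\<Sum>c\<in>G. \<Sum>i\<in>F. pd c f (\<lambda>c. g c u) * pd i (g c) u * shift i u)"
    by (simp only: sum_distrib_right sum.swap[of _ G F])
  also have "\<dots> = (\<Sum>c\<in>G. pd c f (\<lambda>c. g c u) * total_deriv (g c) u)"
    using total_deriv_sum[OF F ck_depends[OF g] u(1)] by (simp add: sum_distrib_left mult.assoc)
  finally show ?thesis .
qed

section \<open>Time as an additional coordinate\<close>

definition at_time :: "real \<Rightarrow> jet \<Rightarrow> coord option \<Rightarrow> real" where
  "at_time t u = case_option t u"

lemma at_time_simps [simp]: "at_time t u None = t" "at_time t u (Some c) = u c" "at_time t u \<circ> Some = u"
  by (auto simp: at_time_def)

lemma at_time_upd: "(at_time t u)(None := s) = at_time s u" "(at_time t u)(Some c := x) = at_time t (u(c := x))"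
  by (auto simp: at_time_def fun_eq_iff split: option.splits)

lemma at_time_collapse: "at_time (w None) (w \<circ> Some) = w"
  by (auto simp: at_time_def fun_eq_iff split: option.splits)

lemma joint_at_time [simp]: "joint f (at_time t u) = f t u"
  by (simp add: joint_def)

lemma at_time_in_joint_dom [simp]: "at_time t u \<in> joint_dom W \<longleftrightarrow> (t, u) \<in> W"
  by (simp add: joint_dom_def)

lemma pd_Some_joint: "pd (Some c) (joint f) w = pd c (f (w None)) (w \<circ> Some)"
proof -
  have "(w(Some c := s)) \<circ> Some = (w \<circ> Some)(c := s)" for s by (auto simp: fun_eq_iff)
  then show ?thesis by (simp add: pd_def joint_def)
qed

definition tck :: "nat \<Rightarrow> coord set \<Rightarrow> (real \<times> jet) set \<Rightarrow> (real \<Rightarrow> jet \<Rightarrow> real) \<Rightarrow> bool" where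
  "tck n F W f \<longleftrightarrow> ck n (insert None (Some ` F)) (joint_dom W) (joint f)"

lemma smooth_in_time_and_iff: "smooth_in_time_and F W f \<longleftrightarrow> (\<forall>n. tck n F W f)"
  by (simp add: smooth_in_time_and_def tck_def smooth_in_iff_ck)

lemma tck_depends: "tck n F W f \<Longrightarrow> depends_on_time_and F W f"
  by (simp add: depends_on_time_and_def tck_def ck_depends)

lemma tck_finite: "tck n F W f \<Longrightarrow> finite F"
  using ck_finite[of n "insert None (Some ` F)" "joint_dom W" "joint f"] finite_imageD[of Some F]
  by (simp add: tck_def)

definition slice :: "(real \<times> jet) set \<Rightarrow> real \<Rightarrow> jet set" where
  "slice W t = {u. (t, u) \<in> W}"

lemma slice_open_depends:
  assumes "open (joint_dom W)" "depends_on (insert None (Some ` F)) (joint_dom W) (\<lambda>_. 0)"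
  shows "open (slice W t)" "depends_on F (slice W t) (\<lambda>_. 0)"
proof -
  have c: "continuous_on UNIV (\<lambda>u. at_time t u k)" for k
    by (cases k) (auto intro: continuous_on_product_then_coordinatewise)
  have d: "depends_on F UNIV (\<lambda>u. at_time t u k)" if "k \<in> insert None (Some ` F)" for k
    using that by (auto simp: depends_on_def)
  have e: "{u\<in>UNIV. (\<lambda>k. at_time t u k) \<in> joint_dom W} = slice W t" by (simp add: slice_def)
  have "depends_on F (UNIV::jet set) (\<lambda>_. 0)" by (simp add: depends_on_def)
  note * = open_depends_vimage[where g="\<lambda>k u. at_time t u k", OF assms open_UNIV this c d, unfolded e]
  show "open (slice W t)" by (rule *(1); simp)
  show "depends_on F (slice W t) (\<lambda>_. 0)" by (rule *(2); simp)
qed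

lemma tck_dom:
  assumes "tck n F W f"
  shows "open (joint_dom W)" "depends_on (insert None (Some ` F)) (joint_dom W) (\<lambda>_. 0)"
  using assms ckD[of n "insert None (Some ` F)" "joint_dom W" "joint f"]
    depends_on_comp1[of "insert None (Some ` F)" "joint_dom W" "joint f" "\<lambda>_. 0"]
  by (simp_all add: tck_def)

lemma tck_slice:
  assumes f: "tck n F W f"
  shows "ck n F (slice W t) (f t)"
proof -
  note fin = tck_finite[OF f] and s = slice_open_depends[OF tck_dom[OF f], of t]
  have "ck n F (slice W t) (\<lambda>u. joint f (\<lambda>k. at_time t u k))"
  proof (rule ck_compose[OF f[unfolded tck_def] _ fin s])
    show "ck n F (slice W t) (\<lambda>u. at_time t u k)" if "k \<in> insert None (Some ` F)" for k
      using that by (auto intro: ck_const[OF fin s] ck_coord[OF fin s])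
    show "(\<lambda>k. at_time t u k) \<in> joint_dom W" if "u \<in> slice W t" for u
      using that by (simp add: slice_def)
  qed
  then show ?thesis by simp
qed

lemma tck_subset:
  assumes f: "tck n F W f" and W: "W' \<subseteq> W" "open (joint_dom W')" "depends_on (insert None (Some ` F')) (joint_dom W') (\<lambda>_. 0)"
    and F: "F \<subseteq> F'" "finite F'"
  shows "tck n F' W' f"
  unfolding tck_def
proof (rule ck_subset[OF _ _ W(2,3)])
  show "ck n (insert None (Some ` F')) (joint_dom W) (joint f)"
    by (rule ck_mono[OF f[unfolded tck_def]]) (use F in auto)
  show "joint_dom W' \<subseteq> joint_dom W" using W(1) by (auto simp: joint_dom_def)
qed

lemma eventually_time:
  assumes f: "tck n F W f" and u: "(t, u) \<in> W"
  shows "\<forall>\<^sub>F s in nhds t. (s, u) \<in> W"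
  using eventually_fun_upd[OF tck_dom(1)[OF f], of "at_time t u" None] u by (simp add: at_time_upd)

text \<open>The total derivative involves derivatives in jet coordinates only, with coefficients
  independent of time; by symmetry of second derivatives it commutes with d/dt.\<close>

lemma total_deriv_time:
  assumes f: "tck (Suc (Suc 0)) F W f" and u: "(t, u) \<in> W"
  shows "((\<lambda>s. total_deriv (f s) u) has_real_derivative
           total_deriv (\<lambda>v. pd None (joint f) (at_time t v)) u) (at t)"
proof -
  note fin = tck_finite[OF f]
  have f': "ck (Suc (Suc 0)) (insert None (Some ` F)) (joint_dom W) (joint f)" using f by (simp add: tck_def)
  have w: "at_time t u \<in> joint_dom W" using u by simp
  have sum: "total_deriv (f s) u = (\<Sum>c\<in>F. pd (Some c) (joint f) (at_time s u) * shift c u)" if "(s, u) \<in> W" for s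
    using total_deriv_sum[OF fin ck_depends[OF tck_slice[OF f]], of u s] that
    by (simp add: slice_def pd_Some_joint)
  have "((\<lambda>s. \<Sum>c\<in>F. pd (Some c) (joint f) (at_time s u) * shift c u) has_real_derivative
      (\<Sum>c\<in>F. pd None (pd (Some c) (joint f)) (at_time t u) * shift c u)) (at t)"
  proof (rule DERIV_sum, rule DERIV_cmult_right)
    fix c
    show "((\<lambda>s. pd (Some c) (joint f) (at_time s u)) has_real_derivative pd None (pd (Some c) (joint f)) (at_time t u)) (at t)"
      using ck_Suc_DERIV[OF ck_pd[OF f', of "Some c"] w, of None] by (simp add: at_time_upd)
  qed
  also have "(\<Sum>c\<in>F. pd None (pd (Some c) (joint f)) (at_time t u) * shift c u) =
      (\<Sum>c\<in>F. pd c (\<lambda>v. pd None (joint f) (at_time t v)) u * shift c u)"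
  proof (rule sum.cong[OF refl])
    fix c
    have "pd None (pd (Some c) (joint f)) (at_time t u) = pd (Some c) (pd None (joint f)) (at_time t u)"
      by (rule pd_commute[OF f' w])
    also have "\<dots> = pd c (\<lambda>v. pd None (joint f) (at_time t v)) u" by (simp add: pd_def at_time_upd)
    finally show "pd None (pd (Some c) (joint f)) (at_time t u) * shift c u =
      pd c (\<lambda>v. pd None (joint f) (at_time t v)) u * shift c u" by simp
  qed
  also have "\<dots> = total_deriv (\<lambda>v. pd None (joint f) (at_time t v)) u"
  proof (rule total_deriv_sum[OF fin, symmetric])
    have "tck 0 F W (\<lambda>t v. pd None (joint f) (at_time t v))"
      unfolding tck_def by (rule ck_cong[OF ck_0[OF ck_pd[OF f']]]) (simp add: joint_def at_time_collapse)
    from ck_depends[OF tck_slice[OF this]]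
    show "depends_on F (slice W t) (\<lambda>v. pd None (joint f) (at_time t v))" .
    show "u \<in> slice W t" using u by (simp add: slice_def)
  qed
  finally show ?thesis
    by (rule DERIV_cong_ev[THEN iffD2, rotated -1])
      (use eventually_mono[OF eventually_time[OF f u]] sum in auto)
qed

definition Jk :: "nat \<Rightarrow> coord set" where
  "Jk k = insert Cx {Cy L \<alpha> | L \<alpha>. \<alpha> \<le> k}"

lemma finite_Jk [simp]: "finite (Jk k)"
proof -
  have "{Cy L \<alpha> | L \<alpha>. \<alpha> \<le> k} = (\<lambda>(L, \<alpha>). Cy L \<alpha>) ` (UNIV \<times> {..k})" by auto
  then show ?thesis by (simp add: Jk_def)
qed

lemma Jk_simps [simp]: "Cx \<in> Jk k" "Cy L \<alpha> \<in> Jk k \<longleftrightarrow> \<alpha> \<le> k"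
  by (simp_all add: Jk_def)

lemma Jk_mono: "k \<le> m \<Longrightarrow> Jk k \<subseteq> Jk m"
  by (auto simp: Jk_def)

lemma J1_coords_Jk: "J1_coords = Jk 1"
  by (simp add: J1_coords_def Jk_def)

lemma tck_total_deriv:
  assumes f: "tck (Suc n) (Jk k) W f"
  shows "tck n (Jk (Suc k)) W (\<lambda>t u. total_deriv (f t) u)"
proof -
  let ?F = "insert None (Some ` Jk (Suc k))"
  have f': "ck (Suc n) ?F (joint_dom W) (joint f)"
    by (rule ck_mono[OF f[unfolded tck_def]]) (use Jk_mono[of k "Suc k"] in auto)
  have D: "finite ?F" "open (joint_dom W)" "depends_on ?F (joint_dom W) (\<lambda>_. 0)"
    using ckD[OF f'] depends_on_comp1[OF ck_depends[OF f'], of "\<lambda>_. 0"] by simp_all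
  have "ck n ?F (joint_dom W) (\<lambda>w. \<Sum>c\<in>Jk k. pd (Some c) (joint f) w * shift c (w \<circ> Some))"
  proof (rule ck_sum[OF D], rule ck_mult)
    fix c assume c: "c \<in> Jk k"
    show "ck n ?F (joint_dom W) (pd (Some c) (joint f))" by (rule ck_pd[OF f'])
    show "ck n ?F (joint_dom W) (\<lambda>w. shift c (w \<circ> Some))"
      using c by (cases c) (auto intro: ck_const[OF D] ck_coord[OF D])
  qed
  then show ?thesis
    unfolding tck_def
  proof (rule ck_cong)
    fix w assume "w \<in> joint_dom W"
    then have "w \<circ> Some \<in> slice W (w None)" by (simp add: joint_dom_def slice_def)
    from total_deriv_sum[OF finite_Jk ck_depends[OF tck_slice[OF f]] this]
    show "(\<Sum>c\<in>Jk k. pd (Some c) (joint f) w * shift c (w \<circ> Some)) = joint (\<lambda>t u. total_deriv (f t) u) w"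
      by (simp add: pd_Some_joint joint_def)
  qed
qed

lemma tck_divide:
  assumes "tck n F W f" "tck n F W g" "\<And>t u. (t, u) \<in> W \<Longrightarrow> g t u \<noteq> 0"
  shows "tck n F W (\<lambda>t u. f t u / g t u)"
proof -
  have "ck n (insert None (Some ` F)) (joint_dom W) (\<lambda>w. joint f w / joint g w)"
  proof (rule ck_divide)
    show "joint g w \<noteq> 0" if "w \<in> joint_dom W" for w
      using that assms(3) by (simp add: joint_dom_def joint_def)
  qed (use assms(1,2) in \<open>simp_all add: tck_def\<close>)
  then show ?thesis unfolding tck_def by (rule ck_cong) (simp add: joint_def)
qed

section \<open>Prolonged maps and the group law in all orders\<close>

primrec prolong :: "(real \<Rightarrow> jet \<Rightarrow> real) \<Rightarrow> (2 \<Rightarrow> real \<Rightarrow> jet \<Rightarrow> real) \<Rightarrow> nat \<Rightarrow> 2 \<Rightarrow> real \<Rightarrow> jet \<Rightarrow> real" where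
  "prolong \<Xi> H 0 L t u = H L t u"
| "prolong \<Xi> H (Suc k) L t u = total_deriv (prolong \<Xi> H k L t) u / total_deriv (\<Xi> t) u"

definition prolonged :: "(real \<Rightarrow> jet \<Rightarrow> real) \<Rightarrow> (2 \<Rightarrow> real \<Rightarrow> jet \<Rightarrow> real) \<Rightarrow> real \<Rightarrow> jet \<Rightarrow> jet" where
  "prolonged \<Xi> H t u c = (case c of Cx \<Rightarrow> \<Xi> t u | Cy L k \<Rightarrow> prolong \<Xi> H k L t u)"

lemma prolonged_simps:
  "prolonged \<Xi> H t u Cx = \<Xi> t u" "prolonged \<Xi> H t u (Cy L k) = prolong \<Xi> H k L t u"
  by (simp_all add: prolonged_def)

text \<open>
  The bound on \<open>y\<^sup>1\<^sub>a\<close> makes every set of coordinates that determines a component of the flow contain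
  \<open>y\<^sup>1\<^sub>a\<close>, so that a composition is defined only where \<open>\<D>\<Xi>\<close> does not vanish.
\<close>

locale point_flow =
  fixes U :: "jet set" and X :: field and W0 :: "(real \<times> jet) set"
    and \<Xi> :: "real \<Rightarrow> jet \<Rightarrow> real" and H :: "2 \<Rightarrow> real \<Rightarrow> jet \<Rightarrow> real"
    and a :: 2 and B :: real
  assumes \<Xi>: "tck n (Jk 1) W0 \<Xi>" and H: "tck n (Jk 1) W0 (H L)"
    and W0U: "(t, u) \<in> W0 \<Longrightarrow> u \<in> U"
    and LB: "Lie_Backlund_on U X" and openU: "open U"
    and zero: "(0, u) \<in> W0 \<Longrightarrow> \<Xi> 0 u = u Cx" "(0, u) \<in> W0 \<Longrightarrow> H L 0 u = u (Cy L 0)"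
    and der: "(0, u) \<in> W0 \<Longrightarrow> ((\<lambda>t. \<Xi> t u) has_real_derivative X Cx u) (at 0)"
      "(0, u) \<in> W0 \<Longrightarrow> ((\<lambda>t. H L t u) has_real_derivative X (Cy L 0) u) (at 0)"
    and grp: "(s, u) \<in> W0 \<Longrightarrow> total_deriv (\<Xi> s) u \<noteq> 0 \<Longrightarrow> (t, prolonged \<Xi> H s u) \<in> W0 \<Longrightarrow>
        (t + s, u) \<in> W0 \<Longrightarrow> \<Xi> t (prolonged \<Xi> H s u) = \<Xi> (t + s) u"
      "(s, u) \<in> W0 \<Longrightarrow> total_deriv (\<Xi> s) u \<noteq> 0 \<Longrightarrow> (t, prolonged \<Xi> H s u) \<in> W0 \<Longrightarrow>
        (t + s, u) \<in> W0 \<Longrightarrow> H L t (prolonged \<Xi> H s u) = H L (t + s) u"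
    and bounded: "(t, u) \<in> W0 \<Longrightarrow> \<bar>u (Cy a 1)\<bar> \<le> B"
begin

abbreviation \<Phi> where "\<Phi> \<equiv> prolonged \<Xi> H"

abbreviation Hk where "Hk \<equiv> prolong \<Xi> H"

definition W1 :: "(real \<times> jet) set" where
  "W1 = {(t, u). (t, u) \<in> W0 \<and> total_deriv (\<Xi> t) u \<noteq> 0}"

text \<open>\<open>W1\<close> involves coordinates of second order through the total derivative of
  \<open>\<Xi>\<close>. The components of order zero keep \<open>W0\<close>, so that their domains,
  and not only their values, are determined by first-order coordinates.\<close>

definition W :: "coord \<Rightarrow> (real \<times> jet) set" where
  "W c = (case c of Cx \<Rightarrow> W0 | Cy L k \<Rightarrow> if k = 0 then W0 else W1)"

lemma W1_sub: "W1 \<subseteq> W0"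
  by (auto simp: W1_def)

lemma W1_dom:
  assumes "m \<ge> 2"
  shows "open (joint_dom W1)" "depends_on (insert None (Some ` Jk m)) (joint_dom W1) (\<lambda>_. 0)"
proof -
  have "tck 0 (Jk (Suc 1)) W0 (\<lambda>t u. total_deriv (\<Xi> t) u)" by (rule tck_total_deriv[OF \<Xi>])
  then have d: "ck 0 (insert None (Some ` Jk (Suc 1))) (joint_dom W0) (joint (\<lambda>t u. total_deriv (\<Xi> t) u))"
    by (simp add: tck_def)
  have e: "joint_dom W1 = {w\<in>joint_dom W0. joint (\<lambda>t u. total_deriv (\<Xi> t) u) w \<in> - {0}}"
    by (auto simp: joint_dom_def W1_def joint_def)
  show "open (joint_dom W1)" unfolding e
    by (rule open_Collect_in[OF ck_open[OF d] ck_continuous[OF d]]) (simp add: open_Compl)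
  have "depends_on (insert None (Some ` Jk (Suc 1))) (joint_dom W1) (\<lambda>_. 0)"
    unfolding e by (rule depends_Collect_in[OF ck_depends[OF d]])
  then show "depends_on (insert None (Some ` Jk m)) (joint_dom W1) (\<lambda>_. 0)"
    by (rule depends_on_mono) (use Jk_mono[of "Suc 1" m] assms in auto)
qed

lemma tck_restrict_W1:
  assumes "tck n (Jk k) W0 f" "k \<le> m" "2 \<le> m"
  shows "tck n (Jk m) W1 f"
  by (rule tck_subset[OF assms(1) W1_sub W1_dom[OF assms(3)] Jk_mono[OF assms(2)] finite_Jk])

lemma tck_D\<Xi>:
  assumes "2 \<le> m"
  shows "tck n (Jk m) W1 (\<lambda>t u. total_deriv (\<Xi> t) u)"
  by (rule tck_restrict_W1[OF tck_total_deriv[OF \<Xi>]]) (use assms in auto)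

text \<open>The order is k + 2 instead of k + 1 because already for k = 0 the domain
  \<open>W1\<close> needs coordinates of order two.\<close>

lemma tck_Hk_W1: "tck n (Jk (Suc (Suc k))) W1 (Hk k L)"
proof (induction k arbitrary: n)
  case 0
  have "Hk 0 L = H L" by (simp add: fun_eq_iff)
  then show ?case using tck_restrict_W1[OF H, of "Suc (Suc 0)" n L] by simp
next
  case (Suc k)
  have "tck n (Jk (Suc (Suc (Suc k)))) W1 (\<lambda>t u. total_deriv (Hk k L t) u / total_deriv (\<Xi> t) u)"
    by (rule tck_divide[OF tck_total_deriv[OF Suc.IH] tck_D\<Xi>]) (simp_all add: W1_def)
  moreover have "Hk (Suc k) L = (\<lambda>t u. total_deriv (Hk k L t) u / total_deriv (\<Xi> t) u)"
    by (simp add: fun_eq_iff)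
  ultimately show ?case by simp
qed

lemma tck_\<Phi>_W1: "\<exists>m. \<forall>n. tck n (Jk m) W1 (\<lambda>t u. \<Phi> t u c)"
proof (cases c)
  case Cx
  then show ?thesis using tck_restrict_W1[OF \<Xi>, of 2] by (auto simp: prolonged_simps)
next
  case (Cy L k)
  then show ?thesis using tck_Hk_W1[of _ k L] by (auto simp: prolonged_simps)
qed

lemma \<Phi>_smooth: "\<exists>F. smooth_in_time_and F (W c) (\<lambda>t u. \<Phi> t u c)"
proof (cases c)
  case Cx
  then show ?thesis using \<Xi> unfolding smooth_in_time_and_iff by (auto simp: prolonged_simps W_def)
next
  case (Cy L k)
  have "\<exists>F. \<forall>n. tck n F (W (Cy L k)) (Hk k L)"
  proof (cases k)
    case 0
    have "Hk 0 L = H L" by (simp add: fun_eq_iff)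
    then show ?thesis using H 0 by (auto simp: W_def)
  next
    case (Suc k')
    then show ?thesis using tck_Hk_W1[of _ k L] by (auto simp: W_def)
  qed
  then show ?thesis unfolding smooth_in_time_and_iff by (simp add: Cy prolonged_simps)
qed

lemma D\<Xi>_zero: "(0, u) \<in> W0 \<Longrightarrow> total_deriv (\<Xi> 0) u = 1"
proof -
  assume u: "(0, u) \<in> W0"
  have "total_deriv (\<Xi> 0) u = total_deriv (\<lambda>v. v Cx) u"
    by (rule total_deriv_cong[OF slice_open_depends(1)[OF tck_dom[OF \<Xi>], of 0]])
      (use u zero(1) in \<open>auto simp: slice_def\<close>)
  then show ?thesis by (simp add: total_deriv_coord)
qed

lemma W1_zero: "(0, u) \<in> W0 \<Longrightarrow> (0, u) \<in> W1"
  using D\<Xi>_zero by (simp add: W1_def)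

lemma velocity_at_zero:
  assumes "((\<lambda>t. f t v) has_real_derivative d) (at 0)"
  shows "pd None (joint f) (at_time 0 v) = d"
  by (rule pd_eqI) (use assms in \<open>simp add: at_time_upd\<close>)

lemma D\<Xi>_der:
  assumes u: "(0, u) \<in> W0"
  shows "((\<lambda>t. total_deriv (\<Xi> t) u) has_real_derivative total_deriv (X Cx) u) (at 0)"
proof -
  have "total_deriv (\<lambda>v. pd None (joint \<Xi>) (at_time 0 v)) u = total_deriv (X Cx) u"
    by (rule total_deriv_cong[OF slice_open_depends(1)[OF tck_dom[OF \<Xi>], of 0]])
      (use u velocity_at_zero[OF der(1)] in \<open>auto simp: slice_def\<close>)
  then show ?thesis using total_deriv_time[OF \<Xi> u] by simp
qed

text \<open>At time zero the total derivative of \<open>\<Xi>\<close> is 1, and the quotient rule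
  turns the definition of \<open>prolong\<close> into the Lie-Backlund recursion. Value and
  derivative are treated together because the quotient rule uses the value of the numerator.\<close>

lemma Hk_zero:
  "(0, u) \<in> W0 \<Longrightarrow> Hk k L 0 u = u (Cy L k) \<and> ((\<lambda>t. Hk k L t u) has_real_derivative X (Cy L k) u) (at 0)"
proof (induction k arbitrary: u)
  case 0
  then show ?case using zero(2) der(2) by simp
next
  case (Suc k)
  note u = Suc.prems
  note u1 = W1_zero[OF u]
  note op = slice_open_depends(1)[OF W1_dom[OF order_refl], of 0]
  have "total_deriv (Hk k L 0) u = total_deriv (\<lambda>v. v (Cy L k)) u"
    by (rule total_deriv_cong[OF op]) (use u1 W1_sub Suc.IH in \<open>auto simp: slice_def\<close>)
  then have D0: "total_deriv (Hk k L 0) u = u (Cy L (Suc k))" by (simp add: total_deriv_coord)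
  have "total_deriv (\<lambda>v. pd None (joint (Hk k L)) (at_time 0 v)) u = total_deriv (X (Cy L k)) u"
    by (rule total_deriv_cong[OF op]) (use u1 W1_sub velocity_at_zero Suc.IH in \<open>auto simp: slice_def\<close>)
  then have "((\<lambda>t. total_deriv (Hk k L t) u) has_real_derivative total_deriv (X (Cy L k)) u) (at 0)"
    using total_deriv_time[OF tck_Hk_W1 u1, of k L] by simp
  from DERIV_divide[OF this D\<Xi>_der[OF u]]
  have "((\<lambda>t. Hk (Suc k) L t u) has_real_derivative
      total_deriv (X (Cy L k)) u - u (Cy L (Suc k)) * total_deriv (X Cx) u) (at 0)"
    by (simp add: D0 D\<Xi>_zero[OF u])
  moreover have "X (Cy L (Suc k)) u = total_deriv (X (Cy L k)) u - u (Cy L (Suc k)) * total_deriv (X Cx) u"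
    using LB W0U[OF u] by (simp add: Lie_Backlund_on_def)
  ultimately show ?case using D0 D\<Xi>_zero[OF u] by simp
qed

text \<open>The contact property of the prolonged map; it is the definition of
  \<open>prolong\<close> with the denominator cleared.\<close>

lemma total_deriv_\<Phi>:
  assumes "(s, u) \<in> W1"
  shows "total_deriv (\<lambda>v. \<Phi> s v c) u = shift c (\<Phi> s u) * total_deriv (\<Xi> s) u"
  using assms by (cases c) (simp_all add: prolonged_simps W1_def)

text \<open>By the chain rule and the contact property, composition with the prolonged map
  multiplies total derivatives by that of \<open>\<Xi> s\<close>. Orders are raised to at least 2 to
  determine the domain \<open>W1\<close>, and \<open>K\<close> is a common order for the finitely
  many components that enter.\<close>

lemma \<Phi>_compose_total_deriv:
  assumes f: "tck (Suc 0) (Jk m) W1 f" and s: "(s, u) \<in> W1" and t: "(t, \<Phi> s u) \<in> W1"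
  shows "total_deriv (\<lambda>v. f t (\<Phi> s v)) u = total_deriv (f t) (\<Phi> s u) * total_deriv (\<Xi> s) u"
    and "open {v\<in>slice W1 s. \<Phi> s v \<in> slice W1 t}"
proof -
  obtain k where k: "\<And>c n. tck n (Jk (k c)) W1 (\<lambda>t u. \<Phi> t u c)" using tck_\<Phi>_W1 by metis
  define K where "K = Max (insert 2 (k ` Jk (max m 2)))"
  have K: "k c \<le> K" if "c \<in> Jk (max m 2)" for c using that by (simp add: K_def)
  have K2: "2 \<le> K" by (simp add: K_def)
  have m2: "2 \<le> max m 2" by simp
  have f': "tck (Suc 0) (Jk (max m 2)) W1 f"
    by (rule tck_subset[OF f subset_refl W1_dom[OF m2] Jk_mono finite_Jk]) simp
  have g: "ck (Suc 0) (Jk K) (slice W1 s) (\<lambda>v. \<Phi> s v c)" if "c \<in> Jk (max m 2)" for c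
    by (rule ck_mono[OF tck_slice[OF k] Jk_mono[OF K[OF that]]]) simp
  note sl = slice_open_depends[OF W1_dom[OF K2], of s]
  have "total_deriv (\<lambda>v. f t (\<lambda>c. \<Phi> s v c)) u = (\<Sum>c\<in>Jk (max m 2). pd c (f t) (\<lambda>c. \<Phi> s u c) * total_deriv (\<lambda>v. \<Phi> s v c) u)"
    by (rule total_deriv_compose[OF tck_slice[OF f'] finite_Jk g sl]) (use s t in \<open>simp_all add: slice_def\<close>)
  also have "\<dots> = (\<Sum>c\<in>Jk (max m 2). pd c (f t) (\<Phi> s u) * shift c (\<Phi> s u)) * total_deriv (\<Xi> s) u"
    by (simp add: total_deriv_\<Phi>[OF s] sum_distrib_right mult.assoc)
  also have "(\<Sum>c\<in>Jk (max m 2). pd c (f t) (\<Phi> s u) * shift c (\<Phi> s u)) = total_deriv (f t) (\<Phi> s u)"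
    by (rule total_deriv_sum[OF finite_Jk ck_depends[OF tck_slice[OF f']], symmetric]) (use t in \<open>simp add: slice_def\<close>)
  finally show "total_deriv (\<lambda>v. f t (\<Phi> s v)) u = total_deriv (f t) (\<Phi> s u) * total_deriv (\<Xi> s) u" by simp
  show "open {v\<in>slice W1 s. \<Phi> s v \<in> slice W1 t}"
    using open_depends_vimage(1)[OF slice_open_depends[OF W1_dom[OF m2], of t] sl ck_continuous[OF g] ck_depends[OF g]]
    by simp
qed

text \<open>The group identity can be differentiated because it holds on an open set around
  \<open>u\<close>; hence \<open>g\<close> speaks of all points \<open>v\<close>.\<close>

lemma total_deriv_group:
  assumes f: "\<And>n. tck n (Jk m) W1 f" and s: "(s, u) \<in> W1" and t: "(t, \<Phi> s u) \<in> W1" and ts: "(t + s, u) \<in> W1"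
    and g: "\<And>v. (s, v) \<in> W1 \<Longrightarrow> (t, \<Phi> s v) \<in> W1 \<Longrightarrow> (t + s, v) \<in> W1 \<Longrightarrow> f t (\<Phi> s v) = f (t + s) v"
  shows "total_deriv (f (t + s)) u = total_deriv (f t) (\<Phi> s u) * total_deriv (\<Xi> s) u"
proof -
  let ?N = "{v\<in>slice W1 s. \<Phi> s v \<in> slice W1 t} \<inter> slice W1 (t + s)"
  have "open ?N"
    by (rule open_Int[OF \<Phi>_compose_total_deriv(2)[OF f s t] slice_open_depends(1)[OF W1_dom[OF order_refl]]])
  then have "total_deriv (\<lambda>v. f t (\<Phi> s v)) u = total_deriv (f (t + s)) u"
    by (rule total_deriv_cong) (use s t ts g in \<open>auto simp: slice_def\<close>)
  then show ?thesis using \<Phi>_compose_total_deriv(1)[OF f s t] by simp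
qed

lemma D\<Xi>_group:
  assumes s: "(s, u) \<in> W1" and t: "(t, \<Phi> s u) \<in> W1" and ts: "(t + s, u) \<in> W1"
  shows "total_deriv (\<Xi> (t + s)) u = total_deriv (\<Xi> t) (\<Phi> s u) * total_deriv (\<Xi> s) u"
  by (rule total_deriv_group[OF tck_restrict_W1[OF \<Xi>, of 2] s t ts])
    (use grp(1) in \<open>auto simp: W1_def\<close>)

text \<open>Numerator and denominator of the next component both acquire the factor
  \<open>total_deriv (\<Xi> s) u\<close>, which cancels.\<close>

lemma Hk_group:
  "(s, u) \<in> W1 \<Longrightarrow> (t, \<Phi> s u) \<in> W1 \<Longrightarrow> (t + s, u) \<in> W1 \<Longrightarrow> Hk k L t (\<Phi> s u) = Hk k L (t + s) u"
proof (induction k arbitrary: u)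
  case 0
  then show ?case using grp(2) by (simp add: W1_def)
next
  case (Suc k)
  have n0: "total_deriv (\<Xi> s) u \<noteq> 0" using Suc.prems(1) by (simp add: W1_def)
  have "total_deriv (Hk k L (t + s)) u = total_deriv (Hk k L t) (\<Phi> s u) * total_deriv (\<Xi> s) u"
    by (rule total_deriv_group[OF tck_Hk_W1 Suc.prems Suc.IH])
  then show ?case using D\<Xi>_group[OF Suc.prems] n0 by simp
qed

lemma comp_defined_W1:
  assumes "comp_defined W \<Phi> c t s u"
  shows "(s, u) \<in> W1" "(t, \<Phi> s u) \<in> W c"
proof -
  obtain F where F: "finite F" "depends_on_time_and F (W c) (\<lambda>t u. \<Phi> t u c)"
    "\<forall>c'\<in>F. (s, u) \<in> W c'" "(t, \<Phi> s u) \<in> W c"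
    using assms unfolding comp_defined_def by blast
  show "(t, \<Phi> s u) \<in> W c" by (rule F(4))
  have WW0: "(t, v) \<in> W0" if "(t, v) \<in> W c" for t v
    using that W1_sub by (auto simp: W_def split: coord.splits if_splits)
  have "Cy a 1 \<in> F"
  proof (rule ccontr)
    assume n: "Cy a 1 \<notin> F"
    \<comment> \<open>If \<open>F\<close> missed y^1_a, this coordinate could be moved beyond
      \<open>B\<close> without leaving \<open>W c\<close>, contrary to
      \<open>bounded\<close>.\<close>
    let ?v = "(\<Phi> s u)(Cy a 1 := B + 1)"
    have "at_time t ?v \<in> joint_dom (W c)"
    proof (rule depends_onD(1)[OF F(2)[unfolded depends_on_time_and_def]])
      show "at_time t (\<Phi> s u) \<in> joint_dom (W c)" using F(4) by simp
      fix i assume i: "i \<in> insert None (Some ` F)"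
      show "at_time t (\<Phi> s u) i = at_time t ?v i"
        using i n by (cases i) auto
    qed
    then have "(t, ?v) \<in> W c" by simp
    from bounded[OF WW0[OF this]] show False by simp
  qed
  \<comment> \<open>The coordinate y^1_a has order one, so its component has the domain
    \<open>W1\<close>.\<close>
  then show "(s, u) \<in> W1" using F(3) by (auto simp: W_def)
qed

theorem exponentiable: "exponentiable_to U X W \<Phi>"
  unfolding exponentiable_to_def
proof (intro conjI allI impI ballI)
  show "\<exists>F. smooth_in_time_and F (W c) (\<lambda>t u. \<Phi> t u c)" for c by (rule \<Phi>_smooth)
  have WW0: "(t, v) \<in> W0" if "(t, v) \<in> W c" for t v c
    using that W1_sub by (auto simp: W_def split: coord.splits if_splits)
  show "\<Phi> 0 u c = u c" if "(0, u) \<in> W c" for c u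
    using WW0[OF that] zero(1) Hk_zero by (cases c) (simp_all add: prolonged_simps)
  show "((\<lambda>t. \<Phi> t u c) has_real_derivative X c u) (at 0)" if "(0, u) \<in> W c" for c u
    using WW0[OF that] der(1) Hk_zero by (cases c) (simp_all add: prolonged_simps)
  fix c t s u assume a: "comp_defined W \<Phi> c t s u \<and> (t + s, u) \<in> W c"
  then have s: "(s, u) \<in> W1" and t: "(t, \<Phi> s u) \<in> W c" and ts: "(t + s, u) \<in> W c"
    using comp_defined_W1 by blast+
  have s0: "(s, u) \<in> W0" "total_deriv (\<Xi> s) u \<noteq> 0" using s by (auto simp: W1_def)
  show "\<Phi> t (\<Phi> s u) c = \<Phi> (t + s) u c"
  proof (cases c)
    case Cx
    then show ?thesis using grp(1)[OF s0 WW0[OF t] WW0[OF ts]] by (simp add: prolonged_simps)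
  next
    case (Cy L k)
    show ?thesis
    proof (cases k)
      case 0
      then show ?thesis using grp(2)[OF s0 WW0[OF t] WW0[OF ts]] Cy by (simp add: prolonged_simps)
    next
      case (Suc k')
      then have "(t, \<Phi> s u) \<in> W1" "(t + s, u) \<in> W1" using t ts Cy by (auto simp: W_def)
      from Hk_group[OF s this] show ?thesis using Cy by (simp add: prolonged_simps)
    qed
  qed
qed

text \<open>\<open>W1\<close> lies in every \<open>W c\<close>, so a single time bound serves all
  the infinitely many components.\<close>

lemma flow_dom_W: "{u. (0, u) \<in> W0} \<subseteq> flow_dom W"
proof
  fix u assume "u \<in> {u. (0, u) \<in> W0}"
  then have "(0, u) \<in> W1" using W1_zero by simp
  from eventually_time[OF tck_D\<Xi>[OF order_refl] this]
  obtain d where "d > 0" "\<And>s. dist s 0 < d \<Longrightarrow> (s, u) \<in> W1"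
    by (auto simp: eventually_nhds_metric)
  then have "\<forall>t. \<bar>t\<bar> < d \<longrightarrow> (\<forall>c. (t, u) \<in> W c)"
    using W1_sub by (auto simp: W_def dist_real_def split: coord.splits)
  then show "u \<in> flow_dom W" using \<open>d > 0\<close> by (auto simp: flow_dom_def)
qed

lemma W_simps: "W Cx = W0" "W (Cy L 0) = W0"
  by (simp_all add: W_def)

end

section \<open>Fields whose components are constant along lines\<close>

lemma pd_mult:
  assumes "ck (Suc 0) F U f" "ck (Suc 0) F U g" "u \<in> U"
  shows "pd i (\<lambda>u. f u * g u) u = pd i f u * g u + f u * pd i g u"
proof (rule pd_eqI)
  show "((\<lambda>s. f (u(i := s)) * g (u(i := s))) has_real_derivative pd i f u * g u + f u * pd i g u) (at (u i))"
    using DERIV_mult[OF ck_Suc_DERIV[OF assms(1,3), of i] ck_Suc_DERIV[OF assms(2,3), of i]]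
    by (simp only: fun_upd_triv mult.commute)
qed

lemma pd_diff:
  assumes "ck (Suc 0) F U f" "ck (Suc 0) F U g" "u \<in> U"
  shows "pd i (\<lambda>u. f u - g u) u = pd i f u - pd i g u"
  by (rule pd_eqI) (rule DERIV_diff[OF ck_Suc_DERIV[OF assms(1,3)] ck_Suc_DERIV[OF assms(2,3)]])

lemma pd_uminus: "ck (Suc 0) F U f \<Longrightarrow> u \<in> U \<Longrightarrow> pd i (\<lambda>u. - f u) u = - pd i f u"
  by (rule pd_eqI) (rule DERIV_minus[OF ck_Suc_DERIV])

text \<open>Integrating factor: with an antiderivative \<open>g\<close> of \<open>k\<close>, the
  product \<open>f t * exp (- g t)\<close> is constant.\<close>

lemma linear_ode_zero:
  fixes f k :: "real \<Rightarrow> real"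
  assumes k: "continuous_on {l..r} k"
    and f: "\<And>t. t \<in> {l..r} \<Longrightarrow> (f has_real_derivative k t * f t) (at t within {l..r})"
    and t0: "t0 \<in> {l..r}" "f t0 = 0" and t: "t \<in> {l..r}"
  shows "f t = 0"
proof -
  obtain g where "\<And>t. t \<in> {l..r} \<Longrightarrow> (g has_vector_derivative k t) (at t within {l..r})"
    using antiderivative_continuous[OF k] by blast
  then have g: "(g has_real_derivative k t) (at t within {l..r})" if "t \<in> {l..r}" for t
    using that has_real_derivative_iff_has_vector_derivative by blast
  have "\<exists>c. \<forall>t\<in>{l..r}. f t * exp (- g t) = c"
  proof (rule has_field_derivative_zero_constant)
    show "((\<lambda>t. f t * exp (- g t)) has_real_derivative 0) (at t within {l..r})" if "t \<in> {l..r}" for t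
      by (rule derivative_eq_intros f[OF that] g[OF that] refl)+ simp
  qed simp
  then obtain c where c: "\<And>t. t \<in> {l..r} \<Longrightarrow> f t * exp (- g t) = c" by blast
  from c[OF t0(1)] t0(2) have "c = 0" by simp
  with c[OF t] show ?thesis by simp
qed

lemma UNIV_2_eq: "a \<noteq> b \<Longrightarrow> (UNIV::2 set) = {a, b}"
  by (metis (full_types) UNIV_eq_I exhaust_2 insertCI)

lemma sum_UNIV_2: "a \<noteq> b \<Longrightarrow> (\<Sum>K\<in>UNIV. f K) = f a + f (b::2)"
  by (simp add: UNIV_2_eq)

text \<open>The two indices are left open as \<open>a\<close> and \<open>b\<close> so that the
  nonzero entry can be taken to be M^b_a. The superscript \<open>b\<close> selects the row of M that
  gives the direction of the lines.\<close>

locale lb_field =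
  fixes U :: "jet set" and X :: field and a b :: 2
  assumes openU: "open U" and depU: "depends_on (Jk 1) U (\<lambda>_. 0)"
    and ck_xi: "ck n (Jk 1) U (X Cx)" and ck_eta: "ck n (Jk 1) U (X (Cy L 0))"
    and ab: "a \<noteq> b"
    and i_xi: "u \<in> U \<Longrightarrow> (\<Sum>P\<in>UNIV. Mmat X b P u * pd (Cy P 1) (X Cx) u) = 0"
    and i_eta: "u \<in> U \<Longrightarrow> (\<Sum>P\<in>UNIV. Mmat X b P u * pd (Cy P 1) (X (Cy L 0)) u) = 0"
    and ii_xi: "u \<in> U \<Longrightarrow> (\<Sum>P\<in>UNIV. Qmat X b P u * pd (Cy P 1) (X Cx) u) = 0"
    and ii_eta: "u \<in> U \<Longrightarrow> (\<Sum>P\<in>UNIV. Qmat X b P u * pd (Cy P 1) (X (Cy L 0)) u) = 0"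
begin

abbreviation ya where "ya \<equiv> Cy a 1"
abbreviation yb where "yb \<equiv> Cy b 1"

text \<open>\<open>O\<^sub>L\<close>, \<open>N\<^sup>K\<^sub>L\<close> and \<open>M\<^sup>K\<^sub>L\<close> are \<open>Pm i L\<close> for the coordinates \<open>i\<close> = \<open>x\<close>, \<open>y\<^sup>0\<^sub>K\<close>, \<open>y\<^sup>1\<^sub>K\<close>.\<close>

definition Pm :: "coord \<Rightarrow> 2 \<Rightarrow> jet \<Rightarrow> real" where
  "Pm i L u = pd i (X (Cy L 0)) u - u (Cy L 1) * pd i (X Cx) u"

lemma matrices_Pm: "Ovec X L = Pm Cx L" "Nmat X K L = Pm (Cy K 0) L" "Mmat X K L = Pm (Cy K 1) L"
  by (simp_all add: fun_eq_iff Ovec_def Nmat_def Mmat_def Pm_def)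

lemma ck_y1: "ck n (Jk 1) U (\<lambda>u. u (Cy L 1))"
  by (rule ck_coord[OF finite_Jk openU depU]) simp

lemma ck_Pm: "ck n (Jk 1) U (Pm i L)"
  unfolding Pm_def[abs_def] by (intro ck_diff ck_mult ck_y1 ck_pd[OF ck_xi] ck_pd[OF ck_eta])

lemma pd_Pm:
  assumes "u \<in> U"
  shows "pd j (Pm i L) u = pd j (pd i (X (Cy L 0))) u -
    ((if j = Cy L 1 then pd i (X Cx) u else 0) + u (Cy L 1) * pd j (pd i (X Cx)) u)"
proof -
  have "pd j (Pm i L) u = pd j (pd i (X (Cy L 0))) u - pd j (\<lambda>u. u (Cy L 1) * pd i (X Cx) u) u"
    unfolding Pm_def[abs_def] by (rule pd_diff[OF ck_pd[OF ck_eta] ck_mult[OF ck_y1 ck_pd[OF ck_xi]] assms])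
  also have "pd j (\<lambda>u. u (Cy L 1) * pd i (X Cx) u) u =
      pd j (\<lambda>u. u (Cy L 1)) u * pd i (X Cx) u + u (Cy L 1) * pd j (pd i (X Cx)) u"
    by (rule pd_mult[OF ck_y1 ck_pd[OF ck_xi] assms])
  finally show ?thesis by (simp add: pd_coord)
qed

section \<open>Consequences of condition (i)\<close>

definition U1 :: "jet set" where "U1 = {u\<in>U. Pm yb a u \<noteq> 0}"

text \<open>The slope of the lines in the \<open>(y\<^sup>1\<^sub>a, y\<^sup>1\<^sub>b)\<close>-planes along which \<open>\<xi>\<close> and \<open>\<eta>\<^sup>0\<^sub>L\<close> are constant.\<close>

definition \<sigma> :: "jet \<Rightarrow> real" where "\<sigma> u = Pm yb b u / Pm yb a u"

lemma U1_U: "u \<in> U1 \<Longrightarrow> u \<in> U"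
  by (simp add: U1_def)

lemma U1_dom: "open U1" "depends_on (Jk 1) U1 (\<lambda>_. 0)"
proof -
  have e: "U1 = {u\<in>U. Pm yb a u \<in> - {0}}" by (auto simp: U1_def)
  have "open (- {0::real})" by (simp add: open_Compl)
  then show "open U1" unfolding e by (rule open_Collect_in[OF openU ck_continuous[OF ck_Pm]])
  show "depends_on (Jk 1) U1 (\<lambda>_. 0)" unfolding e by (rule depends_Collect_in[OF ck_depends[OF ck_Pm]])
qed

lemma ck_U1: "ck n (Jk 1) U f \<Longrightarrow> ck n (Jk 1) U1 f"
  by (rule ck_subset[OF _ _ U1_dom]) (auto simp: U1_def)

lemma ck_sigma: "ck n (Jk 1) U1 \<sigma>"
  unfolding \<sigma>_def[abs_def] by (rule ck_divide[OF ck_U1[OF ck_Pm] ck_U1[OF ck_Pm]]) (simp add: U1_def)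

lemma sigma_Pm: "u \<in> U1 \<Longrightarrow> Pm yb b u = \<sigma> u * Pm yb a u"
  by (simp add: \<sigma>_def U1_def)

text \<open>The functions that descend to the space of lines, named after the basic functions of a
  foliation.\<close>

definition basic :: "(jet \<Rightarrow> real) \<Rightarrow> bool" where
  "basic f \<longleftrightarrow> (\<forall>n. ck n (Jk 1) U1 f) \<and> (\<forall>u\<in>U1. pd ya f u = - (\<sigma> u * pd yb f u))"

lemma basic_components: "basic (X Cx)" "basic (X (Cy L 0))"
proof -
  have "pd ya f u = - (\<sigma> u * pd yb f u)"
    if u: "u \<in> U1" and s: "(\<Sum>P\<in>UNIV. Mmat X b P u * pd (Cy P 1) f u) = 0" for f u
  proof -
    have "Pm yb a u * pd ya f u + \<sigma> u * Pm yb a u * pd yb f u = 0"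
      using s sigma_Pm[OF u] by (simp add: sum_UNIV_2[OF ab] matrices_Pm)
    then have "Pm yb a u * (pd ya f u + \<sigma> u * pd yb f u) = 0" by (simp add: algebra_simps)
    then show ?thesis using u by (simp add: U1_def)
  qed
  then show "basic (X Cx)" "basic (X (Cy L 0))"
    unfolding basic_def using i_xi i_eta U1_U ck_U1[OF ck_xi] ck_U1[OF ck_eta] by blast+
qed

text \<open>Differentiating the equation for \<open>f\<close> in direction \<open>i\<close> and
  commuting derivatives leaves the term in which \<open>\<sigma>\<close> itself is
  differentiated.\<close>

lemma basic_pd:
  assumes f: "basic f" and u: "u \<in> U1"
  shows "pd ya (pd i f) u + \<sigma> u * pd yb (pd i f) u = - (pd i \<sigma> u * pd yb f u)"
proof -
  have c: "ck n (Jk 1) U1 f" for n using f by (simp add: basic_def)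
  have "pd i (pd ya f) u = pd i (\<lambda>u. - (\<sigma> u * pd yb f u)) u"
    by (rule pd_cong[OF U1_dom(1) u]) (use f in \<open>simp add: basic_def\<close>)
  also have "\<dots> = - pd i (\<lambda>u. \<sigma> u * pd yb f u) u"
    by (rule pd_uminus[OF ck_mult[OF ck_sigma ck_pd[OF c]] u])
  also have "pd i (\<lambda>u. \<sigma> u * pd yb f u) u = pd i \<sigma> u * pd yb f u + \<sigma> u * pd i (pd yb f) u"
    by (rule pd_mult[OF ck_sigma ck_pd[OF c] u])
  finally show ?thesis using pd_commute[OF c u, of i ya] pd_commute[OF c u, of i yb] by simp
qed

text \<open>\<open>basic_pd\<close> is applied to \<xi> and \<eta>^0_L. The last term comes from the
  factor y^1_L, whose rate along a line is 1 for \<open>L = a\<close> and \<open>\<sigma>\<close>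
  for \<open>L = b\<close>.\<close>

lemma basic_Pm:
  assumes u: "u \<in> U1"
  shows "pd ya (Pm i L) u + \<sigma> u * pd yb (Pm i L) u =
    - (pd i \<sigma> u * Pm yb L u) - (if L = a then 1 else \<sigma> u) * pd i (X Cx) u"
proof -
  have L: "L = a \<or> L = b" using UNIV_2_eq[OF ab] by auto
  have y1: "Cy a 1 \<noteq> Cy b 1" "Cy b 1 \<noteq> Cy a 1" using ab by auto
  have "pd ya (Pm i L) u + \<sigma> u * pd yb (Pm i L) u =
      (pd ya (pd i (X (Cy L 0))) u + \<sigma> u * pd yb (pd i (X (Cy L 0))) u)
      - u (Cy L 1) * (pd ya (pd i (X Cx)) u + \<sigma> u * pd yb (pd i (X Cx)) u)
      - (if L = a then 1 else \<sigma> u) * pd i (X Cx) u"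
    using L ab y1 by (auto simp: pd_Pm[OF U1_U[OF u]] algebra_simps)
  also have "\<dots> = - (pd i \<sigma> u * Pm yb L u) - (if L = a then 1 else \<sigma> u) * pd i (X Cx) u"
    unfolding basic_pd[OF basic_components(1) u] basic_pd[OF basic_components(2) u] Pm_def
    by (simp add: algebra_simps)
  finally show ?thesis .
qed

lemma pd_sigma_Pm:
  assumes u: "u \<in> U1"
  shows "pd i (Pm yb b) u = pd i \<sigma> u * Pm yb a u + \<sigma> u * pd i (Pm yb a) u"
proof -
  have "pd i (Pm yb b) u = pd i (\<lambda>u. \<sigma> u * Pm yb a u) u"
    by (rule pd_cong[OF U1_dom(1) u]) (rule sigma_Pm)
  also have "\<dots> = pd i \<sigma> u * Pm yb a u + \<sigma> u * pd i (Pm yb a) u"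
    by (rule pd_mult[OF ck_sigma ck_U1[OF ck_Pm] u])
  finally show ?thesis .
qed

text \<open>By \<open>basic_Pm\<close> the rate of M^b_b along a line is \<open>\<sigma>\<close>
  times that of M^b_a. The entries have the same ratio, so their quotient \<open>\<sigma>\<close>
  has rate zero.\<close>

lemma basic_sigma: "basic \<sigma>"
  unfolding basic_def
proof (intro conjI allI ballI ck_sigma)
  fix u assume u: "u \<in> U1"
  define m where "m = Pm yb a u"
  have m: "m \<noteq> 0" using u by (simp add: U1_def m_def)
  have "b \<noteq> a" using ab by simp
  have eb: "(pd ya \<sigma> u * m + \<sigma> u * pd ya (Pm yb a) u) + \<sigma> u * (pd yb \<sigma> u * m + \<sigma> u * pd yb (Pm yb a) u) =
      - (pd yb \<sigma> u * (\<sigma> u * m)) - \<sigma> u * pd yb (X Cx) u"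
    using basic_Pm[OF u, of yb b] \<open>b \<noteq> a\<close> unfolding pd_sigma_Pm[OF u] sigma_Pm[OF u] m_def[symmetric] by simp
  have ea: "pd ya (Pm yb a) u + \<sigma> u * pd yb (Pm yb a) u = - (pd yb \<sigma> u * m) - pd yb (X Cx) u"
    using basic_Pm[OF u, of yb a] by (simp add: m_def)
  have "(pd ya \<sigma> u + \<sigma> u * pd yb \<sigma> u) * m = (- (pd yb \<sigma> u * (\<sigma> u * m)) - \<sigma> u * pd yb (X Cx) u)
      - \<sigma> u * (pd ya (Pm yb a) u + \<sigma> u * pd yb (Pm yb a) u)"
    using eb by (simp add: algebra_simps)
  also have "\<dots> = 0" unfolding ea by (simp add: algebra_simps)
  finally show "pd ya \<sigma> u = - (\<sigma> u * pd yb \<sigma> u)" using m by (simp add: eq_neg_iff_add_eq_0)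
qed

section \<open>Consequences of condition (ii)\<close>

definition Yf :: "2 \<Rightarrow> jet \<Rightarrow> real" where
  "Yf L u = Pm Cx L u + u ya * Pm (Cy a 0) L u + u yb * Pm (Cy b 0) L u"

definition nf :: "2 \<Rightarrow> jet \<Rightarrow> real" where
  "nf K u = Pm (Cy K 0) b u - \<sigma> u * Pm (Cy K 0) a u"

text \<open>If Q^b were not a multiple of (1, sigma), then (ii) together with the equation of basic
  functions would make the y^1_b-derivatives of \<xi> and \<eta>^0_a vanish, and with them
  M^b_a.\<close>

lemma Q_parallel:
  assumes u: "u \<in> U1"
  shows "Qmat X b b u = \<sigma> u * Qmat X b a u"
proof (rule ccontr)
  assume ne: "Qmat X b b u \<noteq> \<sigma> u * Qmat X b a u"
  have "pd yb f u = 0" if "basic f" "(\<Sum>P\<in>UNIV. Qmat X b P u * pd (Cy P 1) f u) = 0" for f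
  proof -
    have "pd ya f u = - (\<sigma> u * pd yb f u)" using that(1) u by (simp add: basic_def)
    with that(2) have "Qmat X b a u * (- (\<sigma> u * pd yb f u)) + Qmat X b b u * pd yb f u = 0"
      by (simp add: sum_UNIV_2[OF ab])
    then have "(Qmat X b b u - \<sigma> u * Qmat X b a u) * pd yb f u = 0" by (simp add: algebra_simps)
    then show ?thesis using ne by simp
  qed
  then have "pd yb (X Cx) u = 0" "pd yb (X (Cy a 0)) u = 0"
    using basic_components ii_xi[OF U1_U[OF u]] ii_eta[OF U1_U[OF u]] by blast+
  then have "Pm yb a u = 0" by (simp add: Pm_def)
  then show False using u by (simp add: U1_def)
qed

text \<open>The relation Q^b_b - sigma Q^b_a = 0 is evaluated with M^b_b = sigma M^b_a. The
  derivatives \<open>v\<close> along the line satisfy \<open>v i b = \<sigma> u * v i a\<close> and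
  drop out; what remains is M^b_a times the difference of the two sides.\<close>

lemma flow_of_slope:
  assumes u: "u \<in> U1"
  shows "X Cx u * pd Cx \<sigma> u + X (Cy a 0) u * pd (Cy a 0) \<sigma> u + X (Cy b 0) u * pd (Cy b 0) \<sigma> u
    + Yf a u * pd ya \<sigma> u + Yf b u * pd yb \<sigma> u = nf a u + \<sigma> u * nf b u"
proof -
  define m where "m = Pm yb a u"
  have m: "m \<noteq> 0" using u by (simp add: U1_def m_def)
  have ba: "b \<noteq> a" using ab by simp
  define DY where "DY f = X Cx u * pd Cx f u + X (Cy a 0) u * pd (Cy a 0) f u + X (Cy b 0) u * pd (Cy b 0) f u
    + Yf a u * pd ya f u + Yf b u * pd yb f u" for f
  define v where "v i L = pd ya (Pm i L) u + \<sigma> u * pd yb (Pm i L) u" for i L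
  have vv: "v i b = \<sigma> u * v i a" for i
    unfolding v_def basic_Pm[OF u] using ba sigma_Pm[OF u] by (simp add: algebra_simps)
  have Q: "Qmat X b L u = DY (Pm yb L) - m * (v Cx L + Pm (Cy a 0) L u + \<sigma> u * Pm (Cy b 0) L u
     + u ya * v (Cy a 0) L + u yb * v (Cy b 0) L)" for L
    unfolding Qmat_def matrices_Pm sum_UNIV_2[OF ab] sigma_Pm[OF u] m_def[symmetric] DY_def Yf_def v_def
    by (simp add: algebra_simps)
  have DYb: "DY (Pm yb b) = DY \<sigma> * m + \<sigma> u * DY (Pm yb a)"
    unfolding DY_def pd_sigma_Pm[OF u] m_def[symmetric] by (simp add: algebra_simps)
  have "0 = Qmat X b b u - \<sigma> u * Qmat X b a u" using Q_parallel[OF u] by simp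
  also have "\<dots> = m * (DY \<sigma> - (nf a u + \<sigma> u * nf b u))"
    unfolding Q DYb vv nf_def by (simp add: algebra_simps)
  finally show ?thesis using m unfolding DY_def by simp
qed

text \<open>The segment has the fixed slope \<open>\<sigma> w\<close>, whereas \<open>basic\<close>
  refers to the slope at the moving point. The difference of the two slopes solves a homogeneous
  linear equation and vanishes at the start, hence everywhere; then \<open>f\<close> has derivative
  zero along the segment, which stays in \<open>U1\<close> because cubes are convex.\<close>

lemma basic_const_on_lines:
  assumes f: "basic f" and sub: "cube (Jk 1) u0 r \<subseteq> U1" and w: "w \<in> cube (Jk 1) u0 r"
    and v: "w(ya := w ya + h, yb := w yb + h * \<sigma> w) \<in> cube (Jk 1) u0 r"
  shows "f (w(ya := w ya + h, yb := w yb + h * \<sigma> w)) = f w"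
proof -
  define \<gamma> where "\<gamma> \<theta> = w(ya := w ya + \<theta> * h, yb := w yb + \<theta> * (h * \<sigma> w))" for \<theta>
  have y1: "ya \<noteq> yb" using ab by simp
  have \<gamma>B: "\<gamma> \<theta> \<in> U1" if "\<theta> \<in> {0..1}" for \<theta>
  proof -
    let ?v = "w(ya := w ya + h, yb := w yb + h * \<sigma> w)"
    have "(\<lambda>d. w d + \<theta> * (?v d - w d)) \<in> cube (Jk 1) u0 r"
      by (rule cube_convex[OF w v]) (use that in auto)
    moreover have "(\<lambda>d. w d + \<theta> * (?v d - w d)) = \<gamma> \<theta>" using y1 by (auto simp: \<gamma>_def fun_eq_iff)
    ultimately show ?thesis using sub by auto
  qed
  have d\<gamma>: "((\<lambda>\<theta>. g (\<gamma> \<theta>)) has_real_derivative h * (\<sigma> w - \<sigma> (\<gamma> \<theta>)) * pd yb g (\<gamma> \<theta>)) (at \<theta> within {0..1})"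
    if g: "basic g" and \<theta>: "\<theta> \<in> {0..1}" for g \<theta>
  proof -
    have gc: "ck (Suc 0) (Jk 1) U1 g" using g by (simp add: basic_def)
    let ?d = "\<lambda>c. if c = ya then h else if c = yb then h * \<sigma> w else 0"
    have "((\<lambda>\<theta>. g (\<gamma> \<theta>)) has_real_derivative (\<Sum>c\<in>Jk 1. pd c g (\<gamma> \<theta>) * ?d c)) (at \<theta> within {0..1})"
    proof (rule ck1_chain_within[where \<gamma>=\<gamma> and s=\<theta>, OF gc \<gamma>B[OF \<theta>]])
      show "((\<lambda>\<theta>. \<gamma> \<theta> c) has_real_derivative ?d c) (at \<theta> within {0..1})" for c
        unfolding \<gamma>_def using y1 by (cases "c = ya"; cases "c = yb") (auto intro!: derivative_eq_intros)
    qed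
    moreover have "(\<Sum>c\<in>Jk 1. pd c g (\<gamma> \<theta>) * ?d c) = (\<Sum>c\<in>{ya, yb}. pd c g (\<gamma> \<theta>) * ?d c)"
      by (rule sum.mono_neutral_right) auto
    moreover have "(\<Sum>c\<in>{ya, yb}. pd c g (\<gamma> \<theta>) * ?d c) = pd ya g (\<gamma> \<theta>) * h + pd yb g (\<gamma> \<theta>) * (h * \<sigma> w)"
      using y1 by simp
    moreover have "pd ya g (\<gamma> \<theta>) = - (\<sigma> (\<gamma> \<theta>) * pd yb g (\<gamma> \<theta>))" using g \<gamma>B[OF \<theta>] by (simp add: basic_def)
    ultimately show ?thesis by (simp add: algebra_simps)
  qed
  have \<gamma>0: "\<gamma> 0 = w" by (simp add: \<gamma>_def)
  have s: "\<sigma> (\<gamma> \<theta>) - \<sigma> w = 0" if \<theta>: "\<theta> \<in> {0..1}" for \<theta>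
  proof (rule linear_ode_zero[where f="\<lambda>\<theta>. \<sigma> (\<gamma> \<theta>) - \<sigma> w" and t=\<theta> and k="\<lambda>\<theta>. - (h * pd yb \<sigma> (\<gamma> \<theta>))" and l=0 and r=1 and ?t0.0=0])
    have "continuous_on {0..1} (\<lambda>\<theta>. pd yb \<sigma> (\<gamma> \<theta>))"
    proof (rule ck0_continuous_compose[OF ck_pd[OF ck_sigma] \<gamma>B])
      show "continuous_on {0..1} (\<lambda>\<theta>. \<gamma> \<theta> c)" for c
        unfolding \<gamma>_def using y1 by (cases "c = ya"; cases "c = yb") (auto intro!: continuous_intros)
    qed
    then show "continuous_on {0..1} (\<lambda>\<theta>. - (h * pd yb \<sigma> (\<gamma> \<theta>)))" by (intro continuous_intros)
    show "((\<lambda>\<theta>. \<sigma> (\<gamma> \<theta>) - \<sigma> w) has_real_derivative - (h * pd yb \<sigma> (\<gamma> t)) * (\<sigma> (\<gamma> t) - \<sigma> w)) (at t within {0..1})"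
      if "t \<in> {0..1}" for t
      using DERIV_diff[OF d\<gamma>[OF basic_sigma that] DERIV_const[of "\<sigma> w"]] by (simp add: algebra_simps)
  qed (use \<theta> \<gamma>0 in auto)
  have "\<exists>k. \<forall>\<theta>\<in>{0..1}. f (\<gamma> \<theta>) = k"
  proof (rule has_field_derivative_zero_constant)
    show "((\<lambda>\<theta>. f (\<gamma> \<theta>)) has_real_derivative 0) (at \<theta> within {0..1})" if "\<theta> \<in> {0..1}" for \<theta>
      using d\<gamma>[OF f that] s[OF that] by simp
  qed simp
  then have "f (\<gamma> 1) = f (\<gamma> 0)" by auto
  then show ?thesis by (simp add: \<gamma>_def)
qed

end

declare One_nat_def [simp del]

lemma flow_joint_dom_open_depends:
  assumes "finite C"
  shows "open (flow_joint_dom C u r T)" "depends_on (insert None (Some ` C)) (flow_joint_dom C u r T) (\<lambda>_. 0)"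
proof -
  have "open {w::'a option \<Rightarrow> real. \<bar>w None\<bar> < T}"
    by (intro open_Collect_less continuous_intros
        continuous_on_product_then_coordinatewise[OF continuous_on_id])
  moreover have "flow_joint_dom C u r T = {w. w \<circ> Some \<in> cube C u r} \<inter> {w. \<bar>w None\<bar> < T}"
    by (auto simp: flow_joint_dom_def)
  ultimately show "open (flow_joint_dom C u r T)" using open_flow_dom0[OF assms] by (simp add: open_Int)
  show "depends_on (insert None (Some ` C)) (flow_joint_dom C u r T) (\<lambda>_. 0)"
    by (rule depends_on_zeroI) (auto simp: flow_joint_dom_def cube_def)
qed

section \<open>The flow on the space of lines\<close>

locale lb_point = lb_field +
  fixes u0 :: jet and \<rho> :: real
  assumes \<rho>: "\<rho> > 0" and cube_U1: "cube (Jk 1) u0 \<rho> \<subseteq> U1"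
begin

abbreviation B where "B \<equiv> cube (Jk 1) u0 \<rho>"

abbreviation q where "q \<equiv> u0 ya"

text \<open>The lines are parametrized by their intersection with the slice \<open>y\<^sup>1\<^sub>a = q\<close>, on which \<open>C\<close> is a
  system of coordinates; \<open>S\<close> moves a point into the slice and ignores its coordinate \<open>y\<^sup>1\<^sub>a\<close>, and
  \<open>S (Z u)\<close> is the intersection of the line through \<open>u\<close> with the slice.\<close>

definition C :: "coord set" where "C = {Cx, Cy a 0, Cy b 0, yb}"

definition S :: "jet \<Rightarrow> jet" where "S u = u(ya := q)"

definition z :: "jet \<Rightarrow> real" where "z u = u yb - \<sigma> u * (u ya - q)"

definition Z :: "jet \<Rightarrow> jet" where "Z u = u(yb := z u)"

definition V :: field where
  "V c = (\<lambda>u. if c = yb then Yf b (S u) - \<sigma> (S u) * Yf a (S u) else X c (S u))"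

lemma finite_C: "finite C"
  by (simp add: C_def)

lemma two_cases: "L = a \<or> L = b"
  using UNIV_2_eq[OF ab] by auto

lemma Jk_C: "Jk 1 = insert ya C"
proof -
  have "c \<in> Jk 1 \<longleftrightarrow> c \<in> insert ya C" for c
    using two_cases ab by (cases c) (auto simp: C_def less_Suc_eq le_Suc_eq)
  then show ?thesis by blast
qed

lemma ya_C: "ya \<notin> C"
  using ab by (simp add: C_def)

lemma sum_C: "(\<Sum>d\<in>C. f d) = f Cx + f (Cy a 0) + f (Cy b 0) + f yb"
  using ab by (simp add: C_def add.assoc)

lemma S_cube: "u \<in> cube C u0 \<rho> \<Longrightarrow> S u \<in> B"
  using ya_C \<rho> by (auto simp: S_def cube_def Jk_C)

lemma open_depends_cubeC: "open (cube C u0 r)" "depends_on C (cube C u0 r) (\<lambda>_. 0)"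
  by (rule open_cube[OF finite_C], rule depends_cube[OF subset_refl])

lemma ck_S:
  assumes f: "ck n (Jk 1) U1 f"
  shows "ck n C (cube C u0 \<rho>) (\<lambda>u. f (S u))"
proof -
  have "ck n C (cube C u0 \<rho>) (\<lambda>u. f (\<lambda>c. if c = ya then q else u c))"
  proof (rule ck_compose[OF f _ finite_C open_depends_cubeC])
    fix c assume "c \<in> Jk 1"
    then show "ck n C (cube C u0 \<rho>) (\<lambda>u. if c = ya then q else u c)"
      by (cases "c = ya")
        (simp_all add: Jk_C ck_const[OF finite_C open_depends_cubeC] ck_coord[OF finite_C open_depends_cubeC])
  next
    fix u assume "u \<in> cube C u0 \<rho>"
    from S_cube[OF this] cube_U1 show "(\<lambda>c. if c = ya then q else u c) \<in> U1"
      by (auto simp: S_def fun_upd_def)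
  qed
  then show ?thesis by (simp add: S_def fun_upd_def)
qed

lemma pd_S: "d \<noteq> ya \<Longrightarrow> pd d (\<lambda>u. f (S u)) u = pd d f (S u)"
  by (simp add: pd_def S_def fun_upd_twist)

lemma ck_X: "c \<in> C \<Longrightarrow> c \<noteq> yb \<Longrightarrow> ck n (Jk 1) U (X c)"
  using ck_xi ck_eta by (auto simp: C_def)

lemma ck_Yf: "ck n (Jk 1) U1 (Yf L)"
  unfolding Yf_def[abs_def]
  by (intro ck_U1 ck_add ck_mult ck_Pm ck_coord[OF finite_Jk openU depU]) simp_all

lemma ck_nf: "ck n (Jk 1) U1 (nf L)"
  unfolding nf_def[abs_def] by (intro ck_diff ck_mult ck_sigma ck_U1[OF ck_Pm])

lemma ck_V:
  assumes c: "c \<in> C"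
  shows "ck n C (cube C u0 \<rho>) (V c)"
proof (cases "c = yb")
  case True
  have "ck n C (cube C u0 \<rho>) (\<lambda>u. Yf b (S u) - \<sigma> (S u) * Yf a (S u))"
    by (intro ck_diff ck_mult ck_S ck_Yf ck_sigma)
  then show ?thesis using True by (simp add: V_def)
next
  case False
  then show ?thesis using ck_S[OF ck_U1[OF ck_X[OF c]]] by (simp add: V_def)
qed

lemma ck_Z:
  assumes "c \<in> C"
  shows "ck n (Jk 1) U1 (\<lambda>u. Z u c)"
proof -
  have k: "ck n (Jk 1) U1 (\<lambda>u. u d)" if "d \<in> Jk 1" for d by (rule ck_coord[OF finite_Jk U1_dom that])
  show ?thesis
  proof (cases "c = yb")
    case True
    have "ck n (Jk 1) U1 z" unfolding z_def[abs_def]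
      by (intro ck_diff ck_mult ck_sigma k ck_const[OF finite_Jk U1_dom]) simp_all
    then show ?thesis using True by (simp add: Z_def)
  next
    case False
    then show ?thesis using k[of c] assms by (simp add: Z_def Jk_C)
  qed
qed

text \<open>\<open>S (Z u)\<close> is reached from \<open>u\<close> along its line by the step
  \<open>q - u ya\<close>; the hypothesis on \<open>Z u\<close> puts this end point into
  \<open>B\<close>.\<close>

lemma basic_S_Z:
  assumes f: "basic f" and u: "u \<in> B" and Zu: "Z u \<in> cube C u0 \<rho>"
  shows "f (S (Z u)) = f u"
proof -
  have "S (Z u) = u(ya := u ya + (q - u ya), yb := u yb + (q - u ya) * \<sigma> u)"
    using ab by (auto simp: S_def Z_def z_def fun_eq_iff algebra_simps)
  moreover have "S (Z u) \<in> B" by (rule S_cube[OF Zu])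
  ultimately show ?thesis using basic_const_on_lines[OF f cube_U1 u, of "q - u ya"] by simp
qed

end

locale lb_flow = lb_point +
  fixes r R T :: real and \<phi> :: "real \<Rightarrow> jet \<Rightarrow> jet"
  assumes LB: "Lie_Backlund_on U X"
    and rR: "r \<le> R" and T0: "0 < T" and R\<rho>: "cube C u0 R \<subseteq> cube C u0 \<rho>"
    and flow_ck: "c \<in> C \<Longrightarrow> ck n (insert None (Some ` C)) (flow_joint_dom C u0 r T) (\<lambda>w. \<phi> (w None) (w \<circ> Some) c)"
    and flow_zero: "P \<in> cube C u0 r \<Longrightarrow> c \<in> C \<Longrightarrow> \<phi> 0 P c = P c"
    and flow_cube: "P \<in> cube C u0 r \<Longrightarrow> \<bar>t\<bar> < T \<Longrightarrow> \<phi> t P \<in> cube C u0 R"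
    and flow_der: "P \<in> cube C u0 r \<Longrightarrow> \<bar>t\<bar> < T \<Longrightarrow> c \<in> C \<Longrightarrow>
      ((\<lambda>t. \<phi> t P c) has_real_derivative V c (\<phi> t P)) (at t)"
    and flow_grp: "P \<in> cube C u0 r \<Longrightarrow> \<bar>s\<bar> < T \<Longrightarrow> \<bar>t\<bar> < T \<Longrightarrow> \<phi> s P \<in> cube C u0 r \<Longrightarrow> c \<in> C \<Longrightarrow>
      \<phi> t (\<phi> s P) c = \<phi> (t + s) P c"
begin

text \<open>The two conditions on \<open>u\<close> together keep the segment from \<open>u\<close>
  to the slice inside \<open>B\<close>; the radius \<open>r\<close> makes the orbit of
  \<open>Z u\<close> under \<open>\<phi>\<close> available.\<close>

definition D :: "(real \<times> jet) set" where
  "D = {(t, u). \<bar>t\<bar> < T \<and> u \<in> B \<and> Z u \<in> cube C u0 r}"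

definition h :: "coord \<Rightarrow> real \<Rightarrow> jet \<Rightarrow> real" where
  "h c t u = \<phi> t (Z u) c"

lemma cuber: "cube C u0 r \<subseteq> cube C u0 \<rho>"
  using cube_subset[OF rR] R\<rho> by blast

text \<open>Components of \<open>\<phi>\<close> outside \<open>C\<close> carry no information, so
  states can be compared on \<open>C\<close> only, and the flow has to be insensitive to the other
  coordinates.\<close>

lemma flow_local: "P \<in> cube C u0 r \<Longrightarrow> \<bar>t\<bar> < T \<Longrightarrow> c \<in> C \<Longrightarrow> (\<And>d. d \<in> C \<Longrightarrow> P d = P' d) \<Longrightarrow> \<phi> t P' c = \<phi> t P c"
proof -
  assume P: "P \<in> cube C u0 r" "\<bar>t\<bar> < T" and c: "c \<in> C" and e: "\<And>d. d \<in> C \<Longrightarrow> P d = P' d"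
  have "at_time t P \<in> flow_joint_dom C u0 r T" using P by (simp add: flow_joint_dom_def)
  then have "(\<lambda>w. \<phi> (w None) (w \<circ> Some) c) (at_time t P') = (\<lambda>w. \<phi> (w None) (w \<circ> Some) c) (at_time t P)"
    by (rule depends_onD(2)[OF ck_depends[OF flow_ck[OF c]]]) (use e in auto)
  then show "\<phi> t P' c = \<phi> t P c" by simp
qed

lemma ck_lift_time:
  assumes f: "ck n (Jk 1) U1 f"
  shows "ck n (insert None (Some ` Jk 1)) (flow_joint_dom (Jk 1) u0 \<rho> T) (\<lambda>w. f (w \<circ> Some))"
  unfolding comp_def
proof (rule ck_compose[OF f _ _ flow_joint_dom_open_depends[OF finite_Jk]])
  show fin: "finite (insert None (Some ` Jk 1))" by simp
  show "ck n (insert None (Some ` Jk 1)) (flow_joint_dom (Jk 1) u0 \<rho> T) (\<lambda>w. w (Some c))" if "c \<in> Jk 1" for c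
    by (rule ck_coord[OF fin flow_joint_dom_open_depends[OF finite_Jk]]) (use that in simp)
  show "(\<lambda>c. w (Some c)) \<in> U1" if "w \<in> flow_joint_dom (Jk 1) u0 \<rho> T" for w
    using that cube_U1 by (auto simp: flow_joint_dom_def comp_def)
qed

lemma joint_dom_D:
  "joint_dom D = {w \<in> flow_joint_dom (Jk 1) u0 \<rho> T. (\<lambda>c. Z (w \<circ> Some) c) \<in> cube C u0 r}"
  by (auto simp: joint_dom_def D_def flow_joint_dom_def)

lemma D_dom: "open (joint_dom D)" "depends_on (insert None (Some ` Jk 1)) (joint_dom D) (\<lambda>_. 0)"
  unfolding joint_dom_D
  by (rule open_depends_vimage[OF open_depends_cubeC flow_joint_dom_open_depends[OF finite_Jk]
        ck_continuous[OF ck_lift_time[OF ck_Z]] ck_depends[OF ck_lift_time[OF ck_Z]]]; assumption)+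

lemma tck_h:
  assumes c: "c \<in> C"
  shows "tck n (Jk 1) D (h c)"
proof -
  let ?F = "insert None (Some ` Jk 1)"
  have fin: "finite ?F" by simp
  have "ck n ?F (joint_dom D) (\<lambda>w. (\<lambda>w. \<phi> (w None) (w \<circ> Some) c) (\<lambda>k. at_time (w None) (Z (w \<circ> Some)) k))"
  proof (rule ck_compose[OF flow_ck[OF c] _ fin D_dom])
    fix k assume "k \<in> insert None (Some ` C)"
    then consider "k = None" | d where "k = Some d" "d \<in> C" by blast
    then show "ck n ?F (joint_dom D) (\<lambda>w. at_time (w None) (Z (w \<circ> Some)) k)"
    proof cases
      case 1
      then show ?thesis by (simp add: ck_coord[OF fin D_dom])
    next
      case 2
      have "ck n ?F (joint_dom D) (\<lambda>w. Z (w \<circ> Some) d)"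
        by (rule ck_subset[OF ck_lift_time[OF ck_Z[OF 2(2)]] _ D_dom]) (auto simp: joint_dom_D)
      then show ?thesis using 2 by simp
    qed
  next
    fix w assume "w \<in> joint_dom D"
    then show "(\<lambda>k. at_time (w None) (Z (w \<circ> Some)) k) \<in> flow_joint_dom C u0 r T"
      by (simp add: joint_dom_D flow_joint_dom_def)
  qed
  then show ?thesis unfolding tck_def joint_def[abs_def] h_def by simp
qed

lemma D_time: "(t, u) \<in> D \<Longrightarrow> \<bar>s\<bar> < T \<Longrightarrow> (s, u) \<in> D"
  by (simp add: D_def)

lemma D_facts:
  assumes "(t, u) \<in> D"
  shows "\<bar>t\<bar> < T" "u \<in> B" "Z u \<in> cube C u0 r" "\<phi> t (Z u) \<in> cube C u0 \<rho>" "S (\<phi> t (Z u)) \<in> B"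
proof -
  show a: "\<bar>t\<bar> < T" "u \<in> B" "Z u \<in> cube C u0 r" using assms by (auto simp: D_def)
  show "\<phi> t (Z u) \<in> cube C u0 \<rho>" using flow_cube[OF a(3,1)] R\<rho> by blast
  then show "S (\<phi> t (Z u)) \<in> B" by (rule S_cube)
qed

text \<open>The equation for \<open>h\<close> holds on an open set of points. Applying the total
  derivative, which commutes with d/dt, produces the linearized equation.\<close>

lemma total_deriv_h_der:
  assumes tu: "(t, u) \<in> D" and c: "c \<in> C"
  shows "((\<lambda>t. total_deriv (h c t) u) has_real_derivative
    (\<Sum>d\<in>C. pd d (V c) (\<phi> t (Z u)) * total_deriv (h d t) u)) (at t)"
proof -
  have "total_deriv (\<lambda>v. pd None (joint (h c)) (at_time t v)) u = total_deriv (\<lambda>v. V c (\<lambda>d. h d t v)) u"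
  proof (rule total_deriv_cong[OF slice_open_depends(1)[OF D_dom]])
    show "u \<in> slice D t" using tu by (simp add: slice_def)
    fix v assume "v \<in> slice D t"
    then have v: "(t, v) \<in> D" by (simp add: slice_def)
    show "pd None (joint (h c)) (at_time t v) = V c (\<lambda>d. h d t v)"
    proof (rule pd_eqI)
      show "((\<lambda>s. joint (h c) ((at_time t v)(None := s))) has_real_derivative V c (\<lambda>d. h d t v)) (at (at_time t v None))"
        using flow_der[OF D_facts(3,1)[OF v] c] by (simp add: at_time_upd h_def)
    qed
  qed
  also have "\<dots> = (\<Sum>d\<in>C. pd d (V c) (\<lambda>d. h d t u) * total_deriv (h d t) u)"
  proof (rule total_deriv_compose[OF ck_V[OF c] finite_Jk tck_slice[OF tck_h] slice_open_depends[OF D_dom]])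
    show "u \<in> slice D t" using tu by (simp add: slice_def)
    show "(\<lambda>d. h d t u) \<in> cube C u0 \<rho>" using D_facts(4)[OF tu] by (simp add: h_def)
  qed
  finally show ?thesis using total_deriv_time[OF tck_h[OF c] tu] by (simp add: h_def)
qed

definition E :: "coord \<Rightarrow> real \<Rightarrow> jet \<Rightarrow> real" where
  "E c t u = total_deriv (h c t) u"

lemma E_zero:
  assumes u: "(0, u) \<in> D"
  shows "E Cx 0 u = 1" "E (Cy L 0) 0 u = u (Cy L 1)"
proof -
  have "E c 0 u = shift c u" if c: "c \<in> C" "c \<noteq> yb" for c
  proof -
    have "E c 0 u = total_deriv (\<lambda>v. v c) u"
      unfolding E_def
    proof (rule total_deriv_cong[OF slice_open_depends(1)[OF D_dom]])
      show "u \<in> slice D 0" using u by (simp add: slice_def)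
      show "h c 0 v = v c" if "v \<in> slice D 0" for v
        using flow_zero[of "Z v" c] that c by (simp add: slice_def D_def h_def Z_def)
    qed
    then show ?thesis by (simp add: total_deriv_coord)
  qed
  then show "E Cx 0 u = 1" "E (Cy L 0) 0 u = u (Cy L 1)"
    using two_cases[of L] by (auto simp: C_def simp flip: One_nat_def)
qed

text \<open>The contact condition: the defect of the prolonged point from the line through
  \<open>S (\<phi> t (Z u))\<close>, cleared of denominators, solves a homogeneous linear equation.\<close>

lemma contact_defect_zero:
  assumes su: "(s, u) \<in> D"
  shows "E (Cy b 0) s u - \<phi> s (Z u) yb * E Cx s u - \<sigma> (S (\<phi> s (Z u))) * (E (Cy a 0) s u - q * E Cx s u) = 0"
proof -
  define m where "m = \<bar>s\<bar>"
  have tD: "(t, u) \<in> D" if "t \<in> {-m..m}" for t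
    by (rule D_time[OF su]) (use D_facts(1)[OF su] that in \<open>auto simp: m_def\<close>)
  define w where "w t = S (\<phi> t (Z u))" for t
  define f where "f t = E (Cy b 0) t u - \<phi> t (Z u) yb * E Cx t u - \<sigma> (w t) * (E (Cy a 0) t u - q * E Cx t u)" for t
  have "f s = 0"
  proof (rule linear_ode_zero[where f=f and t=s and k="\<lambda>t. nf b (w t)" and l="-m" and r=m and ?t0.0=0])
    show "0 \<in> {-m..m}" "s \<in> {-m..m}" by (auto simp: m_def)
    have D0: "(0, u) \<in> D" using tD[of 0] by (simp add: m_def)
    have "Z u \<in> cube C u0 \<rho>" using D_facts(3)[OF D0] cuber by blast
    from basic_S_Z[OF basic_sigma D_facts(2)[OF D0] this] have sZ: "\<sigma> (S (Z u)) = \<sigma> u" .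
    have "\<sigma> (S (\<phi> 0 (Z u))) = \<sigma> (S (Z u))"
    proof (rule depends_onD(2)[OF ck_depends[OF ck_S[OF ck_sigma]]])
      show "Z u \<in> cube C u0 \<rho>" by fact
      show "Z u d = \<phi> 0 (Z u) d" if "d \<in> C" for d using flow_zero[OF D_facts(3)[OF D0] that] by simp
    qed
    moreover have "\<phi> 0 (Z u) yb = z u" using flow_zero[OF D_facts(3)[OF D0], of yb] by (simp add: C_def Z_def)
    \<comment> \<open>At time zero the defect is y^1_b - z - sigma (y^1_a - q), which is zero by the
      definition of \<open>z\<close>.\<close>
    ultimately show "f 0 = 0" using sZ by (simp add: f_def w_def E_zero[OF D0] z_def)
    show "continuous_on {-m..m} (\<lambda>t. nf b (w t))"
      unfolding w_def
    proof (rule ck0_continuous_compose[OF ck_S[OF ck_nf]])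
      show "\<phi> t (Z u) \<in> cube C u0 \<rho>" if "t \<in> {-m..m}" for t by (rule D_facts(4)[OF tD[OF that]])
      show "continuous_on {-m..m} (\<lambda>t. \<phi> t (Z u) d)" if "d \<in> C" for d
        by (rule DERIV_continuous_on, rule has_field_derivative_at_within, rule flow_der)
          (use that D_facts[OF tD] in blast)+
    qed
    fix t assume "t \<in> {-m..m}"
    then have t: "(t, u) \<in> D" by (rule tD)
    note F = D_facts[OF t]
    have wU1: "w t \<in> U1" using F(5) cube_U1 by (auto simp: w_def)
    have wy: "w t ya = q" "w t yb = \<phi> t (Z u) yb" using ab by (auto simp: w_def S_def)
    have dne: "d \<noteq> ya" if "d \<in> C" for d using that ya_C by auto
    define x where "x d = E d t u" for d
    define px where "px d = pd d (X Cx) (w t)" for d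
    have pXV: "pd d (V c) (\<phi> t (Z u)) = pd d (X c) (w t)" if "d \<in> C" "c \<noteq> yb" for c d
      using pd_S[OF dne[OF that(1)], of "X c"] that(2) by (simp add: V_def w_def)
    have dEx: "((\<lambda>t. E Cx t u) has_real_derivative (\<Sum>d\<in>C. px d * x d)) (at t)"
      using total_deriv_h_der[OF t, of Cx] pXV[of _ Cx] by (simp add: C_def E_def x_def px_def)
    have dE: "((\<lambda>t. E (Cy L 0) t u) has_real_derivative (\<Sum>d\<in>C. (Pm d L (w t) + w t (Cy L 1) * px d) * x d)) (at t)" for L
      using total_deriv_h_der[OF t, of "Cy L 0"] pXV[of _ "Cy L 0"] two_cases[of L]
      by (auto simp: C_def E_def x_def px_def Pm_def)
    have dz: "((\<lambda>t. \<phi> t (Z u) yb) has_real_derivative Yf b (w t) - \<sigma> (w t) * Yf a (w t)) (at t)"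
      using flow_der[OF F(3,1), of yb] by (simp add: C_def V_def w_def)
    have "((\<lambda>t. \<sigma> (w t)) has_real_derivative (\<Sum>d\<in>C. pd d (\<lambda>u. \<sigma> (S u)) (\<phi> t (Z u)) * V d (\<phi> t (Z u)))) (at t)"
      unfolding w_def
      by (rule ck1_chain_within[where \<gamma>="\<lambda>t. \<phi> t (Z u)" and s=t, OF ck_S[OF ck_sigma] F(4) flow_der[OF F(3,1)]])
    moreover have "(\<Sum>d\<in>C. pd d (\<lambda>u. \<sigma> (S u)) (\<phi> t (Z u)) * V d (\<phi> t (Z u))) = (\<Sum>d\<in>C. pd d \<sigma> (w t) * V d (\<phi> t (Z u)))"
      by (rule sum.cong[OF refl]) (simp add: pd_S[OF dne] w_def)
    moreover have "(\<Sum>d\<in>C. pd d \<sigma> (w t) * V d (\<phi> t (Z u))) = nf a (w t) + \<sigma> (w t) * nf b (w t)"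
    proof -
      \<comment> \<open>\<open>flow_of_slope\<close> contains the rates of y^1_a and y^1_b
        separately, while on the slice the only rate is Y_b - sigma Y_a. The two expressions agree
        because \<open>\<sigma>\<close> is basic.\<close>
      have "pd ya \<sigma> (w t) = - (\<sigma> (w t) * pd yb \<sigma> (w t))" using basic_sigma wU1 by (simp add: basic_def)
      then show ?thesis
        using flow_of_slope[OF wU1] unfolding sum_C by (simp add: V_def w_def[symmetric] algebra_simps)
    qed
    ultimately have ds: "((\<lambda>t. \<sigma> (w t)) has_real_derivative nf a (w t) + \<sigma> (w t) * nf b (w t)) (at t)" by simp
    have "(f has_real_derivative
        ((\<Sum>d\<in>C. (Pm d b (w t) + w t yb * px d) * x d)
        - ((Yf b (w t) - \<sigma> (w t) * Yf a (w t)) * x Cx + (\<Sum>d\<in>C. px d * x d) * w t yb)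
        - ((nf a (w t) + \<sigma> (w t) * nf b (w t)) * (x (Cy a 0) - q * x Cx)
           + ((\<Sum>d\<in>C. (Pm d a (w t) + w t ya * px d) * x d) - q * (\<Sum>d\<in>C. px d * x d)) * \<sigma> (w t)))) (at t)"
      unfolding f_def[abs_def]
      using DERIV_diff[OF DERIV_diff[OF dE[of b] DERIV_mult[OF dz dEx]]
          DERIV_mult[OF ds DERIV_diff[OF dE[of a] DERIV_cmult[OF dEx, of q]]]]
      by (simp add: x_def wy)
    \<comment> \<open>The terms with \<open>px\<close> cancel since y^1_a = q at \<open>w t\<close>,
      those with \<open>x yb\<close> cancel by \<open>sigma_Pm\<close>, and those with
      \<open>nf a\<close> cancel by the rate of \<open>\<sigma>\<close>. A multiple of the defect by
      \<open>nf b\<close> remains.\<close>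
    also have "((\<Sum>d\<in>C. (Pm d b (w t) + w t yb * px d) * x d)
        - ((Yf b (w t) - \<sigma> (w t) * Yf a (w t)) * x Cx + (\<Sum>d\<in>C. px d * x d) * w t yb)
        - ((nf a (w t) + \<sigma> (w t) * nf b (w t)) * (x (Cy a 0) - q * x Cx)
           + ((\<Sum>d\<in>C. (Pm d a (w t) + w t ya * px d) * x d) - q * (\<Sum>d\<in>C. px d * x d)) * \<sigma> (w t)))
       = nf b (w t) * (x (Cy b 0) - w t yb * x Cx - \<sigma> (w t) * (x (Cy a 0) - q * x Cx))"
      unfolding sum_C Yf_def nf_def sigma_Pm[OF wU1] wy(1) by (simp add: algebra_simps)
    also have "x (Cy b 0) - w t yb * x Cx - \<sigma> (w t) * (x (Cy a 0) - q * x Cx) = f t"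
      by (simp add: f_def x_def wy(2))
    finally have "(f has_real_derivative nf b (w t) * f t) (at t)" .
    then show "(f has_real_derivative nf b (w t) * f t) (at t within {-m..m})"
      by (rule has_field_derivative_at_within)
  qed
  then show ?thesis by (simp add: f_def w_def)
qed

abbreviation \<Psi> where "\<Psi> \<equiv> prolonged (h Cx) (\<lambda>L. h (Cy L 0))"

text \<open>Divided by the total derivative of the first component,
  \<open>contact_defect_zero\<close> says that the prolonged point lies on the line through
  \<open>S (\<phi> s (Z u))\<close>. As \<open>\<sigma>\<close> is constant on this line inside
  \<open>B\<close>, \<open>Z\<close> leads back to \<open>\<phi> s (Z u)\<close>.\<close>

lemma Z_prolonged:
  assumes su: "(s, u) \<in> D" and nz: "total_deriv (h Cx s) u \<noteq> 0" and v: "\<Psi> s u \<in> B" and d: "d \<in> C"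
  shows "Z (\<Psi> s u) d = \<phi> s (Z u) d"
proof -
  define v where "v = \<Psi> s u"
  define w where "w = S (\<phi> s (Z u))"
  note F = D_facts[OF su]
  have vy1: "v (Cy L 1) = E (Cy L 0) s u / E Cx s u" for L
  proof -
    have "prolong (h Cx) (\<lambda>L. h (Cy L 0)) 0 L s = h (Cy L 0) s" by (simp add: fun_eq_iff)
    then show ?thesis by (simp add: v_def prolonged_simps E_def One_nat_def)
  qed
  have v0: "v Cx = \<phi> s (Z u) Cx" "v (Cy L 0) = \<phi> s (Z u) (Cy L 0)" for L
    by (simp_all add: v_def prolonged_simps h_def)
  have E0: "E Cx s u \<noteq> 0" using nz by (simp add: E_def)
  have "E (Cy b 0) s u = \<phi> s (Z u) yb * E Cx s u + \<sigma> w * (E (Cy a 0) s u - q * E Cx s u)"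
    using contact_defect_zero[OF su] by (simp add: w_def)
  then have vb: "v yb = \<phi> s (Z u) yb + \<sigma> w * (v ya - q)"
    unfolding vy1 using E0 by (simp add: field_simps)
  \<comment> \<open>The point of the line through \<open>w\<close> that has the same y^1_a as
    \<open>v\<close>; by \<open>vb\<close> it agrees with \<open>v\<close> in all coordinates of
    order at most one.\<close>
  define w' where "w' = w(ya := w ya + (v ya - q), yb := w yb + (v ya - q) * \<sigma> w)"
  have "w' c = v c" if "c \<in> Jk 1" for c
    using that ab v0 vb by (auto simp: Jk_C C_def w'_def w_def S_def algebra_simps)
  then have w'v: "\<And>c. c \<in> Jk 1 \<Longrightarrow> v c = w' c" by simp
  have vB: "v \<in> B" using v by (simp add: v_def)
  then have w'B: "w' \<in> B" using w'v by (simp add: cube_def)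
  have "\<sigma> w' = \<sigma> w"
    unfolding w'_def by (rule basic_const_on_lines[OF basic_sigma cube_U1]) (use F(5) w'B in \<open>simp_all add: w_def w'_def\<close>)
  moreover have "\<sigma> w' = \<sigma> v"
    by (rule depends_onD(2)[OF ck_depends[OF ck_sigma] _ w'v]) (use vB cube_U1 in auto)
  ultimately have "z v = \<phi> s (Z u) yb" using vb by (simp add: z_def)
  then show ?thesis using d v0 by (auto simp: C_def Z_def v_def[symmetric])
qed

text \<open>The components of the field are basic, so they agree at \<open>u\<close> and at the
  intersection of its line with the slice. This yields the initial velocity of the flow.\<close>

lemma V_component:
  assumes "(0, u) \<in> D" and c: "c \<in> C" "c \<noteq> yb"
  shows "V c (\<phi> 0 (Z u)) = X c u"
proof -
  note F = D_facts[OF assms(1)]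
  have Zr: "Z u \<in> cube C u0 \<rho>" using F(3) cuber by blast
  have "V c (\<phi> 0 (Z u)) = V c (Z u)"
    by (rule depends_onD(2)[OF ck_depends[OF ck_V[OF c(1)]] Zr]) (use flow_zero[OF F(3)] in simp)
  also have "\<dots> = X c (S (Z u))" using c by (simp add: V_def)
  also have "\<dots> = X c u"
    by (rule basic_S_Z[OF _ F(2) Zr]) (use c basic_components in \<open>auto simp: C_def\<close>)
  finally show ?thesis .
qed

lemma C_simps: "Cx \<in> C" "Cy L 0 \<in> C" "Cx \<noteq> yb" "Cy L 0 \<noteq> yb"
  using two_cases[of L] by (auto simp: C_def)

lemma flow_group:
  assumes su: "(s, u) \<in> D" and nz: "total_deriv (h Cx s) u \<noteq> 0" and t: "(t, \<Psi> s u) \<in> D" and c: "c \<in> C"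
  shows "h c t (\<Psi> s u) = h c (t + s) u"
proof -
  note F = D_facts[OF su] and G = D_facts[OF t]
  note e = Z_prolonged[OF su nz G(2)]
  have "\<phi> s (Z u) \<in> cube C u0 r"
    by (rule depends_onD(1)[OF open_depends_cubeC(2) G(3)]) (rule e)
  from flow_grp[OF F(3,1) G(1) this c] show ?thesis
    unfolding h_def[of c t "\<Psi> s u"] h_def[of c "t + s" u] using flow_local[OF G(3,1) c, of "\<phi> s (Z u)"] e by simp
qed

sublocale point_flow U X D "h Cx" "\<lambda>L. h (Cy L 0)" a "\<bar>q\<bar> + \<rho>"
proof
  show "tck n (Jk 1) D (h Cx)" "tck n (Jk 1) D (h (Cy L 0))" for n L by (rule tck_h[OF C_simps(1)], rule tck_h[OF C_simps(2)])
  show "u \<in> U" if "(t, u) \<in> D" for t u using D_facts(2)[OF that] cube_U1 U1_U by blast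
  show "Lie_Backlund_on U X" by (rule LB)
  show "open U" by (rule openU)
  have z: "h c 0 u = u c" if "(0, u) \<in> D" "c \<in> C" "c \<noteq> yb" for c u
    using flow_zero[OF D_facts(3)[OF that(1)] that(2)] that(3) by (simp add: h_def Z_def)
  show "h Cx 0 u = u Cx" "h (Cy L 0) 0 u = u (Cy L 0)" if "(0, u) \<in> D" for u L
    using z[OF that] C_simps by blast+
  have d: "((\<lambda>t. h c t u) has_real_derivative X c u) (at 0)" if "(0, u) \<in> D" "c \<in> C" "c \<noteq> yb" for c u
    using flow_der[OF D_facts(3,1)[OF that(1)] that(2)] V_component[OF that] by (simp add: h_def)
  show "((\<lambda>t. h Cx t u) has_real_derivative X Cx u) (at 0)" "((\<lambda>t. h (Cy L 0) t u) has_real_derivative X (Cy L 0) u) (at 0)"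
    if "(0, u) \<in> D" for u L
    using d[OF that] C_simps by blast+
  show "h Cx t (\<Psi> s u) = h Cx (t + s) u" "h (Cy L 0) t (\<Psi> s u) = h (Cy L 0) (t + s) u"
    if "(s, u) \<in> D" "total_deriv (h Cx s) u \<noteq> 0" "(t, \<Psi> s u) \<in> D" "(t + s, u) \<in> D" for s t u L
    using flow_group[OF that(1-3)] C_simps by blast+
  show "\<bar>u ya\<bar> \<le> \<bar>q\<bar> + \<rho>" if "(t, u) \<in> D" for t u
  proof -
    have "\<bar>u ya - q\<bar> < \<rho>" using D_facts(2)[OF that] by (simp add: cube_def)
    then show ?thesis by linarith
  qed
qed

end

theorem (in lb_field) exponentiable_near:
  assumes LB: "Lie_Backlund_on U X" and u0: "u0 \<in> U1"
  shows "\<exists>W \<Phi> N. exponentiable_to U X W \<Phi> \<and> open N \<and> depends_on (Jk 1) N (\<lambda>_. 0) \<and> u0 \<in> N \<and> N \<subseteq> flow_dom W \<and>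
    depends_on_time_and (Jk 1) (W Cx) (\<lambda>t u. \<Phi> t u Cx) \<and>
    (\<forall>L. depends_on_time_and (Jk 1) (W (Cy L 0)) (\<lambda>t u. \<Phi> t u (Cy L 0)))"
proof -
  obtain \<rho> where \<rho>: "\<rho> > 0" "cube (Jk 1) u0 \<rho> \<subseteq> U1"
    using open_contains_cube[OF U1_dom(1) finite_Jk U1_dom(2) u0] by blast
  interpret lb_point U X a b u0 \<rho> by unfold_locales (fact \<rho>)+
  have u0C: "u0 \<in> cube C u0 \<rho>" using \<rho>(1) by (simp add: cube_def)
  obtain R r T \<phi> where fl: "0 < r" "r \<le> R" "0 < T" "cube C u0 R \<subseteq> cube C u0 \<rho>"
    "\<forall>n. \<forall>c\<in>C. ck n (insert None (Some ` C)) (flow_joint_dom C u0 r T) (\<lambda>w. \<phi> (w None) (w \<circ> Some) c)"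
    "\<forall>P\<in>cube C u0 r. \<forall>c\<in>C. \<phi> 0 P c = P c"
    "\<forall>P\<in>cube C u0 r. \<forall>t. \<bar>t\<bar> < T \<longrightarrow> \<phi> t P \<in> cube C u0 R \<and>
       (\<forall>c\<in>C. ((\<lambda>t. \<phi> t P c) has_real_derivative V c (\<phi> t P)) (at t))"
    "\<forall>P\<in>cube C u0 r. \<forall>s t. \<bar>s\<bar> < T \<longrightarrow> \<bar>t\<bar> < T \<longrightarrow> \<phi> s P \<in> cube C u0 r \<longrightarrow>
       (\<forall>c\<in>C. \<phi> t (\<phi> s P) c = \<phi> (t + s) P c)"
    using local_flow_exists[where V=V, OF finite_C ck_V u0C open_depends_cubeC]
    by - (drule meta_mp, assumption, elim exE conjE, rule that)
  interpret lb_flow U X a b u0 \<rho> r R T \<phi>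
    by unfold_locales (use LB fl in simp_all)
  show ?thesis
  proof (intro exI[of _ W] exI[of _ \<Phi>] exI[of _ "slice D 0"] conjI allI)
    show "exponentiable_to U X W \<Phi>" by (rule exponentiable)
    show "open (slice D 0)" "depends_on (Jk 1) (slice D 0) (\<lambda>_. 0)" by (rule slice_open_depends[OF D_dom])+
    \<comment> \<open>\<open>u0\<close> lies in the slice y^1_a = q by the choice of
      \<open>q\<close>.\<close>
    have "Z u0 = u0" by (simp add: Z_def z_def)
    then show "u0 \<in> slice D 0" using \<rho>(1) fl(1,3) by (simp add: slice_def D_def cube_def)
    show "slice D 0 \<subseteq> flow_dom W" using flow_dom_W by (simp add: slice_def)
    show "depends_on_time_and (Jk 1) (W Cx) (\<lambda>t u. \<Phi> t u Cx)"
      using tck_depends[OF tck_h[OF C_simps(1)]] by (simp add: W_simps prolonged_simps)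
    show "depends_on_time_and (Jk 1) (W (Cy L 0)) (\<lambda>t u. \<Phi> t u (Cy L 0))" for L
      using tck_depends[OF tck_h[OF C_simps(2)]] by (simp add: W_simps prolonged_simps)
  qed
qed

section \<open>Passage between first-order and infinite jets\<close>

lemma depends_jet1_vimage: "depends_on (Jk 1) (jet1 -` \<Omega>) (\<lambda>_. 0)"
proof (rule depends_on_zeroI)
  fix u v assume "u \<in> jet1 -` \<Omega>" and e: "\<And>i. i \<in> Jk 1 \<Longrightarrow> u i = v i"
  moreover have "jet1 u = jet1 v" using e by (simp add: jet1_def)
  ultimately show "v \<in> jet1 -` \<Omega>" by simp
qed

text \<open>The finite set of coordinates supplied by \<open>vector_field_on\<close> may go beyond
  J^1; this reduces it to the coordinates on which the function is known to depend.\<close>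

lemma ck_depends_weaken:
  assumes "ck n F U f" "depends_on G U f" "finite G"
  shows "ck n G U f"
  using assms
proof (induction n arbitrary: f)
  case 0
  then show ?case by (simp add: ck.simps)
next
  case (Suc n)
  then show ?case by (auto simp: ck.simps(2) intro: Suc.IH depends_on_pd)
qed

text \<open>\<open>j\<close> extends a first-order jet by zeros and is a continuous section of
  \<open>jet1\<close>; hence the preimage of \<open>N\<close> under \<open>j\<close> is an open
  subset of the image of \<open>N\<close>.\<close>

lemma interior_jet1_image:
  assumes N: "open N" "depends_on (Jk 1) N (\<lambda>_. 0)" "u0 \<in> N"
  shows "jet1 u0 \<in> interior (jet1 ` N)"
proof -
  define j :: "real \<times> (real^2) \<times> (real^2) \<Rightarrow> jet" where
    "j p = (\<lambda>c. case c of Cx \<Rightarrow> fst p | Cy L k \<Rightarrow> if k = 0 then fst (snd p) $ L else if k = 1 then snd (snd p) $ L else 0)" for p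
  have "continuous_on UNIV j"
  proof (rule continuous_on_coordinatewise_then_product)
    show "continuous_on UNIV (\<lambda>p. j p c)" for c
    proof (cases c)
      case (Cy L k)
      then show ?thesis by (cases "k = 0"; cases "k = 1") (auto simp: j_def intro!: continuous_intros)
    qed (auto simp: j_def intro!: continuous_intros)
  qed
  then have "open (j -` N)" by (rule open_vimage[OF N(1)])
  moreover have jet_j: "jet1 (j p) = p" for p by (simp add: jet1_def j_def vec_eq_iff prod_eq_iff)
  then have "j -` N \<subseteq> jet1 ` N" by (metis image_eqI subsetI vimageD)
  \<comment> \<open>The coordinates of \<open>u0\<close> of order at least two are lost under
    \<open>jet1\<close>, but membership in \<open>N\<close> does not involve them.\<close>
  moreover have "j (jet1 u0) \<in> N"
  proof (rule depends_onD(1)[OF N(2,3)])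
    fix c assume "c \<in> Jk 1"
    then show "u0 c = j (jet1 u0) c" by (cases c) (auto simp: j_def jet1_def le_Suc_eq One_nat_def)
  qed
  ultimately show ?thesis by (intro interiorI[of "j -` N"]) auto
qed

lemma continuous_on_jet1: "continuous_on UNIV jet1"
proof -
  have c: "continuous_on UNIV (\<lambda>u::jet. u c)" for c
    by (rule continuous_on_product_then_coordinatewise[OF continuous_on_id])
  show ?thesis unfolding jet1_def[abs_def] by (intro continuous_on_Pair continuous_on_vec_lambda c)
qed

theorem theorem9:
  fixes X :: field
    and \<Omega> :: "(real \<times> (real^2) \<times> (real^2)) set"
    and p :: "real \<times> (real^2) \<times> (real^2)"
  assumes "open \<Omega>" and "p \<in> \<Omega>"
    and "Lie_Backlund_on (jet1 -` \<Omega>) X"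
    and "depends_on J1_coords (jet1 -` \<Omega>) (X Cx)"
    and "\<And>L. depends_on J1_coords (jet1 -` \<Omega>) (X (Cy L 0))"
    and "\<exists>u K L. jet1 u = p \<and> Mmat X K L u \<noteq> 0"
    and "\<And>R u. jet1 u \<in> \<Omega> \<Longrightarrow> (\<Sum>P\<in>UNIV. Mmat X R P u * pd (Cy P 1) (X Cx) u) = 0"
    and "\<And>L R u. jet1 u \<in> \<Omega> \<Longrightarrow> (\<Sum>P\<in>UNIV. Mmat X R P u * pd (Cy P 1) (X (Cy L 0)) u) = 0"
    and "\<And>R u. jet1 u \<in> \<Omega> \<Longrightarrow> (\<Sum>P\<in>UNIV. Qmat X R P u * pd (Cy P 1) (X Cx) u) = 0"
    and "\<And>L R u. jet1 u \<in> \<Omega> \<Longrightarrow> (\<Sum>P\<in>UNIV. Qmat X R P u * pd (Cy P 1) (X (Cy L 0)) u) = 0"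
  shows "\<exists>W \<Phi>. exponentiable_to (jet1 -` \<Omega>) X W \<Phi> \<and>
           p \<in> interior (jet1 ` flow_dom W) \<and>
           depends_on_time_and J1_coords (W Cx) (\<lambda>t u. \<Phi> t u Cx) \<and>
           (\<forall>L. depends_on_time_and J1_coords (W (Cy L 0)) (\<lambda>t u. \<Phi> t u (Cy L 0)))"
proof -
  let ?U = "jet1 -` \<Omega>"
  have openU: "open ?U" by (rule open_vimage[OF assms(1) continuous_on_jet1])
  have smooth: "\<exists>F. \<forall>n. ck n F ?U (X c)" for c
    using assms(3) by (simp add: Lie_Backlund_on_def vector_field_on_def smooth_in_iff_ck)
  have ckX: "ck n (Jk 1) ?U (X Cx)" "ck n (Jk 1) ?U (X (Cy L 0))" for n L
    using smooth[of Cx] smooth[of "Cy L 0"] assms(4,5) ck_depends_weaken[OF _ _ finite_Jk]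
    unfolding J1_coords_Jk by blast+
  \<comment> \<open>\<open>a\<close> is the subscript of some nonzero entry of M and
    \<open>b\<close> will be the other index; this choice forces the entry M^b_a to be nonzero as
    well.\<close>
  obtain u0 K a where u0: "jet1 u0 = p" and M: "Mmat X K a u0 \<noteq> 0" using assms(6) by blast
  obtain b :: 2 where ab: "a \<noteq> b" by (metis (full_types) one_neq_zero)
  have u0U: "u0 \<in> ?U" using u0 assms(2) by simp
  interpret lb_field ?U X a b
    by unfold_locales (use openU depends_jet1_vimage ckX ab assms(7-10) in auto)
  \<comment> \<open>If the row \<open>b\<close> of \<open>M\<close> vanished in column \<open>a\<close>, then by (i) so would the row \<open>a\<close>.\<close>
  have "Mmat X b a u0 \<noteq> 0"
  proof
    assume 0: "Mmat X b a u0 = 0"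
    have "K = a \<or> K = b" using UNIV_2_eq[OF ab] by auto
    with 0 M have K: "K = a" by auto
    have e: "Mmat X a a u0 * pd ya f u0 + Mmat X a b u0 * pd yb f u0 = 0"
      if "f = X Cx \<or> f = X (Cy a 0)" for f
      using assms(7)[of u0 a] assms(8)[of u0 a a] u0 assms(2) that by (auto simp: sum_UNIV_2[OF ab])
    \<comment> \<open>The left-hand side is the entry (a, a) of the square of M, which vanishes by
      (i); so M^b_a = 0 would imply M^a_a = 0.\<close>
    have "Mmat X a a u0 * Mmat X a a u0 + Mmat X a b u0 * Mmat X b a u0 =
        (Mmat X a a u0 * pd ya (X (Cy a 0)) u0 + Mmat X a b u0 * pd yb (X (Cy a 0)) u0)
        - u0 ya * (Mmat X a a u0 * pd ya (X Cx) u0 + Mmat X a b u0 * pd yb (X Cx) u0)"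
      unfolding Mmat_def[of X _ a] by (simp add: algebra_simps)
    also have "\<dots> = 0" using e by simp
    finally show False using 0 M K by simp
  qed
  then have "u0 \<in> U1" using u0U by (simp add: U1_def matrices_Pm)
  from exponentiable_near[OF assms(3) this]
  obtain W \<Phi> N where W: "exponentiable_to ?U X W \<Phi>" and N: "open N" "depends_on (Jk 1) N (\<lambda>_. 0)" "u0 \<in> N"
    and sub: "N \<subseteq> flow_dom W"
    and dep: "depends_on_time_and (Jk 1) (W Cx) (\<lambda>t u. \<Phi> t u Cx)"
      "\<forall>L. depends_on_time_and (Jk 1) (W (Cy L 0)) (\<lambda>t u. \<Phi> t u (Cy L 0))"
    by (elim exE conjE) (rule that)
  have "p \<in> interior (jet1 ` flow_dom W)"
    using interior_jet1_image[OF N] interior_mono[OF image_mono[OF sub], of jet1] u0 by blast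
  then show ?thesis using W dep unfolding J1_coords_Jk by blast
qed

end
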